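(* Let $\Omega\subset\mathbb{R}^2$ be a bounded strictly convex domain whose boundary is a $C^2$ curve of positive curvature, such that the outer billiard map $B^{\rm out}_\Omega$ admits an invariant curve consisting of periodic points of period $3$. Then $$\beta^{\rm out}_\Omega\Big(\frac13\Big)\ \ge\ \frac{|\Omega|}{\pi}\,\beta^{\rm out}_{\mathcal D}\Big(\frac13\Big),$$ where $|\Omega|$ is the area of $\Omega$ and $\mathcal D$ is the unit disk. Moreover, equality holds if and only if $\Omega$ is an ellipse.
   Context: Outer billiard: for $p\in\mathbb{R}^2\setminus\overline\Omega$, consider the tangent line from $p$ to $\partial\Omega$ at a point $q$ such that the vector $\vec{pq}$ has the same orientation as $\partial\Omega$ at $q$; then $B^{\rm out}_\Omega(p)$ is the point on this line such that $q$ is the midpoint of $p$ and $B^{\rm out}_\Omega(p)$. It is an area-preserving positive twist map of the exterior of $\Omega$. "Invariant curve" means a closed invariant curve in the exterior of $\Omega$ winding once around $\Omega$. $\beta^{\rm out}_\Omega$ denotes Mather's $\beta$-function (minimal average action) of $B^{\rm out}_\Omega$, where the action of a periodic orbit is the area of the corresponding circumscribed polygon. For coprime $p,q$ with $p/q\in(0,\frac12)$ one has $\beta^{\rm out}_\Omega(p/q)=\frac1q\,\mathcal A$, with $\mathcal A$ the minimal area of $q$-gons with winding number $p$ circumscribed about $\Omega$. In particular $\beta^{\rm out}_\Omega(1/3)=\frac13\min\{\text{area of triangles circumscribed about }\Omega\}$. For the unit disk, $\beta^{\rm out}_{\mathcal D}(\rho)=\tan(\pi\rho)$, so $\beta^{\rm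 out}_{\mathcal D}(1/3)=\sqrt3$. *)

theory Defs
  imports "HOL-Complex_Analysis.Complex_Analysis"
begin

text \<open>The Euclidean plane is modelled by the type \<^typ>\<open>complex\<close>.\<close>

definition cross2 :: "complex \<Rightarrow> complex \<Rightarrow> real" where
  "cross2 a b = Re a * Im b - Im a * Re b"


section \<open>Strictly convex domains with positively curved boundary\<close>

definition strictly_convex_domain :: "complex set \<Rightarrow> bool" where
  "strictly_convex_domain \<Omega> \<longleftrightarrow>
     open \<Omega> \<and> connected \<Omega> \<and> \<Omega> \<noteq> {} \<and>
     (\<forall>x\<in>closure \<Omega>. \<forall>y\<in>closure \<Omega>. x \<noteq> y \<longrightarrow> open_segment x y \<subseteq> \<Omega>)"

definition signed_curvature :: "complex \<Rightarrow> complex \<Rightarrow> real" where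
  "signed_curvature v a = cross2 v a / norm v ^ 3"

text \<open>
  A regular \<open>C\<^sup>2\<close> simple closed parametrization \<open>c\<close> (of period \<open>L\<close>, with derivatives \<open>c'\<close> and
  \<open>c''\<close>) of the boundary.  Positivity of the signed curvature also fixes the orientation:
  the boundary is traversed counterclockwise.
\<close>
definition pos_curved_boundary_param ::
    "complex set \<Rightarrow> real \<Rightarrow> (real \<Rightarrow> complex) \<Rightarrow> (real \<Rightarrow> complex) \<Rightarrow> (real \<Rightarrow> complex) \<Rightarrow> bool" where
  "pos_curved_boundary_param \<Omega> L c c' c'' \<longleftrightarrow>
     L > 0 \<and> (\<forall>t. c (t + L) = c t) \<and> inj_on c {0..<L} \<and> range c = frontier \<Omega> \<and>
     (\<forall>t. (c has_vector_derivative c' t) (at t)) \<and>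
     (\<forall>t. (c' has_vector_derivative c'' t) (at t)) \<and>
     continuous_on UNIV c'' \<and>
     (\<forall>t. c' t \<noteq> 0 \<and> signed_curvature (c' t) (c'' t) > 0)"

definition C2_pos_curved_boundary :: "complex set \<Rightarrow> bool" where
  "C2_pos_curved_boundary \<Omega> \<longleftrightarrow> (\<exists>L c c' c''. pos_curved_boundary_param \<Omega> L c c' c'')"


section \<open>The outer billiard map\<close>

definition pos_tangent_vector :: "complex set \<Rightarrow> complex \<Rightarrow> complex \<Rightarrow> bool" where
  "pos_tangent_vector \<Omega> q v \<longleftrightarrow>
     (\<exists>L c c' c'' t r. pos_curved_boundary_param \<Omega> L c c' c'' \<and> c t = q \<and> r > 0 \<and> v = r *\<^sub>R c' t)"

text \<open>Only meaningful for \<open>p\<close> outside the closure of \<open>\<Omega>\<close>.\<close>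
definition outer_billiard :: "complex set \<Rightarrow> complex \<Rightarrow> complex" where
  "outer_billiard \<Omega> p =
     (let q = (THE q. q \<in> frontier \<Omega> \<and> pos_tangent_vector \<Omega> q (q - p)) in 2 *\<^sub>R q - p)"

definition invariant_curve :: "complex set \<Rightarrow> complex set \<Rightarrow> bool" where
  "invariant_curve \<Omega> \<Gamma> \<longleftrightarrow>
     (\<exists>g. path g \<and> pathfinish g = pathstart g \<and> path_image g = \<Gamma> \<and>
          \<Gamma> \<inter> closure \<Omega> = {} \<and> (\<forall>z\<in>\<Omega>. winding_number g z = 1)) \<and>
     outer_billiard \<Omega> ` \<Gamma> = \<Gamma>"

text \<open>Since the outer billiard map has no fixed points, 3 is automatically the least period.\<close>
definition consists_of_3_periodic_points :: "complex set \<Rightarrow> complex set \<Rightarrow> bool" where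
  "consists_of_3_periodic_points \<Omega> \<Gamma> \<longleftrightarrow> (\<forall>p\<in>\<Gamma>. (outer_billiard \<Omega> ^^ 3) p = p)"


section \<open>Mather's beta-function of the outer billiard map\<close>

text \<open>The boundary point with outer unit normal \<^term>\<open>cis \<theta>\<close>.\<close>
definition touch :: "complex set \<Rightarrow> real \<Rightarrow> complex" where
  "touch \<Omega> \<theta> = (THE x. x \<in> closure \<Omega> \<and> (\<forall>y\<in>closure \<Omega>. y \<bullet> cis \<theta> \<le> x \<bullet> cis \<theta>))"

text \<open>The intersection point of the tangent lines with outer normals \<^term>\<open>cis \<theta>\<close> and \<^term>\<open>cis \<phi>\<close>.\<close>
definition tangents_meet :: "complex set \<Rightarrow> real \<Rightarrow> real \<Rightarrow> complex" where
  "tangents_meet \<Omega> \<theta> \<phi> =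
     (THE P. (P - touch \<Omega> \<theta>) \<bullet> cis \<theta> = 0 \<and> (P - touch \<Omega> \<phi>) \<bullet> cis \<phi> = 0)"

text \<open>
  The generating function: the signed area of the quadrilateral with vertices \<open>0\<close>,
  \<^term>\<open>touch \<Omega> \<theta>\<close>, \<^term>\<open>tangents_meet \<Omega> \<theta> \<phi>\<close>, \<^term>\<open>touch \<Omega> \<phi>\<close>.  Summed over a periodic
  configuration it gives (shoelace formula) the area of the circumscribed polygon whose sides
  have the outer normals of the configuration, counted with multiplicity if the polygon winds
  around \<open>\<Omega>\<close> several times.  Another choice of the origin changes it only by a coboundary
  \<open>u \<phi> - u \<theta>\<close> with \<open>u\<close> periodic.
\<close>
definition gen_action :: "complex set \<Rightarrow> real \<Rightarrow> real \<Rightarrow> real" where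
  "gen_action \<Omega> \<theta> \<phi> =
     (cross2 (touch \<Omega> \<theta>) (tangents_meet \<Omega> \<theta> \<phi>) + cross2 (tangents_meet \<Omega> \<theta> \<phi>) (touch \<Omega> \<phi>)) / 2"

definition segment_action :: "complex set \<Rightarrow> (int \<Rightarrow> real) \<Rightarrow> int \<Rightarrow> int \<Rightarrow> real" where
  "segment_action \<Omega> x m n = (\<Sum>i\<in>{m..<n}. gen_action \<Omega> (x i) (x (i + 1)))"

definition admissible_on :: "int set \<Rightarrow> (int \<Rightarrow> real) \<Rightarrow> bool" where
  "admissible_on I x \<longleftrightarrow> (\<forall>i\<in>I. 0 < x (i + 1) - x i \<and> x (i + 1) - x i < pi)"

definition minimal_configuration :: "complex set \<Rightarrow> (int \<Rightarrow> real) \<Rightarrow> bool" where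
  "minimal_configuration \<Omega> x \<longleftrightarrow>
     admissible_on UNIV x \<and>
     (\<forall>m n y. m < n \<and> admissible_on {m..<n} y \<and> y m = x m \<and> y n = x n \<longrightarrow>
        segment_action \<Omega> x m n \<le> segment_action \<Omega> y m n)"

definition has_rotation_number :: "(int \<Rightarrow> real) \<Rightarrow> real \<Rightarrow> bool" where
  "has_rotation_number x \<rho> \<longleftrightarrow>
     ((\<lambda>n. x n / (2 * pi * of_int n)) \<longlongrightarrow> \<rho>) at_top \<and>
     ((\<lambda>n. x n / (2 * pi * of_int n)) \<longlongrightarrow> \<rho>) at_bot"

definition has_average_action :: "complex set \<Rightarrow> (int \<Rightarrow> real) \<Rightarrow> real \<Rightarrow> bool" where
  "has_average_action \<Omega> x b \<longleftrightarrow>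
     (\<lambda>N::nat. segment_action \<Omega> x (- int N) (int N) / (2 * real N)) \<longlonglongrightarrow> b"

text \<open>
  The minimal average action: the average action of the minimal configurations of rotation
  number \<open>\<rho>\<close>, for \<open>0 < \<rho> < 1/2\<close>.  By Aubry--Mather theory these configurations exist and all have
  the same average action; for \<open>\<rho> = p/q\<close> in lowest terms it is \<open>1/q\<close> times the minimal area of the
  circumscribed \<open>q\<close>-gons with winding number \<open>p\<close>.
\<close>
definition beta_out :: "complex set \<Rightarrow> real \<Rightarrow> real" where
  "beta_out \<Omega> \<rho> =
     (THE b. \<exists>x. minimal_configuration \<Omega> x \<and> has_rotation_number x \<rho> \<and> has_average_action \<Omega> x b)"


section \<open>Ellipses\<close>

definition is_ellipse :: "complex set \<Rightarrow> bool" where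
  "is_ellipse \<Omega> \<longleftrightarrow>
     (\<exists>z0 \<alpha> a b. a > 0 \<and> b > 0 \<and>
        \<Omega> = {z0 + cis \<alpha> * Complex x y | x y. (x / a)\<^sup>2 + (y / b)\<^sup>2 < 1})"

end

theory Submission
  imports Defs
begin

text \<open>
Let \<open>K\<close> be the closure of \<open>\<Omega>\<close>. A triangle circumscribed about \<open>K\<close> that touches \<open>K\<close> at the midpoints
\<open>p\<close>, \<open>q\<close>, \<open>r\<close> of its sides is four times as large as \<open>p q r\<close>, and the tangent at each of the three
points is parallel to the opposite side of \<open>p q r\<close>. Such triples are called midtangent below. They are
exactly the orbits of period 3 of the outer billiard map, and they include every inscribed triangle of
maximal area.

The invariant curve passes once around \<open>\<Omega>\<close>, hence meets every tangent ray, hence there is a midtangent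
triple through every boundary point (\<open>invariant_curve_tri_body\<close>). Two midtangent triples with a common
vertex and the same tangent there coincide, because each one lies in the circumscribed triangle of the other
(\<open>midtangent_unique\<close>). So the normals of one side and of the next are related by an increasing
homeomorphism \<open>\<sigma>\<close> of the line with \<open>\<sigma> \<circ> \<sigma> \<circ> \<sigma> = (\<lambda>\<theta>. \<theta> + 2 * pi)\<close>: the billiard map is
integrable along the curve.

A calibration turns this into information on minimizers. With \<open>calib\<close> an antiderivative along the graph
of \<open>\<sigma>\<close>, the generating function satisfies \<open>gen_action \<theta> \<phi> \<ge> const + potential \<phi> - potential \<theta>\<close>, with
equality for \<open>\<phi> = \<sigma> \<theta>\<close>. Orbits of \<open>\<sigma>\<close> are therefore minimal configurations. Conversely a minimal
configuration of rotation number 1/3 cannot have larger average action, since it competes with orbits of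
\<open>\<theta> \<mapsto> \<sigma> \<theta> + e\<close> for small \<open>e\<close>. This gives \<open>beta_out_area\<close>: the value of \<open>beta_out \<Omega> (1/3)\<close> is
4/3 of the area of any midtangent triple, so all of them, and in particular the largest inscribed
triangle, have one and the same area.

It remains to bound the largest inscribed triangle from below, which is a theorem of Sas. Parametrize the
boundary by \<open>\<phi>\<close> so that the abscissa is an affine function of \<open>cos \<phi>\<close>. The area of the inscribed triangle
with parameters \<open>\<phi>\<close>, \<open>\<phi> + 2 * pi / 3\<close>, \<open>\<phi> + 4 * pi / 3\<close> has an average over \<open>\<phi>\<close> that depends on the area of
\<open>\<Omega>\<close> alone (\<open>sas_average\<close>), and the largest inscribed triangle is at least as large as the average. In the
case of equality all these triangles are maximal, hence midtangent; this is a linear functional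
differential equation for the ordinate whose only periodic solutions are
\<open>c + A * cos \<phi> + B * sin \<phi>\<close>, and the boundary is an ellipse (\<open>extremal_trigonometric\<close>). For an ellipse all
triangles of Sas are affinely regular and have the same area, so equality holds.
\<close>

section \<open>Support lines of a strictly convex body\<close>

text \<open>
The counterpart of \<open>pos_tangent_vector\<close> in terms of the set \<open>K\<close> alone.
\<close>

definition left_support :: "complex set \<Rightarrow> complex \<Rightarrow> complex \<Rightarrow> bool" where
  "left_support K q v \<longleftrightarrow> q \<in> K \<and> v \<noteq> 0 \<and> (\<forall>z\<in>K. 0 \<le> cross2 v (z - q))"

text \<open>
The counterclockwise tangent direction at the boundary point with outer normal \<open>cis \<theta>\<close>.
\<close>

definition tangent_dir :: "real \<Rightarrow> complex" where
  "tangent_dir \<theta> = \<i> * cis \<theta>"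

text \<open>
The lines through the vertices parallel to the opposite sides support \<open>K\<close>. They bound a triangle whose
sides have \<open>p\<close>, \<open>q\<close>, \<open>r\<close> as midpoints; it is circumscribed about \<open>K\<close> and four times as large.
\<close>

definition midtangent_triangle :: "complex set \<Rightarrow> complex \<Rightarrow> complex \<Rightarrow> complex \<Rightarrow> bool" where
  "midtangent_triangle K p q r \<longleftrightarrow>
     left_support K p (q - r) \<and> left_support K q (r - p) \<and> left_support K r (p - q)"

lemma cross2_simps [simp]:
  "cross2 (a + b) c = cross2 a c + cross2 b c" "cross2 c (a + b) = cross2 c a + cross2 c b"
  "cross2 (a - b) c = cross2 a c - cross2 b c" "cross2 c (a - b) = cross2 c a - cross2 c b"
  "cross2 (- a) c = - cross2 a c" "cross2 c (- a) = - cross2 c a"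
  "cross2 (s *\<^sub>R a) c = s * cross2 a c" "cross2 c (s *\<^sub>R a) = s * cross2 c a"
  "cross2 a a = 0" "cross2 0 a = 0" "cross2 a 0 = 0"
  by (simp_all add: cross2_def algebra_simps)

lemma cross2_commute: "cross2 a b = - cross2 b a"
  by (simp add: cross2_def)

lemma abs_cross2_le: "\<bar>cross2 a b\<bar> \<le> norm a * norm b"
proof -
  have "cross2 a b = Im (cnj a * b)" by (simp add: cross2_def)
  then have "\<bar>cross2 a b\<bar> \<le> norm (cnj a * b)" by (metis abs_Im_le_cmod)
  then show ?thesis by (simp add: norm_mult)
qed

lemma cross2_eq_0_iff:
  assumes "v \<noteq> 0"
  shows "cross2 v w = 0 \<longleftrightarrow> (\<exists>r. w = r *\<^sub>R v)"
proof
  assume "cross2 v w = 0"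
  then have "Im (w / v) = 0" by (simp add: cross2_def Im_divide algebra_simps)
  then have "w / v = of_real (Re (w / v))" by (simp add: complex_eq_iff)
  then have "w = Re (w / v) *\<^sub>R v" using assms by (metis nonzero_divide_eq_eq scaleR_conv_of_real)
  then show "\<exists>r. w = r *\<^sub>R v" ..
qed auto

lemma cross2_tangent_dir: "cross2 (tangent_dir \<theta>) z = - (z \<bullet> cis \<theta>)"
  by (simp add: cross2_def tangent_dir_def inner_complex_def)

lemma cross2_tangent_dirs: "cross2 (tangent_dir \<theta>) (tangent_dir \<phi>) = sin (\<phi> - \<theta>)"
  by (simp add: cross2_def tangent_dir_def sin_diff algebra_simps)

lemma tangent_dir_neq_0 [simp]: "tangent_dir \<theta> \<noteq> 0"
  and norm_tangent_dir [simp]: "norm (tangent_dir \<theta>) = 1"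
  by (simp_all add: tangent_dir_def norm_mult)

lemma tangent_dir_2pi [simp]: "tangent_dir (\<theta> + 2 * pi) = tangent_dir \<theta>"
  by (simp add: tangent_dir_def cis.ctr)

lemma tangent_dir_inner:
  "tangent_dir \<theta> \<bullet> cis \<phi> = sin (\<phi> - \<theta>)" "cis \<theta> \<bullet> cis \<phi> = cos (\<phi> - \<theta>)"
  by (simp_all add: tangent_dir_def inner_complex_def sin_diff cos_diff algebra_simps)

lemma ex_tangent_dir:
  assumes "v \<noteq> 0"
  obtains r \<theta> where "r > 0" "v = r *\<^sub>R tangent_dir \<theta>" "a \<le> \<theta>" "\<theta> < a + 2 * pi"
proof -
  define w where "w = v / (\<i> * cis a)"
  have v: "v = \<i> * cis a * w" by (simp add: w_def)
  have w: "w = of_real (norm v) * cis (Arg2pi w)"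
    using Arg2pi_eq[of w] by (simp add: v norm_mult exp_eq_polar mult.commute)
  have "norm v *\<^sub>R tangent_dir (a + Arg2pi w) = \<i> * cis a * (of_real (norm v) * cis (Arg2pi w))"
    by (simp add: tangent_dir_def scaleR_conv_of_real cis_mult[symmetric] mult_ac)
  also have "\<dots> = v" by (simp only: w[symmetric] v[symmetric])
  finally show thesis
    using that[of "norm v" "a + Arg2pi w"] assms Arg2pi_ge_0[of w] Arg2pi_lt_2pi[of w] by simp
qed

lemma tangent_dir_eq_iff:
  assumes "r > 0" "s > 0" "r *\<^sub>R tangent_dir \<theta> = s *\<^sub>R tangent_dir \<phi>"
  shows "r = s" "tangent_dir \<theta> = tangent_dir \<phi>"
proof -
  have "norm (r *\<^sub>R tangent_dir \<theta>) = norm (s *\<^sub>R tangent_dir \<phi>)" using assms(3) by simp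
  then show "r = s" using assms(1,2) by simp
  then show "tangent_dir \<theta> = tangent_dir \<phi>" using assms by simp
qed

lemma tangent_dir_inj:
  assumes "tangent_dir \<theta> = tangent_dir \<phi>" "\<bar>\<theta> - \<phi>\<bar> < 2 * pi"
  shows "\<theta> = \<phi>"
proof -
  have "cis \<theta> = cis \<phi>" using assms(1) by (simp add: tangent_dir_def)
  then have "sin \<theta> = sin \<phi>" "cos \<theta> = cos \<phi>" by (simp_all add: complex_eq_iff)
  then obtain n :: int where n: "\<theta> = \<phi> + 2 * pi * n" using sin_cos_eq_iff by auto
  with assms(2) have "\<bar>real_of_int n\<bar> * (2 * pi) < 1 * (2 * pi)"
    by (simp add: abs_mult mult.commute)
  then have "\<bar>real_of_int n\<bar> < 1" using mult_less_cancel_right_pos[of "2*pi"] by simp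
  then have "n = 0" by linarith
  with n show ?thesis by simp
qed

locale convex_body =
  fixes \<Omega> :: "complex set"
  assumes bounded: "bounded \<Omega>" and scd: "strictly_convex_domain \<Omega>"
begin

abbreviation "K \<equiv> closure \<Omega>"
abbreviation "\<tau> \<equiv> touch \<Omega>"

lemma open_\<Omega>: "open \<Omega>" and nonempty: "\<Omega> \<noteq> {}"
  and segment: "\<lbrakk>x \<in> K; y \<in> K; x \<noteq> y\<rbrakk> \<Longrightarrow> open_segment x y \<subseteq> \<Omega>"
  using scd by (auto simp: strictly_convex_domain_def)

lemma subset_K: "z \<in> \<Omega> \<Longrightarrow> z \<in> K"
  using closure_subset by blast

lemma compact_K: "compact K" using bounded by simp

lemma convex_\<Omega>: "convex \<Omega>"
  unfolding convex_contains_open_segment using segment subset_K by (metis empty_subsetI open_segment_idem)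

lemma interior_K: "interior K = \<Omega>"
  using convex_interior_closure[OF convex_\<Omega>] open_\<Omega> by (simp add: interior_open)

lemma frontier_eq: "frontier \<Omega> = K - \<Omega>"
  by (simp add: frontier_def interior_open open_\<Omega>)

text \<open>
The point of the disk that lies farthest to the right still has to lie on the left of the line.
\<close>

lemma left_support_cball:
  assumes "left_support K q v" "cball z e \<subseteq> K" "0 \<le> e"
  shows "e * norm v \<le> cross2 v (z - q)"
proof -
  have v: "v \<noteq> 0" and nn: "\<And>z. z \<in> K \<Longrightarrow> 0 \<le> cross2 v (z - q)"
    using assms(1) by (auto simp: left_support_def)
  define w where "w = z - (e / norm v) *\<^sub>R (\<i> * v)"
  have "dist z w \<le> e" using assms v by (simp add: w_def dist_norm norm_mult)
  then have "w \<in> K" using assms by auto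
  from nn[OF this] have "0 \<le> cross2 v (z - q) - (e / norm v) * cross2 v (\<i> * v)"
    by (simp add: w_def)
  moreover have "cross2 v (\<i> * v) = norm v * norm v"
    unfolding power2_eq_square[symmetric] cmod_power2 by (simp add: cross2_def power2_eq_square)
  ultimately show ?thesis using v by simp
qed

lemma ex_cball:
  assumes "z \<in> \<Omega>"
  obtains e where "e > 0" "cball z e \<subseteq> K"
  using open_contains_cball[of \<Omega>] assms open_\<Omega> subset_K by blast

lemma left_support_pos:
  assumes "left_support K q v" "z \<in> \<Omega>"
  shows "0 < cross2 v (z - q)"
proof -
  obtain e where e: "e > 0" "cball z e \<subseteq> K"
    using ex_cball assms(2) by blast
  then have "0 < e * norm v" using assms(1) by (simp add: left_support_def)
  also have "\<dots> \<le> cross2 v (z - q)" using left_support_cball[OF assms(1) e(2)] e by simp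
  finally show ?thesis .
qed

text \<open>
If \<open>z\<close> and \<open>q\<close> were different points of \<open>K\<close> on the line, their midpoint would be an interior point on it.
\<close>

lemma left_support_unique_point:
  assumes "left_support K q v" "z \<in> K" "cross2 v (z - q) = 0"
  shows "z = q"
proof (rule ccontr)
  assume "z \<noteq> q"
  then have m: "midpoint z q \<in> \<Omega>"
    using segment[of z q] assms by (auto simp: left_support_def)
  have "cross2 v (midpoint z q - q) = cross2 v (z - q) / 2"
    by (simp add: midpoint_def algebra_simps)
  with left_support_pos[OF assms(1) m] assms(3) show False by simp
qed

lemma left_support_frontier:
  assumes "left_support K q v" shows "q \<in> frontier \<Omega>"
  using left_support_pos[OF assms, of q] assms by (auto simp: frontier_eq left_support_def)

lemma touch_unique: "\<exists>!x. x \<in> K \<and> (\<forall>y\<in>K. y \<bullet> cis \<theta> \<le> x \<bullet> cis \<theta>)"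
proof -
  have "\<exists>x\<in>K. \<forall>y\<in>K. y \<bullet> cis \<theta> \<le> x \<bullet> cis \<theta>"
    by (intro continuous_attains_sup compact_K) (use nonempty in \<open>auto intro!: continuous_intros\<close>)
  then obtain x where x: "x \<in> K" "\<And>y. y \<in> K \<Longrightarrow> y \<bullet> cis \<theta> \<le> x \<bullet> cis \<theta>" by blast
  have sup: "left_support K x (tangent_dir \<theta>)"
    using x by (simp add: left_support_def cross2_tangent_dir inner_diff_left)
  show ?thesis
  proof (rule ex1I[of _ x])
    fix z assume z: "z \<in> K \<and> (\<forall>y\<in>K. y \<bullet> cis \<theta> \<le> z \<bullet> cis \<theta>)"
    then have "z \<bullet> cis \<theta> = x \<bullet> cis \<theta>" using x by (simp add: eq_iff)
    then show "z = x"
      using left_support_unique_point[OF sup, of z] z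
      by (simp add: cross2_tangent_dir inner_diff_left)
  qed (use x in blast)
qed

lemma touch_in: "\<tau> \<theta> \<in> K" and touch_max: "y \<in> K \<Longrightarrow> y \<bullet> cis \<theta> \<le> \<tau> \<theta> \<bullet> cis \<theta>"
  using theI'[OF touch_unique[of \<theta>]] unfolding touch_def by blast+

lemma touch_eqI:
  assumes "x \<in> K" "\<And>y. y \<in> K \<Longrightarrow> y \<bullet> cis \<theta> \<le> x \<bullet> cis \<theta>"
  shows "\<tau> \<theta> = x"
  using touch_unique[of \<theta>] assms touch_in touch_max by blast

lemma left_support_touch: "left_support K (\<tau> \<theta>) (tangent_dir \<theta>)"
  using touch_in touch_max by (simp add: left_support_def cross2_tangent_dir inner_diff_left)

lemma left_support_scale:
  assumes "r > 0" shows "left_support K q (r *\<^sub>R v) \<longleftrightarrow> left_support K q v"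
  using assms by (auto simp: left_support_def zero_le_mult_iff simp del: cross2_simps(4))

lemma left_support_imp_touch:
  assumes "left_support K q (r *\<^sub>R tangent_dir \<theta>)" "r > 0"
  shows "\<tau> \<theta> = q"
proof (rule touch_eqI)
  have *: "left_support K q (tangent_dir \<theta>)" using assms left_support_scale by blast
  then show "q \<in> K" by (simp add: left_support_def)
  fix y assume "y \<in> K"
  then show "y \<bullet> cis \<theta> \<le> q \<bullet> cis \<theta>"
    using * by (simp add: left_support_def cross2_tangent_dir inner_diff_left)
qed

lemma touch_cong: "tangent_dir \<theta> = tangent_dir \<phi> \<Longrightarrow> \<tau> \<theta> = \<tau> \<phi>"
  by (simp add: touch_def tangent_dir_def)

lemma touch_2pi [simp]: "\<tau> (\<theta> + 2 * pi) = \<tau> \<theta>"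
  by (rule touch_cong) simp

text \<open>
The maximum of \<open>y \<bullet> cis \<theta>\<close> over the compact set \<open>K\<close> is attained at one point only, so the graph of the
maximizer is cut out by closed conditions.
\<close>

lemma continuous_touch: "continuous_on UNIV \<tau>"
proof (rule continuous_from_closed_graph[OF compact_K])
  show "\<tau> \<in> UNIV \<rightarrow> K" using touch_in by auto
  have "(\<lambda>x. (x, \<tau> x)) ` UNIV = {p. snd p \<in> K} \<inter> (\<Inter>y\<in>K. {p. y \<bullet> cis (fst p) \<le> snd p \<bullet> cis (fst p)})"
    using touch_in touch_max touch_eqI by (auto simp: image_iff) 
  moreover have "closed {p :: real \<times> complex. snd p \<in> K}"
    using closed_vimage_snd[of K] by (simp add: vimage_def)
  moreover have "closed (\<Inter>y\<in>K. {p::real \<times> complex. y \<bullet> cis (fst p) \<le> snd p \<bullet> cis (fst p)})"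
    by (intro closed_INT ballI closed_Collect_le continuous_intros)
  ultimately show "closed ((\<lambda>x. (x, \<tau> x)) ` UNIV)" by (simp only: closed_Int)
qed

lemma isCont_touch: "isCont \<tau> \<theta>"
  using continuous_touch by (simp add: continuous_on_eq_continuous_at)

end

section \<open>Triangles with tangent midpoints\<close>

context convex_body begin

lemma midtangent_cyclic:
  "midtangent_triangle K p q r \<Longrightarrow> midtangent_triangle K q r p"
  by (simp add: midtangent_triangle_def)

lemma midtangent_area_pos:
  assumes "midtangent_triangle K p q r"
  shows "0 < cross2 (q - p) (r - p)"
proof -
  have p: "left_support K p (q - r)" and q: "q \<in> K" and "p - q \<noteq> 0"
    using assms by (auto simp: midtangent_triangle_def left_support_def)
  then have "0 \<le> cross2 (q - r) (q - p)" "cross2 (q - r) (q - p) \<noteq> 0"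
    using left_support_unique_point[OF p q] unfolding left_support_def by auto
  moreover have "cross2 (q - r) (q - p) = cross2 (q - p) (r - p)"
    by (simp add: cross2_def algebra_simps)
  ultimately show ?thesis by simp
qed

text \<open>
The sum of half the side length times the distance from \<open>z\<close>, over the three sides, is the area of the
circumscribed triangle. If \<open>z\<close> is the centre of a disk in \<open>K\<close>, all distances are at least \<open>e\<close>, while the
area is at most half the product of two sides; so no side can be short. This keeps limits of midtangent
triangles nondegenerate.
\<close>

lemma midtangent_side_bound:
  assumes "midtangent_triangle K p q r" "cball z e \<subseteq> K" "0 \<le> e"
  shows "e \<le> 2 * norm (p - q)"
proof -
  have s: "left_support K p (q - r)" "left_support K q (r - p)" "left_support K r (p - q)"
    using assms by (auto simp: midtangent_triangle_def)
  then have r: "norm (r - p) > 0" by (simp add: left_support_def)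
  have "e * norm (q - r) + e * norm (r - p) + e * norm (p - q)
      \<le> cross2 (q - r) (z - p) + cross2 (r - p) (z - q) + cross2 (p - q) (z - r)"
    using s[THEN left_support_cball, OF assms(2,3)] by linarith
  also have "\<dots> = 2 * cross2 (q - p) (r - p)"
    by (simp add: cross2_def algebra_simps)
  finally have "e * norm (q - r) + e * norm (r - p) + e * norm (p - q)
      \<le> 2 * cross2 (q - p) (r - p)" .
  moreover have "2 * cross2 (q - p) (r - p) \<le> 2 * (norm (p - q) * norm (r - p))"
    using abs_cross2_le[of "q - p" "r - p"] by (simp add: norm_minus_commute)
  moreover have "0 \<le> e * norm (q - r)" "0 \<le> e * norm (p - q)" using assms(3) by auto
  ultimately have "e * norm (r - p) \<le> (2 * norm (p - q)) * norm (r - p)" by linarith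
  then show ?thesis using r by simp
qed

text \<open>
With \<open>x = b / a\<close> and \<open>y = h / H\<close> the hypotheses read \<open>x + y \<le> 2\<close> and \<open>x + y \<le> 2 * x * y\<close>. Together with the
inequality between the arithmetic and the geometric mean they leave only \<open>x = y = 1\<close>.
\<close>

lemma midtangent_nested_sum:
  fixes a H b h :: real
  assumes pos: "a > 0" "H > 0" "b > 0" "h > 0"
    and 1: "b * H + a * h \<le> 2 * (a * H)" and 2: "a * h + b * H \<le> 2 * (b * h)"
  shows "b * H + a * h = 2 * (a * H)" "a * h + b * H = 2 * (b * h)"
proof -
  let ?x = "b * H" and ?y = "a * h"
  have "(?x + ?y) * (?x + ?y) \<le> (2 * (a * H)) * (2 * (b * h))"
    using assms by (intro mult_mono) (auto simp: add.commute)
  then have "(?x - ?y)\<^sup>2 \<le> 0" by (simp add: power2_eq_square algebra_simps)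
  then have xy: "?x = ?y" by simp
  have "a * H \<ge> ?y" "b * h \<ge> ?y" using 1 2 xy by auto
  then have "H \<ge> h" "b \<ge> a" using pos by auto
  moreover have "b * H \<le> a * H" using 1 xy by auto
  then have "b \<le> a" using pos by auto
  ultimately have "a = b" by simp
  with xy pos have "H = h" by simp
  show "b * H + a * h = 2 * (a * H)" "a * h + b * H = 2 * (b * h)"
    using \<open>a = b\<close> \<open>H = h\<close> by auto
qed

text \<open>
Measured in units of \<open>norm v\<close>, the sides opposite to the common vertex have the lengths \<open>a\<close>, \<open>b\<close>; let \<open>H\<close>, \<open>h\<close> be
proportional to the heights. That the
second triangle lies in the circumscribed triangle of the first bounds its side by
\<open>b \<le> a * (2 - h / H)\<close>; with the roles exchanged, \<open>a \<le> b * (2 - H / h)\<close>. Both can only hold with equality,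
and then the vertices lie on the same support lines.
\<close>

lemma midtangent_unique:
  assumes 1: "midtangent_triangle K p q r" and 2: "midtangent_triangle K p q' r'"
    and dir: "q - r = a *\<^sub>R v" "q' - r' = b *\<^sub>R v" "a > 0" "b > 0"
  shows "q' = q" "r' = r"
proof -
  define H where "H = cross2 v (r - p)"
  define h where "h = cross2 v (r' - p)"
  have q: "q = r + a *\<^sub>R v" "q' = r' + b *\<^sub>R v" using dir by (simp_all add: algebra_simps)
  have s: "left_support K q (r - p)" "left_support K r (p - q)"
    "left_support K q' (r' - p)" "left_support K r' (p - q')"
    using 1 2 by (auto simp: midtangent_triangle_def)
  then have in_K: "q \<in> K" "r \<in> K" "q' \<in> K" "r' \<in> K" by (auto simp: left_support_def)
  have "0 < a * H" "0 < b * h"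
    using midtangent_area_pos[OF 1] midtangent_area_pos[OF 2]
    by (simp_all add: H_def h_def q cross2_def algebra_simps)
  then have pos: "H > 0" "h > 0" using dir by (auto simp: zero_less_mult_iff)
  have nn: "0 \<le> cross2 (r - p) (q' - q)" "0 \<le> cross2 (p - q) (r' - r)"
    "0 \<le> cross2 (r' - p) (q - q')" "0 \<le> cross2 (p - q') (r - r')"
    using s in_K by (auto simp: left_support_def simp del: cross2_simps)
  have e: "cross2 (r - p) (q' - q) + cross2 (p - q) (r' - r) = 2 * (a * H) - (b * H + a * h)"
     "cross2 (r' - p) (q - q') + cross2 (p - q') (r - r') = 2 * (b * h) - (a * h + b * H)"
    unfolding H_def h_def q by (simp_all add: cross2_def algebra_simps)
  then have "b * H + a * h = 2 * (a * H)"
    using midtangent_nested_sum[OF dir(3) pos(1) dir(4) pos(2)] nn by linarith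
  with e nn have "cross2 (r - p) (q' - q) = 0" "cross2 (p - q) (r' - r) = 0" by linarith+
  then show "q' = q" "r' = r" using left_support_unique_point s in_K by blast+
qed

text \<open>
A midtangent triangle recorded by the angles of its outer normals, lifted to the real line in
counterclockwise order: one period of an orbit of period 3.
\<close>

definition critical :: "real \<Rightarrow> real \<Rightarrow> real \<Rightarrow> bool" where
  "critical \<theta> \<phi> \<psi> \<longleftrightarrow> \<theta> < \<phi> \<and> \<phi> < \<psi> \<and> \<psi> < \<theta> + 2 * pi \<and>
     (\<exists>r>0. \<tau> \<phi> - \<tau> \<psi> = r *\<^sub>R tangent_dir \<theta>) \<and>
     (\<exists>r>0. \<tau> \<psi> - \<tau> \<theta> = r *\<^sub>R tangent_dir \<phi>) \<and>
     (\<exists>r>0. \<tau> \<theta> - \<tau> \<phi> = r *\<^sub>R tangent_dir \<psi>)"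

lemma critical_midtangent:
  assumes "critical \<theta> \<phi> \<psi>"
  shows "midtangent_triangle K (\<tau> \<theta>) (\<tau> \<phi>) (\<tau> \<psi>)"
proof -
  obtain a b c where "a > 0" "\<tau> \<phi> - \<tau> \<psi> = a *\<^sub>R tangent_dir \<theta>"
     "b > 0" "\<tau> \<psi> - \<tau> \<theta> = b *\<^sub>R tangent_dir \<phi>" "c > 0" "\<tau> \<theta> - \<tau> \<phi> = c *\<^sub>R tangent_dir \<psi>"
    using assms by (auto simp: critical_def)
  then show ?thesis
    by (simp add: midtangent_triangle_def left_support_scale left_support_touch)
qed

lemma critical_cyclic: "critical \<theta> \<phi> \<psi> \<Longrightarrow> critical \<phi> \<psi> (\<theta> + 2 * pi)"
  unfolding critical_def by auto

lemma critical_2pi: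
  assumes "critical \<theta> \<phi> \<psi>"
  shows "critical (\<theta> + 2 * pi) (\<phi> + 2 * pi) (\<psi> + 2 * pi)"
  by (intro critical_cyclic assms)

lemma sin_pos_imp_less_pi:
  assumes "0 \<le> x" "x < 2 * pi" "0 < sin x"
  shows "0 < x" "x < pi"
proof -
  show "x < pi"
  proof (rule ccontr)
    assume "\<not> x < pi"
    then have "0 \<le> sin (x - pi)" using assms by (intro sin_ge_zero) auto
    with assms show False by simp
  qed
  show "0 < x" using assms by (cases "x = 0") auto
qed

lemma critical_gap:
  assumes "critical \<theta> \<phi> \<psi>"
  shows "\<phi> - \<theta> < pi"
proof -
  obtain a b where ab: "a > 0" "b > 0" "\<tau> \<phi> - \<tau> \<psi> = a *\<^sub>R tangent_dir \<theta>"
      "\<tau> \<psi> - \<tau> \<theta> = b *\<^sub>R tangent_dir \<phi>"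
    using assms by (auto simp: critical_def)
  have "cross2 (\<tau> \<phi> - \<tau> \<theta>) (\<tau> \<psi> - \<tau> \<theta>) = cross2 (\<tau> \<phi> - \<tau> \<psi>) (\<tau> \<psi> - \<tau> \<theta>)"
    by (simp add: cross2_def algebra_simps)
  also have "\<dots> = (a * b) * sin (\<phi> - \<theta>)"
    unfolding ab by (simp add: cross2_tangent_dirs)
  finally have "0 < sin (\<phi> - \<theta>)"
    using midtangent_area_pos[OF critical_midtangent[OF assms]] ab by (simp add: zero_less_mult_iff)
  then show ?thesis using sin_pos_imp_less_pi[of "\<phi> - \<theta>"] assms by (simp add: critical_def)
qed

text \<open>
The signed area is a positive multiple of the sine of the angle between consecutive sides, so this angle
can be lifted to \<open>(0, \<pi>)\<close>.
\<close>

lemma midtangent_imp_critical: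
  assumes T: "midtangent_triangle K p q r" and dir: "q - r = a *\<^sub>R tangent_dir \<theta>" "a > 0"
  obtains \<phi> \<psi> where "critical \<theta> \<phi> \<psi>" "\<tau> \<theta> = p" "\<tau> \<phi> = q" "\<tau> \<psi> = r"
proof -
  have s: "left_support K p (q - r)" "left_support K q (r - p)" "left_support K r (p - q)"
    using T by (auto simp: midtangent_triangle_def)
  then have "r - p \<noteq> 0" "p - q \<noteq> 0" by (auto simp: left_support_def)
  then obtain b \<phi> where b: "b > 0" "r - p = b *\<^sub>R tangent_dir \<phi>" "\<theta> \<le> \<phi>" "\<phi> < \<theta> + 2 * pi"
    using ex_tangent_dir by metis
  obtain c \<psi> where c: "c > 0" "p - q = c *\<^sub>R tangent_dir \<psi>" "\<phi> \<le> \<psi>" "\<psi> < \<phi> + 2 * pi"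
    using ex_tangent_dir \<open>p - q \<noteq> 0\<close> by metis
  have D: "0 < cross2 (q - p) (r - p)" by (rule midtangent_area_pos[OF T])
  have "cross2 (q - p) (r - p) = cross2 (q - r) (r - p)"
    "cross2 (q - p) (r - p) = cross2 (r - p) (p - q)"
    by (simp_all add: cross2_def algebra_simps)
  moreover have "cross2 (q - r) (r - p) = a * (b * sin (\<phi> - \<theta>))"
    unfolding dir(1) b(2) by (simp add: cross2_tangent_dirs)
  moreover have "cross2 (r - p) (p - q) = b * (c * sin (\<psi> - \<phi>))"
    unfolding c(2) b(2) by (simp add: cross2_tangent_dirs)
  ultimately have "0 < a * (b * sin (\<phi> - \<theta>))" "0 < b * (c * sin (\<psi> - \<phi>))"
    using D by linarith+
  then have "0 < sin (\<phi> - \<theta>)" "0 < sin (\<psi> - \<phi>)"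
    using dir(2) b(1) c(1) by (simp_all add: zero_less_mult_iff)
  then have "\<theta> < \<phi>" "\<phi> < \<psi>" "\<phi> - \<theta> < pi" "\<psi> - \<phi> < pi"
    using sin_pos_imp_less_pi[of "\<phi> - \<theta>"] sin_pos_imp_less_pi[of "\<psi> - \<phi>"] b(3,4) c(3,4) by auto
  moreover have t: "\<tau> \<theta> = p" "\<tau> \<phi> = q" "\<tau> \<psi> = r"
    using left_support_imp_touch s[unfolded dir(1) b(2) c(2)] dir(2) b(1) c(1) by blast+
  ultimately have "critical \<theta> \<phi> \<psi>"
    unfolding critical_def t dir(1) b(2) c(2) using dir(2) b(1) c(1) by auto
  with t that show thesis by blast
qed

text \<open>
The contact points agree by \<open>midtangent_unique\<close>. The sides of the triangle, and with them the normals,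
are determined by the contact points even where \<open>K\<close> has a corner.
\<close>

lemma critical_unique:
  assumes "critical \<theta> \<phi> \<psi>" "critical \<theta> \<phi>' \<psi>'"
  shows "\<phi>' = \<phi>" "\<psi>' = \<psi>"
proof -
  obtain a b c where 1: "a > 0" "\<tau> \<phi> - \<tau> \<psi> = a *\<^sub>R tangent_dir \<theta>"
     "b > 0" "\<tau> \<psi> - \<tau> \<theta> = b *\<^sub>R tangent_dir \<phi>" "c > 0" "\<tau> \<theta> - \<tau> \<phi> = c *\<^sub>R tangent_dir \<psi>"
    using assms(1) by (auto simp: critical_def)
  obtain a' b' c' where 2: "a' > 0" "\<tau> \<phi>' - \<tau> \<psi>' = a' *\<^sub>R tangent_dir \<theta>"
     "b' > 0" "\<tau> \<psi>' - \<tau> \<theta> = b' *\<^sub>R tangent_dir \<phi>'" "c' > 0" "\<tau> \<theta> - \<tau> \<phi>' = c' *\<^sub>R tangent_dir \<psi>'"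
    using assms(2) by (auto simp: critical_def)
  have "\<tau> \<phi>' = \<tau> \<phi>" "\<tau> \<psi>' = \<tau> \<psi>"
    using midtangent_unique[OF critical_midtangent[OF assms(1)] critical_midtangent[OF assms(2)] 1(2) 2(2) 1(1) 2(1)]
    by auto
  then have "b' *\<^sub>R tangent_dir \<phi>' = b *\<^sub>R tangent_dir \<phi>" "c' *\<^sub>R tangent_dir \<psi>' = c *\<^sub>R tangent_dir \<psi>"
    using 1 2 by metis+
  then have "tangent_dir \<phi>' = tangent_dir \<phi>" "tangent_dir \<psi>' = tangent_dir \<psi>"
    using tangent_dir_eq_iff 1 2 by blast+
  moreover have "\<bar>\<phi>' - \<phi>\<bar> < 2 * pi" "\<bar>\<psi>' - \<psi>\<bar> < 2 * pi" using assms by (auto simp: critical_def)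
  ultimately show "\<phi>' = \<phi>" "\<psi>' = \<psi>" using tangent_dir_inj by blast+
qed

lemma pos_multiple_iff:
  "(\<exists>r>0. w = r *\<^sub>R tangent_dir \<theta>) \<longleftrightarrow> w \<noteq> 0 \<and> w = norm w *\<^sub>R tangent_dir \<theta>"
proof
  assume "\<exists>r>0. w = r *\<^sub>R tangent_dir \<theta>"
  then obtain r where r: "r > 0" "w = r *\<^sub>R tangent_dir \<theta>" by blast
  have "norm w = r" unfolding r(2) using r(1) by simp
  then show "w \<noteq> 0 \<and> w = norm w *\<^sub>R tangent_dir \<theta>" using r by auto
next
  assume "w \<noteq> 0 \<and> w = norm w *\<^sub>R tangent_dir \<theta>"
  then show "\<exists>r>0. w = r *\<^sub>R tangent_dir \<theta>" by (intro exI[of _ "norm w"]) auto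
qed

lemma continuous_on_tangent_dir [continuous_intros]:
  "continuous_on S f \<Longrightarrow> continuous_on S (\<lambda>x. tangent_dir (f x))"
  unfolding tangent_dir_def cis_conv_exp by (intro continuous_intros)

lemma continuous_on_touch [continuous_intros]:
  "continuous_on S f \<Longrightarrow> continuous_on S (\<lambda>x. \<tau> (f x))"
  by (rule continuous_on_compose2[OF continuous_touch]) auto

text \<open>
A limit of midtangent triangles could only fail to be one by losing the strict inequalities in
\<open>critical\<close>. These follow from the weak ones once the sides are bounded from below by
\<open>midtangent_side_bound\<close>.
\<close>

lemma closed_critical: "closed {(\<theta>, x, y). critical \<theta> (\<theta> + x) (\<theta> + y)}"
proof -
  obtain z e where e: "e > 0" "cball z e \<subseteq> K" using nonempty ex_cball by blast
  define d where "d = e / 2"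
  have "d > 0" using e by (simp add: d_def)
  let ?side = "\<lambda>a b c. \<tau> b - \<tau> c = norm (\<tau> b - \<tau> c) *\<^sub>R tangent_dir a \<and> d \<le> norm (\<tau> b - \<tau> c)"
  have eq: "critical \<theta> \<phi> \<psi> \<longleftrightarrow> \<theta> \<le> \<phi> \<and> \<phi> \<le> \<psi> \<and> \<psi> \<le> \<theta> + 2 * pi \<and>
     ?side \<theta> \<phi> \<psi> \<and> ?side \<phi> \<psi> \<theta> \<and> ?side \<psi> \<theta> \<phi>" (is "_ \<longleftrightarrow> ?R") for \<theta> \<phi> \<psi>
  proof
    assume c: "critical \<theta> \<phi> \<psi>"
    have T: "midtangent_triangle K (\<tau> \<theta>) (\<tau> \<phi>) (\<tau> \<psi>)" by (rule critical_midtangent[OF c])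
    have "d \<le> norm (\<tau> \<theta> - \<tau> \<phi>)" "d \<le> norm (\<tau> \<phi> - \<tau> \<psi>)" "d \<le> norm (\<tau> \<psi> - \<tau> \<theta>)"
      using midtangent_side_bound[OF T e(2)] midtangent_side_bound[OF midtangent_cyclic[OF T] e(2)]
       midtangent_side_bound[OF midtangent_cyclic[OF midtangent_cyclic[OF T]] e(2)] e
      by (auto simp: d_def)
    then show ?R using c unfolding critical_def pos_multiple_iff by auto
  next
    assume R: ?R
    then have n: "norm (\<tau> \<theta> - \<tau> \<phi>) > 0" "norm (\<tau> \<phi> - \<tau> \<psi>) > 0" "norm (\<tau> \<psi> - \<tau> \<theta>) > 0"
      using \<open>d > 0\<close> by linarith+
    then have "\<theta> \<noteq> \<phi>" "\<phi> \<noteq> \<psi>" "\<psi> \<noteq> \<theta> + 2 * pi" by auto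
    with R n show "critical \<theta> \<phi> \<psi>" unfolding critical_def pos_multiple_iff by auto
  qed
  show ?thesis unfolding eq case_prod_beta
    by (intro closed_Collect_conj closed_Collect_le closed_Collect_eq continuous_intros)
qed

end

section \<open>The circle map of the triangle family\<close>

text \<open>
Every outer normal belongs to a midtangent triangle. This is the form in which the invariant curve enters
the calibration argument.
\<close>

locale tri_body = convex_body +
  assumes ex_critical: "\<exists>\<phi> \<psi>. critical \<theta> \<phi> \<psi>"
begin

text \<open>
Sends the outer normal of one side of a circumscribed triangle of the family to that of the next side.
\<close>

definition \<sigma> :: "real \<Rightarrow> real" where
  "\<sigma> \<theta> = (THE \<phi>. \<exists>\<psi>. critical \<theta> \<phi> \<psi>)"

lemma critical_imp_\<sigma>:
  assumes "critical \<theta> \<phi> \<psi>"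
  shows "\<phi> = \<sigma> \<theta>" "\<psi> = \<sigma> (\<sigma> \<theta>)" "\<sigma> (\<sigma> (\<sigma> \<theta>)) = \<theta> + 2 * pi"
proof -
  have *: "\<sigma> \<theta> = \<phi>" if "critical \<theta> \<phi> \<psi>" for \<theta> \<phi> \<psi>
    unfolding \<sigma>_def by (rule the_equality) (use that critical_unique in blast)+
  show "\<phi> = \<sigma> \<theta>" "\<psi> = \<sigma> (\<sigma> \<theta>)" "\<sigma> (\<sigma> (\<sigma> \<theta>)) = \<theta> + 2 * pi"
    using *[OF assms] *[OF critical_cyclic[OF assms]] *[OF critical_cyclic[OF critical_cyclic[OF assms]]] by auto
qed

lemma critical_\<sigma>: "critical \<theta> (\<sigma> \<theta>) (\<sigma> (\<sigma> \<theta>))"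
  using ex_critical[of \<theta>] critical_imp_\<sigma> by blast

lemma \<sigma>3 [simp]: "\<sigma> (\<sigma> (\<sigma> \<theta>)) = \<theta> + 2 * pi"
  using critical_imp_\<sigma>[OF critical_\<sigma>] by blast

lemma \<sigma>_2pi [simp]: "\<sigma> (\<theta> + 2 * pi) = \<sigma> \<theta> + 2 * pi"
  using critical_imp_\<sigma>(1)[OF critical_2pi[OF critical_\<sigma>]] by simp

lemma \<sigma>_gt: "\<theta> < \<sigma> \<theta>" and \<sigma>_lt: "\<sigma> \<theta> < \<theta> + pi"
  using critical_gap[OF critical_\<sigma>[of \<theta>]] critical_\<sigma>[of \<theta>] by (auto simp: critical_def)

lemma continuous_\<sigma>: "continuous_on UNIV \<sigma>"
proof -
  let ?G = "\<lambda>\<theta>. (\<sigma> \<theta> - \<theta>, \<sigma> (\<sigma> \<theta>) - \<theta>)"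
  have "continuous_on UNIV ?G"
  proof (rule continuous_from_closed_graph)
    show "compact ({0..2 * pi} \<times> {0..2 * pi})" by (intro compact_Times) auto
    have "\<sigma> \<theta> - \<theta> \<in> {0..2 * pi}" "\<sigma> (\<sigma> \<theta>) - \<theta> \<in> {0..2 * pi}" for \<theta>
      using \<sigma>_gt[of \<theta>] \<sigma>_lt[of \<theta>] \<sigma>_gt[of "\<sigma> \<theta>"] \<sigma>_lt[of "\<sigma> \<theta>"] pi_gt_zero by auto
    then show "?G \<in> UNIV \<rightarrow> {0..2 * pi} \<times> {0..2 * pi}" by auto
    have "(\<lambda>x. (x, ?G x)) ` UNIV = {(\<theta>, x, y). critical \<theta> (\<theta> + x) (\<theta> + y)}"
    proof (intro equalityI subsetI)
      fix p assume "p \<in> {(\<theta>, x, y). critical \<theta> (\<theta> + x) (\<theta> + y)}"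
      then obtain \<theta> x y where p: "p = (\<theta>, x, y)" and c: "critical \<theta> (\<theta> + x) (\<theta> + y)" by auto
      have "p = (\<theta>, ?G \<theta>)" using critical_imp_\<sigma>[OF c] p by (simp add: algebra_simps)
      then show "p \<in> (\<lambda>x. (x, ?G x)) ` UNIV" by blast
    qed (use critical_\<sigma> in auto)
    then show "closed ((\<lambda>x. (x, ?G x)) ` UNIV)" using closed_critical by simp
  qed
  then have "continuous_on UNIV (\<lambda>\<theta>. fst (?G \<theta>) + \<theta>)"
    by (intro continuous_on_add continuous_on_fst continuous_on_id)
  then show ?thesis by simp
qed

text \<open>
A continuous injective map of the line is monotone, and \<open>\<sigma>\<close> cannot reverse the order because it commutes
with the translation by \<open>2 * pi\<close>.
\<close>

lemma strict_mono_\<sigma>: "strict_mono \<sigma>"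
proof -
  have "inj_on \<sigma> UNIV"
  proof (rule inj_onI)
    fix x y assume "\<sigma> x = \<sigma> y"
    then have "\<sigma> (\<sigma> (\<sigma> x)) = \<sigma> (\<sigma> (\<sigma> y))" by simp
    then show "x = y" by simp
  qed
  then have "strict_mono_on UNIV \<sigma> \<or> strict_antimono_on UNIV \<sigma>"
    using injective_eq_monotone_map[OF is_interval_univ continuous_\<sigma>] by simp
  moreover have "\<not> strict_antimono_on UNIV \<sigma>"
  proof
    assume "strict_antimono_on UNIV \<sigma>"
    then have "\<sigma> (0 + 2 * pi) < \<sigma> 0" unfolding monotone_on_def using pi_gt_zero by fastforce
    then show False unfolding \<sigma>_2pi using pi_gt_zero by simp
  qed
  ultimately show ?thesis by simp
qed

lemma \<sigma>_le_iff [simp]: "\<sigma> x \<le> \<sigma> y \<longleftrightarrow> x \<le> y"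
  using strict_mono_\<sigma> by (rule strict_mono_less_eq)

end

section \<open>The generating function\<close>

text \<open>
The form in which vanishing derivatives are obtained below: an increment is squeezed between two small
ones.
\<close>

lemma DERIV_0_I:
  fixes g :: "real \<Rightarrow> real"
  assumes "\<And>e. e > 0 \<Longrightarrow> \<exists>d>0. \<forall>y. \<bar>y - x\<bar> < d \<longrightarrow> \<bar>g y - g x\<bar> \<le> e * \<bar>y - x\<bar>"
  shows "(g has_real_derivative 0) (at x)"
proof -
  have "\<exists>d>0. \<forall>y. norm (y - x) < d \<longrightarrow> norm (g y - g x - 0 * (y - x)) \<le> e * norm (y - x)"
    if "e > 0" for e
    using assms[OF that] by simp
  then show ?thesis unfolding has_field_derivative_def has_derivative_at_alt
    by (auto simp: bounded_linear_mult_right)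
qed

lemma norm_cis_diff_le: "norm (cis y - cis x) \<le> \<bar>y - x\<bar>"
proof -
  have "norm (cis y - cis x) ^ 2 = 2 - 2 * cos (y - x)"
    unfolding cmod_power2 by (simp add: cos_diff power2_diff) (smt (verit) sin_cos_squared_add)
  also have "\<dots> = (2 * sin ((y - x) / 2)) ^ 2"
  proof -
    define z where "z = (y - x) / 2"
    have "y - x = 2 * z" by (simp add: z_def)
    then show ?thesis using cos_double_sin[of z] by (simp add: z_def[symmetric] power2_eq_square)
  qed
  finally have "\<bar>norm (cis y - cis x)\<bar> = \<bar>2 * sin ((y - x) / 2)\<bar>"
    unfolding abs_eq_iff power2_eq_iff .
  then have "norm (cis y - cis x) = \<bar>2 * sin ((y - x) / 2)\<bar>" by simp
  also have "\<dots> \<le> \<bar>y - x\<bar>"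
    using abs_sin_x_le_abs_x[of "(y - x) / 2"] by simp
  finally show ?thesis .
qed

context convex_body begin

definition supp :: "real \<Rightarrow> real" where "supp \<theta> = \<tau> \<theta> \<bullet> cis \<theta>"
definition supp' :: "real \<Rightarrow> real" where "supp' \<theta> = \<tau> \<theta> \<bullet> tangent_dir \<theta>"

lemma supp_max: "y \<in> K \<Longrightarrow> y \<bullet> cis \<theta> \<le> supp \<theta>"
  unfolding supp_def by (rule touch_max)

lemma touch_eq: "\<tau> \<theta> = supp \<theta> *\<^sub>R cis \<theta> + supp' \<theta> *\<^sub>R tangent_dir \<theta>"
proof -
  define a b where "a = Re (\<tau> \<theta>)" and "b = Im (\<tau> \<theta>)"
  have "a = (a * cos \<theta> + b * sin \<theta>) * cos \<theta> - (b * cos \<theta> - a * sin \<theta>) * sin \<theta>"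
    "b = (a * cos \<theta> + b * sin \<theta>) * sin \<theta> + (b * cos \<theta> - a * sin \<theta>) * cos \<theta>"
    using sin_cos_squared_add[of \<theta>] by algebra+
  then show ?thesis
    by (simp add: complex_eq_iff supp_def supp'_def inner_complex_def tangent_dir_def flip: a_def b_def)
qed

lemma touch_inner: "\<tau> \<theta> \<bullet> cis \<phi> = supp \<theta> * cos (\<phi> - \<theta>) + supp' \<theta> * sin (\<phi> - \<theta>)"
  by (subst touch_eq) (simp add: inner_add_left tangent_dir_inner)

lemma supp_2pi [simp]: "supp (\<theta> + 2 * pi) = supp \<theta>" "supp' (\<theta> + 2 * pi) = supp' \<theta>"
  by (simp_all add: supp_def supp'_def cis.ctr)

text \<open>
The support function is a maximum of the functions \<open>y \<bullet> cis \<theta>\<close>, so its derivative is that of the function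
which realizes the maximum. It is therefore \<open>C\<^sup>1\<close> although \<open>\<tau>\<close> is only continuous.
\<close>

lemma DERIV_supp: "(supp has_real_derivative supp' \<theta>) (at \<theta>)"
proof -
  let ?g = "\<lambda>y. supp y - \<tau> \<theta> \<bullet> cis y"
  have "(?g has_real_derivative 0) (at \<theta>)"
  proof (rule DERIV_0_I)
    fix e :: real assume "e > 0"
    then obtain d where d: "d > 0" "\<And>y. \<bar>y - \<theta>\<bar> < d \<Longrightarrow> norm (\<tau> y - \<tau> \<theta>) < e"
      using isCont_touch[of \<theta>] unfolding continuous_at_eps_delta
      by (auto simp: dist_norm)
    have "\<bar>?g y - ?g \<theta>\<bar> \<le> e * \<bar>y - \<theta>\<bar>" if "\<bar>y - \<theta>\<bar> < d" for y
    proof -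
      have "0 \<le> ?g y" using supp_max[OF touch_in] by simp
      moreover have "?g y \<le> (\<tau> y - \<tau> \<theta>) \<bullet> (cis y - cis \<theta>)"
        using supp_max[OF touch_in[of y], of \<theta>]
        by (simp add: supp_def inner_diff_left inner_diff_right)
      moreover have "(\<tau> y - \<tau> \<theta>) \<bullet> (cis y - cis \<theta>) \<le> norm (\<tau> y - \<tau> \<theta>) * norm (cis y - cis \<theta>)"
        by (rule norm_cauchy_schwarz)
      moreover have "norm (\<tau> y - \<tau> \<theta>) * norm (cis y - cis \<theta>) \<le> e * \<bar>y - \<theta>\<bar>"
        using d(2)[OF that] norm_cis_diff_le[of y \<theta>] \<open>e > 0\<close>
        by (intro mult_mono) auto
      ultimately show ?thesis using \<open>e > 0\<close> by (simp add: supp_def)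
    qed
    with d show "\<exists>d>0. \<forall>y. \<bar>y - \<theta>\<bar> < d \<longrightarrow> \<bar>?g y - ?g \<theta>\<bar> \<le> e * \<bar>y - \<theta>\<bar>" by blast
  qed
  moreover have "((\<lambda>y. \<tau> \<theta> \<bullet> cis y) has_real_derivative supp' \<theta>) (at \<theta>)"
    unfolding touch_inner by (auto intro!: derivative_eq_intros)
  ultimately have "((\<lambda>y. ?g y + \<tau> \<theta> \<bullet> cis y) has_real_derivative 0 + supp' \<theta>) (at \<theta>)"
    by (rule DERIV_add)
  then show ?thesis by simp
qed

lemma continuous_on_cis_real [continuous_intros]:
  "continuous_on S g \<Longrightarrow> continuous_on S (\<lambda>x. cis (g x))"
  unfolding cis_conv_exp by (intro continuous_intros)

lemma continuous_on_supp [continuous_intros]: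
  "continuous_on S g \<Longrightarrow> continuous_on S (\<lambda>x. supp (g x))"
  "continuous_on S g \<Longrightarrow> continuous_on S (\<lambda>x. supp' (g x))"
  unfolding supp_def supp'_def by (intro continuous_intros; assumption)+

text \<open>
The lengths of the two tangent segments from the contact points to \<open>tangents_meet \<Omega> \<theta> \<phi>\<close>; see
\<open>tangents_meet_eq\<close>.
\<close>

definition len_ahead :: "real \<Rightarrow> real \<Rightarrow> real" where
  "len_ahead \<theta> \<phi> = (supp \<phi> - \<tau> \<theta> \<bullet> cis \<phi>) / sin (\<phi> - \<theta>)"
definition len_behind :: "real \<Rightarrow> real \<Rightarrow> real" where
  "len_behind \<theta> \<phi> = (supp \<theta> - \<tau> \<phi> \<bullet> cis \<theta>) / sin (\<phi> - \<theta>)"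

lemma tangents_meet_eq:
  assumes "0 < \<phi> - \<theta>" "\<phi> - \<theta> < pi"
  shows "tangents_meet \<Omega> \<theta> \<phi> = \<tau> \<theta> + len_ahead \<theta> \<phi> *\<^sub>R tangent_dir \<theta>"
    and "tangents_meet \<Omega> \<theta> \<phi> = \<tau> \<phi> - len_behind \<theta> \<phi> *\<^sub>R tangent_dir \<phi>"
proof -
  have s: "sin (\<phi> - \<theta>) > 0" using assms by (intro sin_gt_zero)
  then have s2: "sin (\<theta> - \<phi>) = - sin (\<phi> - \<theta>)" by (metis minus_diff_eq sin_minus)
  let ?Q = "\<lambda>P. (P - \<tau> \<theta>) \<bullet> cis \<theta> = 0 \<and> (P - \<tau> \<phi>) \<bullet> cis \<phi> = 0"
  have un: "P = P'" if "?Q P" "?Q P'" for P P'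
  proof -
    define d where "d = P - P'"
    have "d \<bullet> cis \<theta> = 0" "d \<bullet> cis \<phi> = 0" using that by (simp_all add: d_def inner_diff_left)
    then have e: "Re d * cos \<theta> + Im d * sin \<theta> = 0" "Re d * cos \<phi> + Im d * sin \<phi> = 0"
      by (simp_all add: inner_complex_def)
    have "Re d * sin (\<phi> - \<theta>) = (Re d * cos \<theta> + Im d * sin \<theta>) * sin \<phi> - (Re d * cos \<phi> + Im d * sin \<phi>) * sin \<theta>"
      "Im d * sin (\<phi> - \<theta>) = (Re d * cos \<phi> + Im d * sin \<phi>) * cos \<theta> - (Re d * cos \<theta> + Im d * sin \<theta>) * cos \<phi>"
      by (simp_all add: sin_diff algebra_simps)
    then have "Re d * sin (\<phi> - \<theta>) = 0" "Im d * sin (\<phi> - \<theta>) = 0" unfolding e by simp_all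
    then have "d = 0" using s by (simp add: complex_eq_iff)
    then show ?thesis by (simp add: d_def)
  qed
  have 1: "?Q (\<tau> \<theta> + len_ahead \<theta> \<phi> *\<^sub>R tangent_dir \<theta>)"
    using s by (simp add: inner_diff_left inner_add_left tangent_dir_inner len_ahead_def supp_def)
  have 2: "?Q (\<tau> \<phi> - len_behind \<theta> \<phi> *\<^sub>R tangent_dir \<phi>)"
    using s by (simp add: inner_diff_left inner_add_left tangent_dir_inner len_behind_def supp_def s2)
  show "tangents_meet \<Omega> \<theta> \<phi> = \<tau> \<theta> + len_ahead \<theta> \<phi> *\<^sub>R tangent_dir \<theta>"
    unfolding tangents_meet_def by (rule the_equality) (use 1 un in blast)+
  show "tangents_meet \<Omega> \<theta> \<phi> = \<tau> \<phi> - len_behind \<theta> \<phi> *\<^sub>R tangent_dir \<phi>"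
    unfolding tangents_meet_def by (rule the_equality) (use 2 un in blast)+
qed

text \<open>
Differs from \<open>gen_action\<close> by a coboundary and involves only the support function itself, so that it can be
differentiated without differentiating \<open>\<tau>\<close>.
\<close>

definition reduced_action :: "real \<Rightarrow> real \<Rightarrow> real" where
  "reduced_action \<theta> \<phi> = (supp \<theta> * supp \<phi> - ((supp \<theta>)\<^sup>2 + (supp \<phi>)\<^sup>2) / 2 * cos (\<phi> - \<theta>)) / sin (\<phi> - \<theta>)"

lemma gen_action_eq:
  assumes "0 < \<phi> - \<theta>" "\<phi> - \<theta> < pi"
  shows "gen_action \<Omega> \<theta> \<phi> = reduced_action \<theta> \<phi> + (supp \<phi> * supp' \<phi> / 2 - supp \<theta> * supp' \<theta> / 2)"
proof -
  have s: "sin (\<phi> - \<theta>) > 0" using assms by (intro sin_gt_zero)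
  then have s2: "sin (\<theta> - \<phi>) = - sin (\<phi> - \<theta>)" by (metis minus_diff_eq sin_minus)
  have c2: "cos (\<theta> - \<phi>) = cos (\<phi> - \<theta>)" by (metis minus_diff_eq cos_minus)
  have "cross2 (\<tau> \<theta>) (tangents_meet \<Omega> \<theta> \<phi>) = len_ahead \<theta> \<phi> * supp \<theta>"
    unfolding tangents_meet_eq(1)[OF assms]
    by (simp add: cross2_commute[of "\<tau> \<theta>" "tangent_dir \<theta>"] cross2_tangent_dir supp_def)
  moreover have "cross2 (tangents_meet \<Omega> \<theta> \<phi>) (\<tau> \<phi>) = len_behind \<theta> \<phi> * supp \<phi>"
    unfolding tangents_meet_eq(2)[OF assms] by (simp add: cross2_tangent_dir supp_def)
  ultimately show ?thesis
    using s unfolding gen_action_def reduced_action_def len_ahead_def len_behind_def touch_inner s2 c2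
    by (simp add: field_simps power2_eq_square)
qed

text \<open>
Over one period this integrates to the area of \<open>\<Omega>\<close>.
\<close>

definition area_density :: "real \<Rightarrow> real" where "area_density \<theta> = ((supp \<theta>)\<^sup>2 - (supp' \<theta>)\<^sup>2) / 2"

text \<open>
The quotient rule for \<open>reduced_action\<close>, with \<open>s\<close>, \<open>c\<close> the sine and cosine of the angle and \<open>a\<close>, \<open>b\<close> the
values of the support function, simplified by completing a square.
\<close>

lemma reduced_action_deriv_algebra:
  fixes a b a' b' s c :: real
  assumes s: "s > 0" and c: "c * c = 1 - s * s"
  shows "((a * b' - (b * b' * c + (a\<^sup>2 + b\<^sup>2) / 2 * (- s))) * s - (a * b - (a\<^sup>2 + b\<^sup>2) / 2 * c) * c) / (s * s)
   = ((a - (b * c - b' * s)) / s)\<^sup>2 / 2 + (b\<^sup>2 - b'\<^sup>2) / 2"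
proof -
  have "(a * b' - (b * b' * c + (a\<^sup>2 + b\<^sup>2) / 2 * (- s))) * s - (a * b - (a\<^sup>2 + b\<^sup>2) / 2 * c) * c
    = a * b' * s - b * b' * c * s + (a\<^sup>2 + b\<^sup>2)/2 * (s * s + c * c) - a * b * c"
    by (simp add: algebra_simps add_divide_distrib)
  also have "\<dots> = (a - (b * c - b' * s))\<^sup>2 / 2 + (b\<^sup>2 - b'\<^sup>2) / 2 * (s * s)"
  proof -
    have "(a - (b * c - b' * s))\<^sup>2 = a\<^sup>2 + b\<^sup>2 * (c * c) + b'\<^sup>2 * (s * s) - 2 * a * b * c + 2 * a * b' * s - 2 * b * b' * c * s"
      by (simp add: power2_eq_square algebra_simps)
    then show ?thesis unfolding c by (simp add: field_simps)
  qed
  finally show ?thesis using s by (simp add: add_divide_distrib power2_eq_square)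
qed

text \<open>
If the second tangent turns about its contact point, the region between the two tangents and \<open>\<Omega>\<close> grows by
a thin sector of radius \<open>len_behind\<close>; the remaining term is, up to the coboundary, the growth of the
corresponding sector of \<open>\<Omega>\<close>.
\<close>

lemma DERIV_reduced_action_2:
  assumes "sin (\<phi> - \<theta>) > 0"
  shows "((\<lambda>y. reduced_action \<theta> y) has_real_derivative (len_behind \<theta> \<phi>)\<^sup>2 / 2 + area_density \<phi>) (at \<phi>)"
proof -
  have s2: "sin (\<theta> - \<phi>) = - sin (\<phi> - \<theta>)" by (metis minus_diff_eq sin_minus)
  have c2: "cos (\<theta> - \<phi>) = cos (\<phi> - \<theta>)" by (metis minus_diff_eq cos_minus)
  have c: "cos (\<phi> - \<theta>) * cos (\<phi> - \<theta>) = 1 - sin (\<phi> - \<theta>) * sin (\<phi> - \<theta>)"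
    using sin_cos_squared_add[of "\<phi> - \<theta>"] by (simp add: power2_eq_square)
  have "((\<lambda>y. reduced_action \<theta> y) has_real_derivative
     ((supp \<theta> * supp' \<phi> - (supp \<phi> * supp' \<phi> * cos (\<phi> - \<theta>) + ((supp \<theta>)\<^sup>2 + (supp \<phi>)\<^sup>2) / 2 * (- sin (\<phi> - \<theta>)))) * sin (\<phi> - \<theta>)
     - (supp \<theta> * supp \<phi> - ((supp \<theta>)\<^sup>2 + (supp \<phi>)\<^sup>2) / 2 * cos (\<phi> - \<theta>)) * cos (\<phi> - \<theta>)) / (sin (\<phi> - \<theta>) * sin (\<phi> - \<theta>))) (at \<phi>)"
    unfolding reduced_action_def using assms
    by (auto intro!: derivative_eq_intros DERIV_supp simp: field_simps power2_eq_square)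
  then show ?thesis
    unfolding reduced_action_deriv_algebra[OF assms c] by (simp add: len_behind_def touch_inner area_density_def s2 c2)
qed

lemma DERIV_reduced_action_1:
  assumes "sin (\<phi> - \<theta>) > 0"
  shows "((\<lambda>x. reduced_action x \<phi>) has_real_derivative - ((len_ahead \<theta> \<phi>)\<^sup>2 / 2) - area_density \<theta>) (at \<theta>)"
proof -
  have c: "cos (\<phi> - \<theta>) * cos (\<phi> - \<theta>) = 1 - sin (\<phi> - \<theta>) * sin (\<phi> - \<theta>)"
    using sin_cos_squared_add[of "\<phi> - \<theta>"] by (simp add: power2_eq_square)
  have "((\<lambda>x. reduced_action x \<phi>) has_real_derivative
     - (((supp \<phi> * (- supp' \<theta>) - (supp \<theta> * (- supp' \<theta>) * cos (\<phi> - \<theta>) + ((supp \<phi>)\<^sup>2 + (supp \<theta>)\<^sup>2) / 2 * (- sin (\<phi> - \<theta>)))) * sin (\<phi> - \<theta>)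
     - (supp \<phi> * supp \<theta> - ((supp \<phi>)\<^sup>2 + (supp \<theta>)\<^sup>2) / 2 * cos (\<phi> - \<theta>)) * cos (\<phi> - \<theta>)) / (sin (\<phi> - \<theta>) * sin (\<phi> - \<theta>)))) (at \<theta>)"
    unfolding reduced_action_def using assms
    by (auto intro!: derivative_eq_intros DERIV_supp simp: field_simps power2_eq_square)
  then show ?thesis
    unfolding reduced_action_deriv_algebra[OF assms c] by (simp add: len_ahead_def touch_inner area_density_def)
qed

text \<open>
The identity behind convexity of support functions: an intermediate normal as a combination of two
others.
\<close>

lemma cis_between:
  "sin (\<phi> - \<theta>) *\<^sub>R cis x = sin (\<phi> - x) *\<^sub>R cis \<theta> + sin (x - \<theta>) *\<^sub>R cis \<phi>"
proof -
  have p: "sin \<phi> * sin \<phi> = 1 - cos \<phi> * cos \<phi>" "sin \<theta> * sin \<theta> = 1 - cos \<theta> * cos \<theta>"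
    using sin_cos_squared_add[of \<phi>] sin_cos_squared_add[of \<theta>] by (simp_all add: power2_eq_square)
  show ?thesis by (simp add: complex_eq_iff sin_diff algebra_simps)
qed

text \<open>
The twist condition. The tangent at an intermediate normal \<open>x\<close> cuts the vertex \<open>tangents_meet \<Omega> \<theta> \<phi>\<close> off,
and so meets the tangent at \<open>\<phi>\<close> between the vertex and the contact point.
\<close>

lemma len_behind_antimono:
  assumes "\<theta> \<le> x" "x < \<phi>" "\<phi> < \<theta> + pi"
  shows "len_behind x \<phi> \<le> len_behind \<theta> \<phi>"
proof -
  have s: "sin (\<phi> - \<theta>) > 0" "sin (\<phi> - x) > 0" "sin (x - \<theta>) \<ge> 0"
    using assms by (auto intro!: sin_gt_zero sin_ge_zero)
  have i: "sin (\<phi> - \<theta>) * (v \<bullet> cis x) = sin (\<phi> - x) * (v \<bullet> cis \<theta>) + sin (x - \<theta>) * (v \<bullet> cis \<phi>)" for v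
    using arg_cong[OF cis_between[of \<phi> \<theta> x], of "\<lambda>w. v \<bullet> w"] by (simp add: inner_add_right)
  have "sin (\<phi> - \<theta>) * supp x = sin (\<phi> - x) * (\<tau> x \<bullet> cis \<theta>) + sin (x - \<theta>) * (\<tau> x \<bullet> cis \<phi>)"
    unfolding supp_def by (rule i)
  also have "\<dots> \<le> sin (\<phi> - x) * supp \<theta> + sin (x - \<theta>) * supp \<phi>"
    using s supp_max[OF touch_in] by (intro add_mono mult_left_mono) auto
  finally have "(supp x - \<tau> \<phi> \<bullet> cis x) * sin (\<phi> - \<theta>) \<le> (supp \<theta> - \<tau> \<phi> \<bullet> cis \<theta>) * sin (\<phi> - x)"
    using i[of "\<tau> \<phi>"] by (simp add: supp_def algebra_simps)
  then show ?thesis unfolding len_behind_def using s by (simp add: divide_le_eq le_divide_eq mult_ac)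
qed

lemma len_behind_nonneg:
  assumes "\<theta> < \<phi>" "\<phi> < \<theta> + pi" shows "0 \<le> len_behind \<theta> \<phi>"
  unfolding len_behind_def using assms supp_max[OF touch_in] by (intro divide_nonneg_pos sin_gt_zero) auto

text \<open>
The contact point is the midpoint of its side; the vertices of the circumscribed triangle have the form
\<open>p + q - r\<close>.
\<close>

lemma critical_lengths:
  assumes "critical \<theta> \<phi> \<psi>"
  shows "len_behind \<theta> \<phi> = len_ahead \<phi> \<psi>"
    and "\<tau> \<theta> + len_ahead \<theta> \<phi> *\<^sub>R tangent_dir \<theta> = \<tau> \<theta> + \<tau> \<phi> - \<tau> \<psi>"
proof -
  have *: "len_ahead \<theta> \<phi> = a" "len_behind \<theta> \<phi> = b"
    if "critical \<theta> \<phi> \<psi>" "\<tau> \<phi> - \<tau> \<psi> = a *\<^sub>R tangent_dir \<theta>" "\<tau> \<psi> - \<tau> \<theta> = b *\<^sub>R tangent_dir \<phi>"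
    for \<theta> \<phi> \<psi> a b
  proof -
    have s: "sin (\<phi> - \<theta>) > 0"
      using that(1) critical_gap[OF that(1)] by (intro sin_gt_zero) (auto simp: critical_def)
    then have s2: "sin (\<theta> - \<phi>) = - sin (\<phi> - \<theta>)" by (metis minus_diff_eq sin_minus)
    have d: "\<tau> \<phi> - \<tau> \<theta> = a *\<^sub>R tangent_dir \<theta> + b *\<^sub>R tangent_dir \<phi>"
      using that(2,3) by (metis add_diff_cancel_right' diff_add_cancel add_diff_eq)
    have "supp \<phi> - \<tau> \<theta> \<bullet> cis \<phi> = (\<tau> \<phi> - \<tau> \<theta>) \<bullet> cis \<phi>"
       "supp \<theta> - \<tau> \<phi> \<bullet> cis \<theta> = - ((\<tau> \<phi> - \<tau> \<theta>) \<bullet> cis \<theta>)"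
      by (simp_all add: supp_def inner_diff_left)
    then show "len_ahead \<theta> \<phi> = a" "len_behind \<theta> \<phi> = b"
      unfolding len_ahead_def len_behind_def d using s by (simp_all add: inner_add_left tangent_dir_inner s2)
  qed
  obtain a b c where 1: "\<tau> \<phi> - \<tau> \<psi> = a *\<^sub>R tangent_dir \<theta>"
     "\<tau> \<psi> - \<tau> \<theta> = b *\<^sub>R tangent_dir \<phi>" "\<tau> \<theta> - \<tau> \<phi> = c *\<^sub>R tangent_dir \<psi>"
    using assms by (auto simp: critical_def)
  have "len_behind \<theta> \<phi> = b" "len_ahead \<theta> \<phi> = a" using *[OF assms 1(1,2)] by auto
  moreover have "len_ahead \<phi> \<psi> = b"
    using *(1)[OF critical_cyclic[OF assms], of b c] 1 by simp
  ultimately show "len_behind \<theta> \<phi> = len_ahead \<phi> \<psi>"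
    and "\<tau> \<theta> + len_ahead \<theta> \<phi> *\<^sub>R tangent_dir \<theta> = \<tau> \<theta> + \<tau> \<phi> - \<tau> \<psi>"
    using 1(1) by (simp_all add: add_diff_eq[symmetric])
qed

end

section \<open>Calibration\<close>

lemma periodic_int:
  assumes "\<And>x::real. g (x + 2 * pi) = g x"
  shows "g (x + 2 * pi * of_int k) = g x"
proof (induction k rule: int_induct[where k = 0])
  case (step1 i)
  have "x + 2 * pi * of_int (i + 1) = (x + 2 * pi * of_int i) + 2 * pi" by (simp add: algebra_simps)
  with step1 assms show ?case by metis
next
  case (step2 i)
  have "x + 2 * pi * of_int i = (x + 2 * pi * of_int (i - 1)) + 2 * pi" by (simp add: algebra_simps)
  with step2 assms show ?case by metis
qed simp

lemma reduce_2pi: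
  obtains k :: int where "0 \<le> x + 2 * pi * of_int k" "x + 2 * pi * of_int k \<le> 2 * pi"
proof
  define y where "y = x / (2 * pi)"
  have x: "x = 2 * pi * y" by (simp add: y_def)
  have "0 \<le> y + of_int (- \<lfloor>y\<rfloor>)" "y + of_int (- \<lfloor>y\<rfloor>) \<le> 1" by (simp_all, linarith+)
  then have "0 \<le> 2 * pi * (y + of_int (- \<lfloor>y\<rfloor>))" "2 * pi * (y + of_int (- \<lfloor>y\<rfloor>)) \<le> 2 * pi * 1"
    by (intro mult_nonneg_nonneg mult_left_mono; simp)+
  then show "0 \<le> x + 2 * pi * of_int (- \<lfloor>y\<rfloor>)" "x + 2 * pi * of_int (- \<lfloor>y\<rfloor>) \<le> 2 * pi"
    unfolding x distrib_left mult_1_right by blast+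
qed

context tri_body begin

lemma continuous_on_\<sigma> [continuous_intros]:
  "continuous_on S g \<Longrightarrow> continuous_on S (\<lambda>x. \<sigma> (g x))"
  by (rule continuous_on_compose2[OF continuous_\<sigma>]) auto

lemma sin_\<sigma>_pos: "0 < sin (\<sigma> \<theta> - \<theta>)"
  using \<sigma>_gt[of \<theta>] \<sigma>_lt[of \<theta>] by (intro sin_gt_zero) auto

text \<open>
Half the side length of the circumscribed triangle of the family that touches at normal \<open>\<theta>\<close>; equivalently,
the distance along the tangent from the contact point to the curve of vertices.
\<close>

definition half_side :: "real \<Rightarrow> real" where "half_side \<theta> = len_ahead \<theta> (\<sigma> \<theta>)"

text \<open>
This is where the midpoint property enters: both halves of a side are equal, which is the Euler-Lagrange
equation for the orbits of \<open>\<sigma>\<close>.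
\<close>

lemma half_side_\<sigma>: "half_side (\<sigma> \<theta>) = len_behind \<theta> (\<sigma> \<theta>)"
  unfolding half_side_def using critical_lengths(1)[OF critical_\<sigma>] by simp

lemma continuous_on_half_side: "continuous_on S half_side"
proof -
  have "sin (\<sigma> \<theta> - \<theta>) \<noteq> 0" for \<theta> using sin_\<sigma>_pos[of \<theta>] by simp
  then show ?thesis unfolding half_side_def len_ahead_def by (intro continuous_intros) auto
qed

lemma continuous_on_area_density: "continuous_on S area_density"
  unfolding area_density_def by (intro continuous_intros) auto

text \<open>
Its derivative is chosen such that \<open>reduced_action \<theta> \<phi> + calib \<theta> - calib \<phi>\<close> is stationary in both
variables on the graph of \<open>\<sigma>\<close>.
\<close>

definition calib :: "real \<Rightarrow> real" where
  "calib = (SOME U. \<forall>\<theta>. (U has_real_derivative (half_side \<theta>)\<^sup>2 / 2 + area_density \<theta>) (at \<theta>))"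

lemma DERIV_calib: "(calib has_real_derivative (half_side \<theta>)\<^sup>2 / 2 + area_density \<theta>) (at \<theta>)"
proof -
  have "continuous_on UNIV (\<lambda>\<theta>. (half_side \<theta>)\<^sup>2 / 2 + area_density \<theta>)"
    by (intro continuous_intros continuous_on_half_side continuous_on_area_density) auto
  then have "isCont (\<lambda>\<theta>. (half_side \<theta>)\<^sup>2 / 2 + area_density \<theta>) x" for x
    by (simp add: continuous_on_eq_continuous_at)
  then have "\<exists>U. \<forall>\<theta>. (U has_real_derivative (half_side \<theta>)\<^sup>2 / 2 + area_density \<theta>) (at \<theta>)"
    using einterval_antiderivative[of "-\<infinity>" \<infinity> "\<lambda>\<theta>. (half_side \<theta>)\<^sup>2 / 2 + area_density \<theta>"]
    by (simp add: has_real_derivative_iff_has_vector_derivative)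
  from someI_ex[OF this] show ?thesis unfolding calib_def by blast
qed

lemma continuous_on_calib [continuous_intros]:
  "continuous_on S g \<Longrightarrow> continuous_on S (\<lambda>x. calib (g x))"
  by (rule continuous_on_compose2[of UNIV calib])
    (auto intro!: DERIV_isCont DERIV_calib continuous_at_imp_continuous_on)

text \<open>
The calibration is periodic only up to this increment over a full turn.
\<close>

definition \<kappa> :: real where "\<kappa> = calib (2 * pi) - calib 0"

lemma calib_2pi [simp]: "calib (\<theta> + 2 * pi) = calib \<theta> + \<kappa>"
proof -
  have per: "half_side (x + 2 * pi) = half_side x" "area_density (x + 2 * pi) = area_density x" for x
    by (simp_all add: half_side_def len_ahead_def area_density_def cis.ctr)
  have "((\<lambda>x. calib (x + 2 * pi) - calib x) has_real_derivative 0) (at x)" for x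
    using DERIV_calib[of "x + 2 * pi"] DERIV_calib[of x]
    by (auto intro!: derivative_eq_intros simp: per DERIV_shift)
  then have "calib (\<theta> + 2 * pi) - calib \<theta> = calib (0 + 2 * pi) - calib 0"
    by (intro DERIV_isconst_all) auto
  then show ?thesis by (simp add: \<kappa>_def)
qed

text \<open>
The derivative in \<open>\<phi>\<close> compares \<open>len_behind\<close> at \<open>\<theta>\<close> with its value at the preimage of \<open>\<phi>\<close> under \<open>\<sigma>\<close>. By
monotonicity of \<open>\<sigma>\<close> and the twist condition it changes sign exactly at \<open>\<phi> = \<sigma> \<theta>\<close>.
\<close>

lemma reduced_action_min:
  assumes "\<theta> < \<phi>" "\<phi> < \<theta> + pi"
  shows "reduced_action \<theta> (\<sigma> \<theta>) - calib (\<sigma> \<theta>) \<le> reduced_action \<theta> \<phi> - calib \<phi>"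
proof -
  have D: "((\<lambda>y. reduced_action \<theta> y - calib y) has_real_derivative ((len_behind \<theta> y)\<^sup>2 - (half_side y)\<^sup>2) / 2) (at y)"
    if "\<theta> < y" "y < \<theta> + pi" for y
  proof -
    have "0 < sin (y - \<theta>)" using that by (intro sin_gt_zero) auto
    from DERIV_diff[OF DERIV_reduced_action_2[OF this] DERIV_calib[of y]] show ?thesis
      by (simp add: diff_divide_distrib)
  qed
  \<comment> \<open>The inverse of \<open>\<sigma>\<close>, since the third iterate is a translation.\<close>
  define pre where "pre y = \<sigma> (\<sigma> (y - 2 * pi))" for y
  have pre: "\<sigma> (pre y) = y" for y by (simp add: pre_def)
  have side: "half_side y = len_behind (pre y) y" "pre y < y" "y < pre y + pi" for y
    using half_side_\<sigma>[of "pre y"] \<sigma>_gt[of "pre y"] \<sigma>_lt[of "pre y"] by (simp_all add: pre)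
  have side_nonneg: "0 \<le> half_side y" for y using len_behind_nonneg[OF side(2,3)] side(1) by simp
  show ?thesis
  proof (cases "\<sigma> \<theta> \<le> \<phi>")
    case True
    have "\<exists>d. ((\<lambda>y. reduced_action \<theta> y - calib y) has_real_derivative d) (at y) \<and> 0 \<le> d"
      if "\<sigma> \<theta> \<le> y" "y \<le> \<phi>" for y
    proof -
      have y: "\<theta> < y" "y < \<theta> + pi" using that assms \<sigma>_gt[of \<theta>] by auto
      have "\<theta> \<le> pre y" using that(1) pre[of y] \<sigma>_le_iff by metis
      then have "half_side y \<le> len_behind \<theta> y" unfolding side(1) using side(2) y by (intro len_behind_antimono) auto
      then show ?thesis using D[OF y] side_nonneg[of y] by (auto intro!: exI power_mono)
    qed
    then show ?thesis using DERIV_nonneg_imp_nondecreasing[OF True, of "\<lambda>y. reduced_action \<theta> y - calib y"] by blast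
  next
    case False
    then have le: "\<phi> \<le> \<sigma> \<theta>" by simp
    have "\<exists>d. ((\<lambda>y. reduced_action \<theta> y - calib y) has_real_derivative d) (at y) \<and> d \<le> 0"
      if "\<phi> \<le> y" "y \<le> \<sigma> \<theta>" for y
    proof -
      have y: "\<theta> < y" "y < \<theta> + pi" using that assms \<sigma>_lt[of \<theta>] by auto
      have "pre y \<le> \<theta>" using that(2) pre[of y] \<sigma>_le_iff by metis
      then have "len_behind \<theta> y \<le> half_side y" unfolding side(1) using side(3) y by (intro len_behind_antimono) auto
      then show ?thesis using D[OF y] len_behind_nonneg[OF y] by (auto intro!: exI power_mono)
    qed
    then show ?thesis using DERIV_nonpos_imp_nonincreasing[OF le, of "\<lambda>y. reduced_action \<theta> y - calib y"] by blast
  qed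
qed

definition excess :: "real \<Rightarrow> real" where "excess \<theta> = reduced_action \<theta> (\<sigma> \<theta>) + calib \<theta> - calib (\<sigma> \<theta>)"

text \<open>
Since \<open>\<sigma>\<close> need not be differentiable, the chain rule is not available. But \<open>excess\<close> is a minimum over \<open>\<phi>\<close>,
so its increment lies between the increments of \<open>\<lambda>x. reduced_action x \<phi> + calib x\<close> for the two minimizers
\<open>\<phi>\<close>. The derivative of this function vanishes on the graph of \<open>\<sigma>\<close> and is small nearby.
\<close>

lemma excess_deriv: "(excess has_real_derivative 0) (at \<theta>)"
proof (rule DERIV_0_I)
  fix \<eta> :: real assume "\<eta> > 0"
  define Q where "Q x y = ((half_side x)\<^sup>2 - (len_ahead x (\<sigma> y))\<^sup>2) / 2" for x y
  have sp: "0 < sin (\<sigma> \<theta> - \<theta>)" by (rule sin_\<sigma>_pos)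
  let ?U = "{p :: real \<times> real. fst p < \<sigma> (snd p) \<and> \<sigma> (snd p) < fst p + pi}"
  have U: "open ?U"
    by (intro open_Collect_conj open_Collect_less continuous_intros)
  have "sin (\<sigma> (snd p) - fst p) \<noteq> 0" if "p \<in> ?U" for p
    using that sin_gt_zero[of "\<sigma> (snd p) - fst p"] by auto
  then have "continuous_on ?U (\<lambda>p. Q (fst p) (snd p))"
    unfolding Q_def len_ahead_def
    by (intro continuous_intros continuous_on_compose2[OF continuous_on_half_side[of UNIV]]) auto
  moreover have "(\<theta>, \<theta>) \<in> ?U" using \<sigma>_gt \<sigma>_lt by simp
  ultimately have "isCont (\<lambda>p. Q (fst p) (snd p)) (\<theta>, \<theta>)"
    using U continuous_on_eq_continuous_at by blast
  moreover have "Q \<theta> \<theta> = 0" by (simp add: Q_def half_side_def)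
  ultimately have "\<forall>\<^sub>F p in at (\<theta>, \<theta>). dist (Q (fst p) (snd p)) 0 < \<eta>"
    using \<open>\<eta> > 0\<close> tendstoD[of "\<lambda>p. Q (fst p) (snd p)" 0 "at (\<theta>, \<theta>)" \<eta>] by (simp add: isCont_def)
  then obtain V where V: "open V" "(\<theta>, \<theta>) \<in> V"
    "\<And>p. p \<in> V \<Longrightarrow> p \<noteq> (\<theta>, \<theta>) \<Longrightarrow> \<bar>Q (fst p) (snd p)\<bar> < \<eta>"
    unfolding eventually_at_topological by auto
  have "open (V \<inter> ?U)" "(\<theta>, \<theta>) \<in> V \<inter> ?U" using V U \<open>(\<theta>, \<theta>) \<in> ?U\<close> by auto
  then obtain A B where AB: "open A" "open B" "(\<theta>, \<theta>) \<in> A \<times> B" "A \<times> B \<subseteq> V \<inter> ?U"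
    by (rule open_prod_elim)
  then have "open (A \<inter> B)" "\<theta> \<in> A \<inter> B" by auto
  then obtain d where d: "d > 0" "\<And>x. \<bar>x - \<theta>\<bar> < d \<Longrightarrow> x \<in> A \<inter> B"
    unfolding open_dist by (auto simp: dist_real_def)
  have small: "\<bar>Q x y\<bar> < \<eta>" "x < \<sigma> y" "\<sigma> y < x + pi" if "\<bar>x - \<theta>\<bar> < d" "\<bar>y - \<theta>\<bar> < d" for x y
  proof -
    have xy: "(x, y) \<in> V \<inter> ?U" using AB(4) d(2)[OF that(1)] d(2)[OF that(2)] by blast
    then show "\<bar>Q x y\<bar> < \<eta>" using V(3)[of "(x, y)"] \<open>Q \<theta> \<theta> = 0\<close> \<open>\<eta> > 0\<close> by (cases "(x, y) = (\<theta>, \<theta>)") auto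
    show "x < \<sigma> y" "\<sigma> y < x + pi" using xy by auto
  qed
  \<comment> \<open>Mean value theorem for the function with frozen second argument \<open>\<sigma> y\<close>.\<close>
  have G: "\<bar>(reduced_action b (\<sigma> y) + calib b) - (reduced_action a (\<sigma> y) + calib a)\<bar> \<le> \<eta> * \<bar>b - a\<bar>"
    if ab: "\<bar>a - \<theta>\<bar> < d" "\<bar>b - \<theta>\<bar> < d" "\<bar>y - \<theta>\<bar> < d" for a b y
  proof -
    have *: "\<bar>(reduced_action b (\<sigma> y) + calib b) - (reduced_action a (\<sigma> y) + calib a)\<bar> \<le> \<eta> * \<bar>b - a\<bar>"
      if ab: "\<bar>a - \<theta>\<bar> < d" "\<bar>b - \<theta>\<bar> < d" and "a < b" for a b
    proof -
      have D: "((\<lambda>x. reduced_action x (\<sigma> y) + calib x) has_real_derivative Q x y) (at x)" if "a \<le> x" "x \<le> b" for x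
      proof -
        have x: "\<bar>x - \<theta>\<bar> < d" using that ab by auto
        have "0 < sin (\<sigma> y - x)" using small(2,3)[OF x \<open>\<bar>y - \<theta>\<bar> < d\<close>] by (intro sin_gt_zero) auto
        from DERIV_add[OF DERIV_reduced_action_1[OF this] DERIV_calib[of x]] show ?thesis
          by (simp add: Q_def diff_divide_distrib)
      qed
      then obtain z where z: "a < z" "z < b"
        "(reduced_action b (\<sigma> y) + calib b) - (reduced_action a (\<sigma> y) + calib a) = (b - a) * Q z y"
        using MVT2[OF \<open>a < b\<close>, of "\<lambda>x. reduced_action x (\<sigma> y) + calib x" "\<lambda>x. Q x y"] by blast
      have "\<bar>Q z y\<bar> < \<eta>" using z ab \<open>\<bar>y - \<theta>\<bar> < d\<close> by (intro small) auto
      then show ?thesis unfolding z(3) abs_mult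
        using \<open>a < b\<close> by (simp add: mult.commute mult_left_mono)
    qed
    show ?thesis using *[OF ab(1,2)] *[OF ab(2,1)]
      by (cases a b rule: linorder_cases) (auto simp: abs_minus_commute)
  qed
  have "\<bar>excess y - excess \<theta>\<bar> \<le> \<eta> * \<bar>y - \<theta>\<bar>" if y: "\<bar>y - \<theta>\<bar> < d" for y
  proof -
    have "reduced_action y (\<sigma> y) - calib (\<sigma> y) \<le> reduced_action y (\<sigma> \<theta>) - calib (\<sigma> \<theta>)"
      using small(2,3)[OF y, of \<theta>] d(1) by (intro reduced_action_min) auto
    moreover have "reduced_action \<theta> (\<sigma> \<theta>) - calib (\<sigma> \<theta>) \<le> reduced_action \<theta> (\<sigma> y) - calib (\<sigma> y)"
      using small(2,3)[of \<theta> y] y d(1) by (intro reduced_action_min) auto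
    moreover have "\<bar>(reduced_action y (\<sigma> \<theta>) + calib y) - (reduced_action \<theta> (\<sigma> \<theta>) + calib \<theta>)\<bar> \<le> \<eta> * \<bar>y - \<theta>\<bar>"
      using y d(1) by (intro G) auto
    moreover have "\<bar>(reduced_action y (\<sigma> y) + calib y) - (reduced_action \<theta> (\<sigma> y) + calib \<theta>)\<bar> \<le> \<eta> * \<bar>y - \<theta>\<bar>"
      using y d(1) by (intro G) auto
    ultimately show ?thesis unfolding excess_def by linarith
  qed
  with d(1) show "\<exists>d>0. \<forall>y. \<bar>y - \<theta>\<bar> < d \<longrightarrow> \<bar>excess y - excess \<theta>\<bar> \<le> \<eta> * \<bar>y - \<theta>\<bar>" by blast
qed

lemma excess_const: "excess \<theta> = excess 0"
  using excess_deriv by (intro DERIV_isconst_all) auto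

text \<open>
The calibration of \<open>gen_action\<close> itself: the coboundary relating it to \<open>reduced_action\<close> is added.
\<close>

definition potential :: "real \<Rightarrow> real" where "potential \<theta> = calib \<theta> + supp \<theta> * supp' \<theta> / 2"

lemma potential_2pi [simp]: "potential (\<theta> + 2 * pi) = potential \<theta> + \<kappa>"
  by (simp add: potential_def)

lemma gen_action_ge:
  assumes "0 < \<phi> - \<theta>" "\<phi> - \<theta> < pi"
  shows "excess 0 + (potential \<phi> - potential \<theta>) \<le> gen_action \<Omega> \<theta> \<phi>"
  using reduced_action_min[of \<theta> \<phi>] excess_const[of \<theta>] assms
  unfolding gen_action_eq[OF assms] potential_def excess_def by linarith

lemma gen_action_\<sigma>: "gen_action \<Omega> \<theta> (\<sigma> \<theta>) = excess 0 + (potential (\<sigma> \<theta>) - potential \<theta>)"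
proof -
  have "0 < \<sigma> \<theta> - \<theta>" "\<sigma> \<theta> - \<theta> < pi" using \<sigma>_gt[of \<theta>] \<sigma>_lt[of \<theta>] by auto
  from gen_action_eq[OF this] show ?thesis
    using excess_const[of \<theta>] unfolding potential_def excess_def by linarith
qed

text \<open>
Uniformity in \<open>\<theta>\<close> comes from compactness of a period.
\<close>

lemma gen_action_near_\<sigma>:
  assumes "\<eta> > 0"
  obtains \<epsilon> where "\<epsilon> > 0"
    "\<And>\<theta> e. \<bar>e\<bar> \<le> \<epsilon> \<Longrightarrow> 0 < \<sigma> \<theta> + e - \<theta> \<and> \<sigma> \<theta> + e - \<theta> < pi \<and>
       gen_action \<Omega> \<theta> (\<sigma> \<theta> + e) \<le> excess 0 + (potential (\<sigma> \<theta> + e) - potential \<theta>) + \<eta>"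
proof -
  have "compact ((\<lambda>\<theta>. \<sigma> \<theta> - \<theta>) ` {0..2 * pi})"
    by (intro compact_continuous_image continuous_intros) auto
  then have "\<exists>\<theta>0\<in>{0..2*pi}. \<forall>\<theta>\<in>{0..2*pi}. \<sigma> \<theta>0 - \<theta>0 \<le> \<sigma> \<theta> - \<theta>"
    "\<exists>\<theta>1\<in>{0..2*pi}. \<forall>\<theta>\<in>{0..2*pi}. \<sigma> \<theta> - \<theta> \<le> \<sigma> \<theta>1 - \<theta>1"
    by (intro continuous_attains_inf continuous_attains_sup continuous_intros; simp)+
  then obtain \<theta>0 \<theta>1 where t: "\<And>\<theta>. \<theta> \<in> {0..2*pi} \<Longrightarrow> \<sigma> \<theta>0 - \<theta>0 \<le> \<sigma> \<theta> - \<theta>"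
    "\<And>\<theta>. \<theta> \<in> {0..2*pi} \<Longrightarrow> \<sigma> \<theta> - \<theta> \<le> \<sigma> \<theta>1 - \<theta>1" by blast
  \<comment> \<open>Half the distance of \<open>\<sigma> \<theta> - \<theta>\<close> from the ends of \<open>{0..pi}\<close>, so that perturbed steps stay admissible.\<close>
  define \<delta> where "\<delta> = min (\<sigma> \<theta>0 - \<theta>0) (\<theta>1 + pi - \<sigma> \<theta>1) / 2"
  have \<delta>: "\<delta> > 0" using \<sigma>_gt[of \<theta>0] \<sigma>_lt[of \<theta>1] by (simp add: \<delta>_def)
  have gap: "0 < \<sigma> \<theta> + e - \<theta>" "\<sigma> \<theta> + e - \<theta> < pi" if "\<theta> \<in> {0..2*pi}" "\<bar>e\<bar> \<le> \<delta>" for \<theta> e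
    using t[OF that(1)] that(2) \<delta> by (auto simp: \<delta>_def min_def split: if_splits)
  define G where "G p = reduced_action (fst p) (\<sigma> (fst p) + snd p) + calib (fst p) - calib (\<sigma> (fst p) + snd p)" for p
  let ?C = "{0..2 * pi} \<times> {- \<delta>..\<delta>}"
  have "sin (\<sigma> (fst p) + snd p - fst p) \<noteq> 0" if "p \<in> ?C" for p
    using gap[of "fst p" "snd p"] that sin_gt_zero[of "\<sigma> (fst p) + snd p - fst p"]
    by (auto simp: abs_le_iff)
  then have "continuous_on ?C G" unfolding G_def reduced_action_def by (intro continuous_intros) auto
  then have "uniformly_continuous_on ?C G"
    by (intro compact_uniformly_continuous compact_Times) auto
  then obtain d where d: "d > 0" "\<And>p q. p \<in> ?C \<Longrightarrow> q \<in> ?C \<Longrightarrow> dist q p < d \<Longrightarrow> dist (G q) (G p) < \<eta>"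
    using assms unfolding uniformly_continuous_on_def by meson
  define \<epsilon> where "\<epsilon> = min \<delta> (d / 2)"
  have \<epsilon>: "\<epsilon> > 0" "\<epsilon> \<le> \<delta>" "\<epsilon> < d" using \<delta> d(1) by (auto simp: \<epsilon>_def)
  have main: "0 < \<sigma> \<theta> + e - \<theta> \<and> \<sigma> \<theta> + e - \<theta> < pi \<and> G (\<theta>, e) \<le> excess 0 + \<eta>"
    if "\<theta> \<in> {0..2*pi}" "\<bar>e\<bar> \<le> \<epsilon>" for \<theta> e
  proof -
    have "dist (G (\<theta>, e)) (G (\<theta>, 0)) < \<eta>"
      using that \<epsilon> by (intro d(2)) (auto simp: dist_Pair_Pair dist_real_def)
    moreover have "G (\<theta>, 0) = excess 0" using excess_const[of \<theta>] by (simp add: G_def excess_def)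
    ultimately show ?thesis using gap[OF that(1), of e] that(2) \<epsilon> by (simp add: dist_real_def)
  qed
  have "0 < \<sigma> \<theta> + e - \<theta> \<and> \<sigma> \<theta> + e - \<theta> < pi \<and>
       gen_action \<Omega> \<theta> (\<sigma> \<theta> + e) \<le> excess 0 + (potential (\<sigma> \<theta> + e) - potential \<theta>) + \<eta>" if "\<bar>e\<bar> \<le> \<epsilon>" for \<theta> e
  proof -
    obtain k where k: "0 \<le> \<theta> + 2 * pi * of_int k" "\<theta> + 2 * pi * of_int k \<le> 2 * pi"
      using reduce_2pi .
    have s2: "\<sigma> (x + 2 * pi) + e = (\<sigma> x + e) + 2 * pi" for x by simp
    have "G (x + 2 * pi, e) = G (x, e)" for x
      unfolding G_def fst_conv snd_conv s2 calib_2pi reduced_action_def supp_2pi by simp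
    from periodic_int[of "\<lambda>x. G (x, e)", OF this]
    have G: "G (\<theta> + 2 * pi * of_int k, e) = G (\<theta>, e)" .
    have s: "\<sigma> (\<theta> + 2 * pi * of_int k) - (\<theta> + 2 * pi * of_int k) = \<sigma> \<theta> - \<theta>"
      by (rule periodic_int[of "\<lambda>x. \<sigma> x - x"]) simp
    have m: "0 < \<sigma> \<theta> + e - \<theta>" "\<sigma> \<theta> + e - \<theta> < pi" "G (\<theta>, e) \<le> excess 0 + \<eta>"
      using main[of "\<theta> + 2 * pi * of_int k" e] k that s unfolding G by auto
    then show ?thesis unfolding gen_action_eq[OF m(1,2)] by (simp add: G_def potential_def)
  qed
  with \<epsilon>(1) that show thesis by blast
qed

end

section \<open>Minimal configurations and the beta function\<close>

lemma sum_telescope_int: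
  fixes g :: "int \<Rightarrow> real"
  assumes "m \<le> n"
  shows "(\<Sum>i\<in>{m..<n}. g (i + 1) - g i) = g n - g m"
  using assms
proof (induction n rule: int_ge_induct)
  case (step i)
  have "{m..<i + 1} = insert i {m..<i}" using step.hyps by auto
  with step show ?case by simp
qed simp

lemma periodic_bounded:
  fixes g :: "real \<Rightarrow> real"
  assumes "continuous_on UNIV g" "\<And>x. g (x + 2 * pi) = g x"
  obtains C where "\<And>x. \<bar>g x\<bar> \<le> C"
proof -
  have "bounded (g ` {0..2 * pi})"
    by (intro compact_imp_bounded compact_continuous_image continuous_on_subset[OF assms(1)]) auto
  then obtain C where C: "\<And>x. x \<in> {0..2 * pi} \<Longrightarrow> \<bar>g x\<bar> \<le> C"
    unfolding bounded_iff by fastforce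
  have "\<bar>g x\<bar> \<le> C" for x
  proof -
    obtain k where "0 \<le> x + 2 * pi * of_int k" "x + 2 * pi * of_int k \<le> 2 * pi"
      using reduce_2pi .
    then show ?thesis using C[of "x + 2 * pi * of_int k"] periodic_int[of g x k, OF assms(2)] by simp
  qed
  then show thesis by (rule that)
qed

lemma bounded_over_infinity:
  fixes g r :: "'a \<Rightarrow> real"
  assumes "\<And>x. \<bar>g x\<bar> \<le> C" "filterlim r at_infinity F"
  shows "((\<lambda>x. g x / r x) \<longlongrightarrow> 0) F"
proof (rule Lim_null_comparison)
  show "\<forall>\<^sub>F x in F. norm (g x / r x) \<le> C / norm (r x)"
    using assms(1) by (simp add: divide_right_mono)
  have "((\<lambda>x. C / r x) \<longlongrightarrow> 0) F" by (rule tendsto_divide_0[OF tendsto_const assms(2)])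
  from tendsto_norm_zero[OF this] have "((\<lambda>x. \<bar>C\<bar> / norm (r x)) \<longlongrightarrow> 0) F" by simp
  moreover have "C \<ge> 0" using assms(1) by (meson abs_ge_zero order_trans)
  ultimately show "((\<lambda>x. C / norm (r x)) \<longlongrightarrow> 0) F" by simp
qed

context tri_body begin

lemma continuous_on_potential: "continuous_on S potential"
  unfolding potential_def by (intro continuous_intros) auto

lemma \<sigma>_int: "\<sigma> (\<theta> + 2 * pi * of_int k) = \<sigma> \<theta> + 2 * pi * of_int k"
  using periodic_int[of "\<lambda>x. \<sigma> x - x" \<theta> k] by simp

lemma segment_action_ge:
  assumes "m \<le> n" "admissible_on {m..<n} y"
  shows "of_int (n - m) * excess 0 + (potential (y n) - potential (y m)) \<le> segment_action \<Omega> y m n"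
proof -
  have "(\<Sum>i\<in>{m..<n}. excess 0 + (potential (y (i + 1)) - potential (y i))) \<le> segment_action \<Omega> y m n"
    unfolding segment_action_def
    by (intro sum_mono gen_action_ge) (use assms(2) in \<open>auto simp: admissible_on_def\<close>)
  then show ?thesis
    using sum_telescope_int[OF assms(1), of "\<lambda>i. potential (y i)"] assms(1) by (simp add: sum.distrib)
qed

lemma segment_action_le:
  assumes "m \<le> n"
    "\<And>i. i \<in> {m..<n} \<Longrightarrow> gen_action \<Omega> (y i) (y (i + 1)) \<le> c + (potential (y (i + 1)) - potential (y i))"
  shows "segment_action \<Omega> y m n \<le> of_int (n - m) * c + (potential (y n) - potential (y m))"
proof -
  have "segment_action \<Omega> y m n \<le> (\<Sum>i\<in>{m..<n}. c + (potential (y (i + 1)) - potential (y i)))"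
    unfolding segment_action_def by (intro sum_mono assms(2))
  then show ?thesis
    using sum_telescope_int[OF assms(1), of "\<lambda>i. potential (y i)"] assms(1) by (simp add: sum.distrib)
qed

text \<open>
The orbit of 0 under \<open>\<sigma>\<close>, indexed by all integers by means of \<open>\<sigma> \<circ> \<sigma> \<circ> \<sigma> = (\<lambda>\<theta>. \<theta> + 2 * pi)\<close>.
\<close>

definition orbit :: "int \<Rightarrow> real" where
  "orbit i = (if i mod 3 = 0 then 0 else if i mod 3 = 1 then \<sigma> 0 else \<sigma> (\<sigma> 0)) + 2 * pi * of_int (i div 3)"

lemma orbit_Suc: "orbit (i + 1) = \<sigma> (orbit i)"
proof -
  consider "i mod 3 = 0" | "i mod 3 = 1" | "i mod 3 = 2" by linarith
  then show ?thesis
  proof cases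
    case 1
    then have "(i + 1) mod 3 = 1" "(i + 1) div 3 = i div 3" by presburger+
    with 1 show ?thesis by (simp add: orbit_def \<sigma>_int[of 0, simplified])
  next
    case 2
    then have "(i + 1) mod 3 = 2" "(i + 1) div 3 = i div 3" by presburger+
    with 2 show ?thesis by (simp add: orbit_def \<sigma>_int)
  next
    case 3
    then have "(i + 1) mod 3 = 0" "(i + 1) div 3 = i div 3 + 1" by presburger+
    with 3 show ?thesis by (simp add: orbit_def \<sigma>_int distrib_left)
  qed
qed

lemma orbit_linear: "\<bar>orbit i - 2 * pi / 3 * of_int i\<bar> \<le> 2 * pi"
proof -
  have i: "real_of_int i = 3 * of_int (i div 3) + of_int (i mod 3)"
    by (metis mult_div_mod_eq of_int_add of_int_mult of_int_numeral)
  have b: "0 < \<sigma> 0" "\<sigma> 0 < pi" "0 < \<sigma> (\<sigma> 0)" "\<sigma> (\<sigma> 0) < 2 * pi"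
    using \<sigma>_gt[of 0] \<sigma>_lt[of 0] order.strict_trans[OF \<sigma>_gt[of 0] \<sigma>_gt[of "\<sigma> 0"]]
      \<sigma>_gt[of "\<sigma> (\<sigma> 0)"] by simp_all
  consider "i mod 3 = 0" | "i mod 3 = 1" | "i mod 3 = 2" by linarith
  then show ?thesis
  proof cases
    case 3
    then have "orbit i - 2 * pi / 3 * of_int i = \<sigma> (\<sigma> 0) - 4 * pi / 3"
      by (simp add: orbit_def i distrib_left)
    then show ?thesis using b by linarith
  qed (use b in \<open>simp_all add: orbit_def i distrib_left abs_le_iff\<close>)
qed

lemma orbit_admissible: "admissible_on I orbit"
  unfolding admissible_on_def orbit_Suc
proof (intro ballI conjI)
  fix i
  show "0 < \<sigma> (orbit i) - orbit i" "\<sigma> (orbit i) - orbit i < pi"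
    using \<sigma>_gt[of "orbit i"] \<sigma>_lt[of "orbit i"] by auto
qed

lemma orbit_segment_action:
  assumes "m \<le> n"
  shows "segment_action \<Omega> orbit m n = of_int (n - m) * excess 0 + (potential (orbit n) - potential (orbit m))"
  by (intro antisym segment_action_ge segment_action_le assms orbit_admissible)
    (simp add: orbit_Suc gen_action_\<sigma>)

lemma orbit_minimal: "minimal_configuration \<Omega> orbit"
  unfolding minimal_configuration_def
proof (intro conjI allI impI orbit_admissible)
  fix m n y assume "m < n \<and> admissible_on {m..<n} y \<and> y m = orbit m \<and> y n = orbit n"
  then show "segment_action \<Omega> orbit m n \<le> segment_action \<Omega> y m n"
    using segment_action_ge[of m n y] orbit_segment_action[of m n] by simp
qed

lemma orbit_rotation: "has_rotation_number orbit (1/3)"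
proof -
  have *: "((\<lambda>n. orbit n / (2 * pi * of_int n)) \<longlongrightarrow> 1/3) F"
    if F: "filterlim real_of_int at_infinity F" for F
  proof -
    have "((\<lambda>n. (orbit n - 2 * pi / 3 * of_int n) / of_int n) \<longlongrightarrow> 0) F"
      by (rule bounded_over_infinity[OF orbit_linear F])
    then have "((\<lambda>n. 1/3 + (orbit n - 2 * pi / 3 * of_int n) / of_int n / (2 * pi)) \<longlongrightarrow> 1/3 + 0 / (2 * pi)) F"
      by (intro tendsto_intros) auto
    moreover have "\<forall>\<^sub>F n in F. n \<noteq> 0"
      using filterlim_at_infinity_imp_eventually_ne[OF F, of 0] by simp
    then have "\<forall>\<^sub>F n in F. 1/3 + (orbit n - 2 * pi / 3 * of_int n) / of_int n / (2 * pi) = orbit n / (2 * pi * of_int n)"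
      by eventually_elim (simp add: field_simps)
    ultimately show ?thesis using tendsto_cong by fastforce
  qed
  show ?thesis unfolding has_rotation_number_def
    using *[OF filterlim_at_top_imp_at_infinity[OF filterlim_real_of_int_at_top]]
     *[OF filterlim_mono[OF filterlim_real_of_int_at_bot at_bot_le_at_infinity order_refl]] by blast
qed

lemma rotation_displacement:
  assumes "has_rotation_number x (1/3)"
  shows "(\<lambda>N::nat. (x (int N) - x (- int N)) / (2 * real N)) \<longlonglongrightarrow> 2 * pi / 3"
proof -
  have lim: "((\<lambda>n. x n / (2 * pi * of_int n)) \<longlongrightarrow> 1/3) at_top" "((\<lambda>n. x n / (2 * pi * of_int n)) \<longlongrightarrow> 1/3) at_bot"
    using assms by (auto simp: has_rotation_number_def)
  have "(\<lambda>N. x (int N) / (2 * pi * of_int (int N))) \<longlonglongrightarrow> 1/3"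
    by (rule filterlim_compose[OF lim(1) filterlim_int_sequentially])
  moreover have "filterlim (\<lambda>N. - int N) at_bot sequentially"
    unfolding filterlim_at_bot eventually_sequentially
  proof
    fix Z :: int
    show "\<exists>M. \<forall>N\<ge>M. - int N \<le> Z" by (intro exI[of _ "nat (- Z)"]) auto
  qed
  then have "(\<lambda>N. x (- int N) / (2 * pi * of_int (- int N))) \<longlonglongrightarrow> 1/3"
    by (rule filterlim_compose[OF lim(2)])
  ultimately have "(\<lambda>N. pi * (x (int N) / (2 * pi * of_int (int N)) + x (- int N) / (2 * pi * of_int (- int N)))) \<longlonglongrightarrow> pi * (1/3 + 1/3)"
    by (intro tendsto_mult tendsto_const tendsto_add)
  then show ?thesis
    by (simp add: field_simps diff_divide_distrib)
qed

text \<open>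
Up to a bounded function the potential is linear with slope \<open>\<kappa> / (2 * pi)\<close>.
\<close>

lemma potential_displacement:
  assumes "has_rotation_number x (1/3)"
  shows "(\<lambda>N::nat. (potential (x (int N)) - potential (x (- int N))) / (2 * real N)) \<longlonglongrightarrow> \<kappa> / 3"
proof -
  define p where "p \<theta> = potential \<theta> - \<kappa> / (2 * pi) * \<theta>" for \<theta>
  have "continuous_on UNIV p" unfolding p_def by (intro continuous_intros continuous_on_potential)
  moreover have "p (y + 2 * pi) = p y" for y by (simp add: p_def distrib_left)
  ultimately obtain C where C: "\<And>y. \<bar>p y\<bar> \<le> C" using periodic_bounded by blast
  let ?d = "\<lambda>N::nat. p (x (int N)) - p (x (- int N))"
  have "\<bar>?d N\<bar> \<le> 2 * C" for N using C[of "x (int N)"] C[of "x (- int N)"] by linarith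
  moreover have "filterlim (\<lambda>N::nat. 2 * real N) at_infinity sequentially"
    by (intro filterlim_at_top_imp_at_infinity) real_asymp
  ultimately have "(\<lambda>N. ?d N / (2 * real N)) \<longlonglongrightarrow> 0" by (rule bounded_over_infinity)
  then have "(\<lambda>N. \<kappa> / (2 * pi) * ((x (int N) - x (- int N)) / (2 * real N)) + ?d N / (2 * real N))
     \<longlonglongrightarrow> \<kappa> / (2 * pi) * (2 * pi / 3) + 0"
    by (intro tendsto_intros rotation_displacement assms)
  moreover have "\<kappa> / (2 * pi) * ((x (int N) - x (- int N)) / (2 * real N)) + ?d N / (2 * real N)
     = (potential (x (int N)) - potential (x (- int N))) / (2 * real N)" for N
  proof -
    have "\<kappa> / (2 * pi) * (x (int N) - x (- int N)) + ?d N = potential (x (int N)) - potential (x (- int N))"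
      by (simp add: p_def right_diff_distrib)
    then show ?thesis by (metis add_divide_distrib times_divide_eq_right)
  qed
  ultimately show ?thesis by simp
qed

text \<open>
Orbits of \<open>\<sigma>\<close> speeded up or slowed down by a small constant. They cost little more action than orbits of
\<open>\<sigma>\<close>, and by the choice of \<open>e\<close> they can be made to end at a prescribed point.
\<close>

definition drift :: "real \<Rightarrow> nat \<Rightarrow> real \<Rightarrow> real" where
  "drift e n = (\<lambda>\<theta>. \<sigma> \<theta> + e) ^^ n"

lemma drift_Suc: "drift e (Suc n) \<theta> = \<sigma> (drift e n \<theta>) + e"
  by (simp add: drift_def)

lemma drift_continuous: "continuous_on UNIV (\<lambda>e. drift e n a)"
proof (induction n)
  case (Suc n)
  then show ?case unfolding drift_Suc by (intro continuous_intros)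
qed (simp add: drift_def)

lemma \<sigma>_mono: "x \<le> y \<Longrightarrow> \<sigma> x \<le> \<sigma> y" by simp

text \<open>
Three steps advance by at least \<open>2 * pi + e\<close>, because \<open>\<sigma>\<close> is monotone and its third iterate is the
translation by \<open>2 * pi\<close>.
\<close>

lemma drift_ge:
  assumes "e \<ge> 0"
  shows "a + (2 * pi + e) * real n / 3 - (2 * pi + e) \<le> drift e n a"
proof (induction n rule: less_induct)
  case (less n)
  show ?case
  proof (cases "n < 3")
    case True
    have "a \<le> drift e k a" for k
    proof (induction k)
      case (Suc k)
      then show ?case using \<sigma>_gt[of "drift e k a"] assms by (simp add: drift_Suc)
    qed (simp add: drift_def)
    have "(2 * pi + e) * (real n / 3) \<le> (2 * pi + e) * 1"
      using True assms pi_gt_zero by (intro mult_left_mono) auto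
    then have "(2 * pi + e) * real n / 3 \<le> 2 * pi + e" by simp
    with \<open>\<And>k. a \<le> drift e k a\<close>[of n] show ?thesis by linarith
  next
    case False
    then obtain k where "n = 3 + k" using le_Suc_ex[of 3 n] by auto
    then have n: "n = Suc (Suc (Suc k))" by simp
    have "\<sigma> (\<sigma> (drift e k a)) \<le> \<sigma> (\<sigma> (drift e k a) + e)"
      using assms by (intro \<sigma>_mono) simp
    then have "\<sigma> (\<sigma> (\<sigma> (drift e k a))) \<le> \<sigma> (\<sigma> (\<sigma> (drift e k a) + e) + e)"
      using assms by (intro \<sigma>_mono) linarith
    then have "drift e k a + 2 * pi + e \<le> drift e n a" by (simp add: n drift_Suc)
    moreover have "a + (2 * pi + e) * real k / 3 - (2 * pi + e) \<le> drift e k a"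
      by (rule less) (simp add: n)
    moreover have "(2 * pi + e) * real n / 3 = (2 * pi + e) * real k / 3 + (2 * pi + e)"
      by (simp add: n field_simps)
    ultimately show ?thesis by linarith
  qed
qed

lemma drift_le:
  assumes "0 \<le> e" "e \<le> 2 * pi"
  shows "drift (- e) n a \<le> a + (2 * pi - e) * real n / 3 + 3 * pi"
proof (induction n rule: less_induct)
  case (less n)
  show ?case
  proof (cases "n < 3")
    case True
    have "drift (- e) k a \<le> a + pi * real k" for k
    proof (induction k)
      case (Suc k)
      then show ?case using \<sigma>_lt[of "drift (- e) k a"] assms by (simp add: drift_Suc algebra_simps)
    qed (simp add: drift_def)
    from this[of n] have "drift (- e) n a \<le> a + pi * real n" .
    moreover have "pi * real n \<le> pi * 3" using True by (intro mult_left_mono) auto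
    moreover have "0 \<le> (2 * pi - e) * real n / 3" using assms by simp
    ultimately show ?thesis by linarith
  next
    case False
    then obtain k where "n = 3 + k" using le_Suc_ex[of 3 n] by auto
    then have n: "n = Suc (Suc (Suc k))" by simp
    have "\<sigma> (\<sigma> (drift (- e) k a) + - e) \<le> \<sigma> (\<sigma> (drift (- e) k a))"
      using assms by (intro \<sigma>_mono) simp
    then have "\<sigma> (\<sigma> (\<sigma> (drift (- e) k a) + - e) + - e) \<le> \<sigma> (\<sigma> (\<sigma> (drift (- e) k a)))"
      using assms by (intro \<sigma>_mono) linarith
    then have "drift (- e) n a \<le> drift (- e) k a + 2 * pi - e" by (simp add: n drift_Suc)
    moreover have "drift (- e) k a \<le> a + (2 * pi - e) * real k / 3 + 3 * pi"
      by (rule less) (simp add: n)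
    moreover have "(2 * pi - e) * real n / 3 = (2 * pi - e) * real k / 3 + (2 * pi - e)"
      by (simp add: n field_simps)
    ultimately show ?thesis by linarith
  qed
qed

text \<open>
Over \<open>2 * N\<close> steps the displacement of \<open>x\<close> is \<open>4 * pi / 3 * N\<close> up to an error that is small compared with \<open>N\<close>,
whereas a drift of size \<open>e\<close> changes the displacement by a multiple of \<open>e * N\<close>. So some drift in
\<open>{- e..e}\<close> has the same end points as \<open>x\<close> and competes with it.
\<close>

lemma minimal_segment_le:
  assumes x: "minimal_configuration \<Omega> x" "has_rotation_number x (1/3)" and "\<eta> > 0"
  shows "\<forall>\<^sub>F N in sequentially. segment_action \<Omega> x (- int N) (int N) \<le>
     2 * real N * (excess 0 + \<eta>) + (potential (x (int N)) - potential (x (- int N)))"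
proof -
  obtain \<epsilon> where \<epsilon>: "\<epsilon> > 0" "\<And>\<theta> e. \<bar>e\<bar> \<le> \<epsilon> \<Longrightarrow> 0 < \<sigma> \<theta> + e - \<theta> \<and> \<sigma> \<theta> + e - \<theta> < pi \<and>
       gen_action \<Omega> \<theta> (\<sigma> \<theta> + e) \<le> excess 0 + (potential (\<sigma> \<theta> + e) - potential \<theta>) + \<eta>"
    using gen_action_near_\<sigma>[OF \<open>\<eta> > 0\<close>] by metis
  define e where "e = min \<epsilon> 1"
  have e: "e > 0" "e \<le> \<epsilon>" "e \<le> 1" using \<epsilon>(1) by (auto simp: e_def)
  let ?r = "\<lambda>N::nat. (x (int N) - x (- int N)) / (2 * real N)"
  have "\<forall>\<^sub>F N in sequentially. dist (?r N) (2 * pi / 3) < e / 6"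
    by (rule tendstoD[OF rotation_displacement[OF x(2)]]) (use e in auto)
  then show ?thesis
    using eventually_ge_at_top[of "Suc (nat \<lceil>(9 * pi + 3) / e\<rceil>)"]
  proof eventually_elim
    case (elim N)
    have N: "real N > 0" and "(9 * pi + 3) / e \<le> real N" using elim(2) by linarith+
    \<comment> \<open>This makes \<open>e * N / 3\<close> larger than both \<open>3 * pi\<close> and \<open>2 * pi + e\<close>, the constants in \<open>drift_le\<close> and \<open>drift_ge\<close>.\<close>
    then have eN: "9 * pi + 3 \<le> e * real N" using e by (simp add: divide_le_eq mult.commute)
    define a where "a = x (- int N)"
    define D where "D = x (int N) - a - 4 * pi / 3 * real N"
    have "?r N - 2 * pi / 3 = D / (2 * real N)" using N by (simp add: D_def a_def field_simps)
    then have "\<bar>D\<bar> / (2 * real N) < e / 6" using elim(1) N by (simp add: dist_real_def)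
    then have d: "\<bar>D\<bar> < e * real N / 3" using N by (simp add: field_simps)
    have "drift (- e) (2 * N) a \<le> a + (2 * pi - e) * real (2 * N) / 3 + 3 * pi"
      using e pi_gt3 by (intro drift_le) auto
    also have "\<dots> = a + 4 * pi / 3 * real N - 2 * (e * real N / 3) + 3 * pi" by (simp add: field_simps)
    also have "\<dots> \<le> x (int N)" using d eN D_def by linarith
    finally have lo: "drift (- e) (2 * N) a \<le> x (int N)" .
    have "x (int N) \<le> a + 4 * pi / 3 * real N + 2 * (e * real N / 3) - (2 * pi + e)"
      using d eN e(3) D_def pi_gt_zero by linarith
    then have "x (int N) \<le> a + (2 * pi + e) * real (2 * N) / 3 - (2 * pi + e)" by (simp add: field_simps)
    then have hi: "x (int N) \<le> drift e (2 * N) a"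
      using drift_ge[of e a "2 * N"] e(1) by linarith
    obtain e' where e': "- e \<le> e'" "e' \<le> e" "drift e' (2 * N) a = x (int N)"
      using IVT'[of "\<lambda>e. drift e (2 * N) a" "- e" "x (int N)" e] lo hi e
        continuous_on_subset[OF drift_continuous] by auto
    define y where "y i = drift e' (nat (i + int N)) a" for i
    have ySuc: "y (i + 1) = \<sigma> (y i) + e'" if "i \<ge> - int N" for i
    proof -
      have "nat (i + 1 + int N) = Suc (nat (i + int N))" using that by linarith
      then show ?thesis by (simp add: y_def drift_Suc)
    qed
    have "\<bar>e'\<bar> \<le> \<epsilon>" using e' e by auto
    note near = \<epsilon>(2)[OF this]
    have "nat (int N + int N) = 2 * N" by linarith
    then have ends: "y (- int N) = x (- int N)" "y (int N) = x (int N)"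
      unfolding y_def using e'(3) by (simp_all add: drift_def a_def)
    moreover have "admissible_on {- int N..<int N} y"
      unfolding admissible_on_def using near ySuc by simp
    ultimately have "segment_action \<Omega> x (- int N) (int N) \<le> segment_action \<Omega> y (- int N) (int N)"
      using x(1) N unfolding minimal_configuration_def by simp
    also have "\<dots> \<le> of_int (int N - - int N) * (excess 0 + \<eta>) + (potential (y (int N)) - potential (y (- int N)))"
      using near ySuc by (intro segment_action_le) (auto simp: algebra_simps)
    finally show ?case
      using \<open>y (- int N) = x (- int N)\<close> \<open>y (int N) = x (int N)\<close> by simp
  qed
qed

text \<open>
The orbit of \<open>\<sigma>\<close> realizes the value. For any other minimal configuration the calibration gives one
inequality and \<open>minimal_segment_le\<close> the other.
\<close>

lemma beta_out_eq: "beta_out \<Omega> (1/3) = excess 0 + \<kappa> / 3"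
  unfolding beta_out_def
proof (rule the_equality)
  have "(\<lambda>N. excess 0 + (potential (orbit (int N)) - potential (orbit (- int N))) / (2 * real N)) \<longlonglongrightarrow> excess 0 + \<kappa> / 3"
    by (intro tendsto_intros potential_displacement orbit_rotation)
  moreover have "\<forall>\<^sub>F N in sequentially. excess 0 + (potential (orbit (int N)) - potential (orbit (- int N))) / (2 * real N) =
      segment_action \<Omega> orbit (- int N) (int N) / (2 * real N)"
    using eventually_gt_at_top[of 0] by eventually_elim (simp add: orbit_segment_action field_simps)
  ultimately have "has_average_action \<Omega> orbit (excess 0 + \<kappa> / 3)"
    unfolding has_average_action_def by (rule Lim_transform_eventually)
  then show "\<exists>x. minimal_configuration \<Omega> x \<and> has_rotation_number x (1/3) \<and> has_average_action \<Omega> x (excess 0 + \<kappa> / 3)"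
    using orbit_minimal orbit_rotation by blast
next
  fix b assume "\<exists>x. minimal_configuration \<Omega> x \<and> has_rotation_number x (1/3) \<and> has_average_action \<Omega> x b"
  then obtain x where x: "minimal_configuration \<Omega> x" "has_rotation_number x (1/3)"
    and b: "(\<lambda>N. segment_action \<Omega> x (- int N) (int N) / (2 * real N)) \<longlonglongrightarrow> b"
    unfolding has_average_action_def by blast
  have lim: "(\<lambda>N. c + (potential (x (int N)) - potential (x (- int N))) / (2 * real N)) \<longlonglongrightarrow> c + \<kappa> / 3" for c
    by (intro tendsto_intros potential_displacement x)
  have "excess 0 + \<kappa> / 3 \<le> b"
  proof (rule tendsto_le[OF _ b lim])
    have "admissible_on {- int N..<int N} x" for N
      using x(1) by (auto simp: minimal_configuration_def admissible_on_def)
    then have ge: "2 * real N * excess 0 + (potential (x (int N)) - potential (x (- int N))) \<le> segment_action \<Omega> x (- int N) (int N)" for N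
      using segment_action_ge[of "- int N" "int N" x] by simp
    show "\<forall>\<^sub>F N in sequentially. excess 0 + (potential (x (int N)) - potential (x (- int N))) / (2 * real N)
        \<le> segment_action \<Omega> x (- int N) (int N) / (2 * real N)"
      using eventually_gt_at_top[of 0]
    proof eventually_elim
      case (elim N)
      then show ?case using divide_right_mono[OF ge[of N], of "2 * real N"]
        by (simp add: add_divide_distrib)
    qed
  qed simp
  moreover have le: "b \<le> (excess 0 + \<eta>) + \<kappa> / 3" if "\<eta> > 0" for \<eta>
  proof (rule tendsto_le[OF _ lim b])
    show "\<forall>\<^sub>F N in sequentially. segment_action \<Omega> x (- int N) (int N) / (2 * real N) \<le>
      (excess 0 + \<eta>) + (potential (x (int N)) - potential (x (- int N))) / (2 * real N)"
      using eventually_gt_at_top[of 0] minimal_segment_le[OF x that]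
      by eventually_elim (simp add: field_simps)
  qed simp
  have "b \<le> excess 0 + \<kappa> / 3"
  proof (rule field_le_epsilon)
    fix \<eta> :: real assume "\<eta> > 0"
    from le[OF this] show "b \<le> excess 0 + \<kappa> / 3 + \<eta>" by simp
  qed
  ultimately show "b = excess 0 + \<kappa> / 3" by simp
qed

lemma critical_actions:
  assumes "critical \<theta> \<phi> \<psi>"
  shows "gen_action \<Omega> \<theta> \<phi> = (2 * cross2 (\<tau> \<theta>) (\<tau> \<phi>) + cross2 (\<tau> \<phi>) (\<tau> \<psi>) + cross2 (\<tau> \<psi>) (\<tau> \<theta>)) / 2"
proof -
  have "0 < \<phi> - \<theta>" "\<phi> - \<theta> < pi" using assms critical_gap by (auto simp: critical_def)
  then have "tangents_meet \<Omega> \<theta> \<phi> = \<tau> \<theta> + \<tau> \<phi> - \<tau> \<psi>"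
    using tangents_meet_eq(1) critical_lengths(2)[OF assms] by simp
  then show ?thesis by (simp add: gen_action_def cross2_commute[of "\<tau> \<theta>" "\<tau> \<psi>"]
        cross2_commute[of "\<tau> \<psi>" "\<tau> \<phi>"])
qed

text \<open>
Summing the calibrated action over one period gives \<open>3 * beta_out \<Omega> (1/3)\<close>, and the shoelace formula gives
the area of the circumscribed triangle, which is twice the cross product.
\<close>

theorem beta_out_area:
  assumes "midtangent_triangle K p q r"
  shows "beta_out \<Omega> (1/3) = 2 / 3 * cross2 (q - p) (r - p)"
proof -
  have "q - r \<noteq> 0" using assms by (auto simp: midtangent_triangle_def left_support_def)
  then obtain a \<theta> where "a > 0" "q - r = a *\<^sub>R tangent_dir \<theta>" using ex_tangent_dir by metis
  then obtain \<phi> \<psi> where c: "critical \<theta> \<phi> \<psi>" and t: "\<tau> \<theta> = p" "\<tau> \<phi> = q" "\<tau> \<psi> = r"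
    using midtangent_imp_critical[OF assms] by metis
  have s: "\<sigma> \<theta> = \<phi>" "\<sigma> \<phi> = \<psi>" "\<sigma> \<psi> = \<theta> + 2 * pi"
    using critical_imp_\<sigma>[OF c] by auto
  have "3 * excess 0 + \<kappa> = gen_action \<Omega> \<theta> \<phi> + gen_action \<Omega> \<phi> \<psi> + gen_action \<Omega> \<psi> (\<theta> + 2 * pi)"
    using gen_action_\<sigma>[of \<theta>] gen_action_\<sigma>[of \<phi>] gen_action_\<sigma>[of \<psi>] unfolding s by simp
  also have "\<dots> = 2 * (cross2 p q + cross2 q r + cross2 r p)"
    unfolding critical_actions[OF c] critical_actions[OF critical_cyclic[OF c]]
      critical_actions[OF critical_cyclic[OF critical_cyclic[OF c]]] touch_2pi t by (simp add: field_simps)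
  also have "cross2 p q + cross2 q r + cross2 r p = cross2 (q - p) (r - p)"
    by (simp add: cross2_def algebra_simps)
  finally show ?thesis by (simp add: beta_out_eq field_simps)
qed

end

section \<open>From the invariant curve to the triangle family\<close>

lemma bounded_linear_cross2: "bounded_linear (cross2 v)"
  unfolding cross2_def
  by (intro bounded_linear_sub bounded_linear_const_mult bounded_linear_Im bounded_linear_Re)

context convex_body begin

lemma touch_point_unique:
  assumes "left_support K q (q - p)" "left_support K q' (q' - p)"
  shows "q' = q"
proof (rule left_support_unique_point[OF assms(1)])
  show "q' \<in> K" using assms(2) by (simp add: left_support_def)
  have "0 \<le> cross2 (q - p) (q' - q)" "0 \<le> cross2 (q' - p) (q - q')"
    using assms by (auto simp: left_support_def simp del: cross2_simps)
  moreover have "cross2 (q' - p) (q - q') = - cross2 (q - p) (q' - q)"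
    by (simp add: cross2_def algebra_simps)
  ultimately show "cross2 (q - p) (q' - q) = 0" by linarith
qed

text \<open>
Seen from \<open>p\<close>, choose the rightmost point of \<open>K\<close>. In coordinates where \<open>K\<close> lies ahead of \<open>p\<close> it is the point
of minimal slope.
\<close>

lemma ex_touch_point:
  assumes "p \<notin> K"
  shows "\<exists>q. left_support K q (q - p)"
proof -
  obtain a b where a: "a \<bullet> p < b" "\<And>x. x \<in> K \<Longrightarrow> b < a \<bullet> x"
    using separating_hyperplane_closed_point[of K p] assms convex_closure[OF convex_\<Omega>] by auto
  have pos: "0 < a \<bullet> (z - p)" if "z \<in> K" for z
    using a(2)[OF that] a(1) by (simp add: inner_diff_right)
  let ?slope = "\<lambda>z. cross2 a (z - p) / (a \<bullet> (z - p))"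
  have "continuous_on K ?slope"
    unfolding cross2_def by (intro continuous_intros) (use pos in force)
  then obtain q where q: "q \<in> K" "\<And>z. z \<in> K \<Longrightarrow> ?slope q \<le> ?slope z"
    using continuous_attains_inf[OF compact_K, of ?slope] nonempty by auto
  have "0 \<le> cross2 (q - p) (z - q)" if z: "z \<in> K" for z
  proof -
    have "cross2 a (q - p) * (a \<bullet> (z - p)) \<le> cross2 a (z - p) * (a \<bullet> (q - p))"
      using q(2)[OF z] pos[OF q(1)] pos[OF z] by (simp add: divide_le_eq le_divide_eq mult_ac del: cross2_simps)
    moreover have "(a \<bullet> a) * cross2 (q - p) (z - q) =
      cross2 a (z - p) * (a \<bullet> (q - p)) - cross2 a (q - p) * (a \<bullet> (z - p))"
      by (simp add: cross2_def inner_complex_def algebra_simps)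
    moreover have "0 < a \<bullet> a" using pos[OF q(1)] by auto
    ultimately show ?thesis by (smt (verit) mult_pos_neg)
  qed
  moreover have "q \<noteq> p" using q(1) assms by auto
  ultimately show ?thesis using q(1) by (auto simp: left_support_def)
qed

text \<open>
By convexity the tangent is a support line; the question is on which side \<open>K\<close> lies. Positive curvature
makes the curve turn to the left of its tangent.
\<close>

lemma curve_left_support:
  assumes "pos_curved_boundary_param \<Omega> L c c' c''"
  shows "left_support K (c t) (c' t)"
proof -
  have c: "range c = frontier \<Omega>" "\<And>t. (c has_vector_derivative c' t) (at t)"
    "\<And>t. (c' has_vector_derivative c'' t) (at t)" "c' t \<noteq> 0" "signed_curvature (c' t) (c'' t) > 0"
    using assms by (auto simp: pos_curved_boundary_param_def)
  have cK: "c s \<in> K" "c s \<notin> \<Omega>" for s using c(1) frontier_eq by auto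
  have "rel_interior K = \<Omega>"
    using interior_K nonempty rel_interior_nonempty_interior by metis
  then obtain a where a: "a \<noteq> 0" "\<And>y. y \<in> K \<Longrightarrow> a \<bullet> c t \<le> a \<bullet> y"
    using supporting_hyperplane_rel_boundary[OF convex_closure[OF convex_\<Omega>] cK(1), of t] cK(2)[of t]
    by metis
  define b where "b = - \<i> * a"
  have b: "cross2 b z = a \<bullet> z" for z by (simp add: b_def cross2_def inner_complex_def)
  have sup: "left_support K (c t) b"
    using a cK(1)[of t] by (simp add: left_support_def b inner_diff_right) (simp add: b_def)
  have "((\<lambda>s. a \<bullet> c s) has_real_derivative a \<bullet> c' t) (at t)"
    unfolding has_real_derivative_iff_has_vector_derivative
    by (rule bounded_linear.has_vector_derivative[OF bounded_linear_inner_right c(2)])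
  then have "a \<bullet> c' t = 0"
    by (rule DERIV_local_min[of _ _ _ 1]) (use a cK in auto)
  then have "cross2 b (c' t) = 0" by (simp add: b)
  then obtain r where r: "c' t = r *\<^sub>R b"
    using cross2_eq_0_iff[of b "c' t"] a by (auto simp: b_def)
  have "r > 0"
  proof (rule ccontr)
    assume "\<not> r > 0"
    with r c(4) have "r < 0" by (cases "r = 0") auto
    have neg: "cross2 (c' t) (c s - c t) \<le> 0" for s
      unfolding r using \<open>r < 0\<close> sup cK(1)[of s]
      by (simp add: left_support_def mult_le_0_iff del: cross2_simps(4))
    note lin = bounded_linear_cross2[of "c' t"]
    \<comment> \<open>If \<open>K\<close> were on the right, the curve would enter the forbidden side just after \<open>t\<close>.\<close>
    have "((\<lambda>s. cross2 (c' t) (c' s)) has_real_derivative cross2 (c' t) (c'' t)) (at t)"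
      unfolding has_real_derivative_iff_has_vector_derivative
      by (rule bounded_linear.has_vector_derivative[OF lin c(3)])
    moreover have "0 < cross2 (c' t) (c'' t)"
      using c(4,5) by (simp add: signed_curvature_def zero_less_divide_iff)
    ultimately obtain d where d: "d > 0"
      "\<And>h. 0 < h \<Longrightarrow> h < d \<Longrightarrow> cross2 (c' t) (c' t) < cross2 (c' t) (c' (t + h))"
      using DERIV_pos_inc_right by blast
    have "\<exists>z. t < z \<and> z < t + d / 2 \<and>
      cross2 (c' t) (c (t + d / 2)) - cross2 (c' t) (c t) = (t + d / 2 - t) * cross2 (c' t) (c' z)"
    proof (rule MVT2)
      fix x
      show "((\<lambda>s. cross2 (c' t) (c s)) has_real_derivative cross2 (c' t) (c' x)) (at x)"
        unfolding has_real_derivative_iff_has_vector_derivative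
        by (rule bounded_linear.has_vector_derivative[OF lin c(2)])
    qed (use d(1) in simp)
    then obtain z where z: "t < z" "z < t + d / 2"
      "cross2 (c' t) (c (t + d / 2)) - cross2 (c' t) (c t) = d / 2 * cross2 (c' t) (c' z)" by auto
    have "0 < d / 2 * cross2 (c' t) (c' z)"
      using d(2)[of "z - t"] z(1,2) d(1) by simp
    then show False using neg[of "t + d / 2"] z(3) by simp
  qed
  then show ?thesis unfolding r using sup left_support_scale by blast
qed

text \<open>
The derivative of the parametrization leaves a single support direction at each boundary point. In
particular the notion does not depend on the parametrization.
\<close>

lemma pos_tangent_vector_iff:
  assumes "C2_pos_curved_boundary \<Omega>"
  shows "pos_tangent_vector \<Omega> q v \<longleftrightarrow> left_support K q v"
proof
  assume "pos_tangent_vector \<Omega> q v"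
  then show "left_support K q v"
    unfolding pos_tangent_vector_def using curve_left_support left_support_scale by blast
next
  assume v: "left_support K q v"
  obtain L c c' c'' where c: "pos_curved_boundary_param \<Omega> L c c' c''"
    using assms by (auto simp: C2_pos_curved_boundary_def)
  then have rc: "range c = frontier \<Omega>" and dc: "\<And>t. (c has_vector_derivative c' t) (at t)" "\<And>t. c' t \<noteq> 0"
    by (auto simp: pos_curved_boundary_param_def)
  from left_support_frontier[OF v] rc obtain t where t: "c t = q" by (metis imageE)
  have cK: "c s \<in> K" for s using rc frontier_eq by auto
  have "((\<lambda>s. cross2 v (c s)) has_real_derivative cross2 v (c' t)) (at t)"
    unfolding has_real_derivative_iff_has_vector_derivative
    by (rule bounded_linear.has_vector_derivative[OF bounded_linear_cross2 dc(1)])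
  then have "cross2 v (c' t) = 0"
    by (rule DERIV_local_min[of _ _ _ 1]) (use v cK in \<open>auto simp: left_support_def t\<close>)
  then have "cross2 (c' t) v = 0" by (simp add: cross2_commute[of "c' t" v])
  then obtain r where r: "v = r *\<^sub>R c' t" using cross2_eq_0_iff[OF dc(2)] by metis
  obtain z where z: "z \<in> \<Omega>" using nonempty by blast
  have "0 < r * cross2 (c' t) (z - q)" "0 < cross2 (c' t) (z - q)"
    using left_support_pos[OF v z] left_support_pos[OF curve_left_support[OF c, of t] z]
    unfolding r t by (simp_all del: cross2_simps(1-4))
  then have "r > 0" by (simp add: zero_less_mult_iff)
  then show "pos_tangent_vector \<Omega> q v" unfolding pos_tangent_vector_def using c t r by blast
qed

lemma outer_billiard_eq:
  assumes "C2_pos_curved_boundary \<Omega>" "left_support K q (q - p)"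
  shows "outer_billiard \<Omega> p = 2 *\<^sub>R q - p"
proof -
  have "(THE q. q \<in> frontier \<Omega> \<and> pos_tangent_vector \<Omega> q (q - p)) = q"
    unfolding pos_tangent_vector_iff[OF assms(1)]
    by (rule the_equality) (use assms(2) left_support_frontier touch_point_unique in blast)+
  then show ?thesis by (simp add: outer_billiard_def)
qed

text \<open>
Otherwise \<open>q\<close> could be joined to infinity without meeting the curve and would have winding number 0. But
the winding number is constant on \<open>K\<close>, where it is 1.
\<close>

lemma invariant_curve_meets_ray:
  assumes "invariant_curve \<Omega> \<Gamma>" "q \<in> K" "v \<noteq> 0"
  obtains r where "r > 0" "q - r *\<^sub>R v \<in> \<Gamma>"
proof (rule ccontr)
  note found = that
  assume no: "\<not> thesis"
  obtain g where g: "path g" "pathfinish g = pathstart g" "path_image g = \<Gamma>" "\<Gamma> \<inter> K = {}"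
    "\<And>z. z \<in> \<Omega> \<Longrightarrow> winding_number g z = 1"
    using assms(1) by (auto simp: invariant_curve_def)
  define S where "S = (\<lambda>r. q - r *\<^sub>R v) ` {0..}"
  have "q - r *\<^sub>R v \<notin> \<Gamma>" if "r \<ge> 0" for r :: real
  proof (cases "r = 0")
    case True
    then show ?thesis using g(4) assms(2) by auto
  next
    case False
    with \<open>r \<ge> 0\<close> found[of r] no show ?thesis by auto
  qed
  then have S: "S \<subseteq> - \<Gamma>" by (auto simp: S_def)
  have conn: "connected S" unfolding S_def
    by (intro connected_continuous_image continuous_intros) simp
  have "q \<in> S" by (auto simp: S_def intro!: image_eqI[of _ _ 0])
  have "\<not> bounded S"
  proof
    assume "bounded S"
    then obtain B where B: "\<And>z. z \<in> S \<Longrightarrow> norm z \<le> B" by (auto simp: bounded_iff)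
    then have B0: "B \<ge> 0" using \<open>q \<in> S\<close> norm_ge_zero order_trans by blast
    define r where "r = (B + norm q + 1) / norm v"
    have "r \<ge> 0" using B0 by (simp add: r_def)
    then have "norm (q - r *\<^sub>R v) \<le> B" using B by (auto simp: S_def)
    moreover have "norm (r *\<^sub>R v) = B + norm q + 1"
      using assms(3) B0 by (simp add: r_def)
    moreover have "norm (r *\<^sub>R v) \<le> norm q + norm (q - r *\<^sub>R v)"
      using norm_triangle_ineq4[of q "q - r *\<^sub>R v"] by simp
    ultimately show False by linarith
  qed
  moreover have "S \<subseteq> connected_component_set (- \<Gamma>) q"
    by (rule connected_component_maximal[OF \<open>q \<in> S\<close> conn S])
  ultimately have "q \<in> outside (path_image g)"
    unfolding g(3) outside_def using bounded_subset \<open>q \<in> S\<close> S by blast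
  then have "winding_number g q = 0" by (rule winding_number_zero_in_outside[OF g(1,2)])
  moreover have "connected K" using convex_closure[OF convex_\<Omega>] convex_connected by blast
  then have "winding_number g constant_on K"
    by (rule winding_number_constant[OF g(1,2)]) (use g in auto)
  then have "winding_number g q = 1"
    using g(5) nonempty subset_K assms(2) unfolding constant_on_def by (metis ex_in_conv)
  ultimately show False by simp
qed

text \<open>
The tangent ray at \<open>\<tau> \<theta>\<close> meets the curve in a point whose first contact point is \<open>\<tau> \<theta>\<close>. Its orbit closes
after three steps, and the three contact points are the midpoints of the resulting triangle.
\<close>

lemma invariant_curve_tri_body:
  assumes C2: "C2_pos_curved_boundary \<Omega>" and inv: "invariant_curve \<Omega> \<Gamma>"
    and per: "consists_of_3_periodic_points \<Omega> \<Gamma>"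
  shows "tri_body \<Omega>"
proof unfold_locales
  fix \<theta>
  have G: "outer_billiard \<Omega> p \<in> \<Gamma>" "p \<notin> K" if "p \<in> \<Gamma>" for p
    using inv that by (auto simp: invariant_curve_def)
  obtain r where r: "r > 0" "\<tau> \<theta> - r *\<^sub>R tangent_dir \<theta> \<in> \<Gamma>"
    using invariant_curve_meets_ray[OF inv touch_in tangent_dir_neq_0] .
  define p where "p = \<tau> \<theta> - r *\<^sub>R tangent_dir \<theta>"
  have dir: "\<tau> \<theta> - p = r *\<^sub>R tangent_dir \<theta>" by (simp add: p_def)
  have q: "left_support K (\<tau> \<theta>) (\<tau> \<theta> - p)"
    unfolding dir using left_support_touch left_support_scale[OF r(1)] by blast
  define p2 where "p2 = outer_billiard \<Omega> p"
  define p3 where "p3 = outer_billiard \<Omega> p2"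
  have in_G: "p \<in> \<Gamma>" "p2 \<in> \<Gamma>" "p3 \<in> \<Gamma>" using r(2) G by (auto simp: p_def p2_def p3_def)
  \<comment> \<open>The contact points are the midpoints of the segments from one orbit point to the next.\<close>
  obtain q2 where q2: "left_support K q2 (q2 - p2)" using ex_touch_point G(2)[OF in_G(2)] by blast
  obtain q3 where q3: "left_support K q3 (q3 - p3)" using ex_touch_point G(2)[OF in_G(3)] by blast
  have e2: "p2 = 2 *\<^sub>R \<tau> \<theta> - p" and e3: "p3 = 2 *\<^sub>R q2 - p2"
    using outer_billiard_eq[OF C2] q q2 by (auto simp: p2_def p3_def)
  have "outer_billiard \<Omega> p3 = p"
    using per in_G(1) by (simp add: consists_of_3_periodic_points_def numeral_3_eq_3 p2_def p3_def)
  then have e1: "p = 2 *\<^sub>R q3 - p3" using outer_billiard_eq[OF C2 q3] by simp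
  have d: "q2 - q3 = \<tau> \<theta> - p" "q3 - \<tau> \<theta> = q2 - p2" "\<tau> \<theta> - q2 = q3 - p3"
    using e1 e2 e3 by (simp_all add: complex_eq_iff)
  then have T: "midtangent_triangle K (\<tau> \<theta>) q2 q3"
    unfolding midtangent_triangle_def d using q q2 q3 by simp
  have "q2 - q3 = r *\<^sub>R tangent_dir \<theta>" using d dir by simp
  from midtangent_imp_critical[OF T this r(1)] show "\<exists>\<phi> \<psi>. critical \<theta> \<phi> \<psi>" by metis
qed

end

section \<open>The unit disk\<close>

lemma cis_thirds:
  "cis (2 * pi / 3) = Complex (- 1 / 2) (sqrt 3 / 2)"
  "cis (4 * pi / 3) = Complex (- 1 / 2) (- sqrt 3 / 2)"
proof -
  have "2 * pi / 3 = pi - pi / 3" "4 * pi / 3 = pi + pi / 3" by simp_all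
  then show "cis (2 * pi / 3) = Complex (- 1 / 2) (sqrt 3 / 2)"
    "cis (4 * pi / 3) = Complex (- 1 / 2) (- sqrt 3 / 2)"
    by (simp_all only: complex_eq_iff cis.sel complex.sel cos_diff cos_add sin_diff sin_add
        cos_pi sin_pi cos_60 sin_60) simp_all
qed

lemma cis_third: "cis (\<theta> + 2 * pi / 3) - cis (\<theta> + 4 * pi / 3) = sqrt 3 *\<^sub>R tangent_dir \<theta>"
  unfolding cis_mult[symmetric] cis_thirds tangent_dir_def
  by (simp add: complex_eq_iff field_simps)

lemma convex_body_disk: "convex_body (ball 0 1)"
proof
  have "open_segment x y \<subseteq> ball 0 1" if "norm x \<le> 1" "norm y \<le> 1" for x y :: complex
    using that dist_decreases_open_segment[of _ x y 0] by fastforce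
  then show "strictly_convex_domain (ball 0 1)"
    by (auto simp: strictly_convex_domain_def)
qed simp

interpretation disk: convex_body "ball 0 1" by (rule convex_body_disk)

lemma touch_disk: "touch (ball 0 1) \<theta> = cis \<theta>"
proof (rule disk.touch_eqI)
  fix y :: complex assume "y \<in> closure (ball 0 1)"
  then have "norm y \<le> 1" by simp
  then show "y \<bullet> cis \<theta> \<le> cis \<theta> \<bullet> cis \<theta>"
    using norm_cauchy_schwarz[of y "cis \<theta>"] by (simp add: tangent_dir_inner)
qed simp

text \<open>
For the disk the family consists of the inscribed equilateral triangles.
\<close>

lemma critical_disk: "disk.critical \<theta> (\<theta> + 2 * pi / 3) (\<theta> + 4 * pi / 3)"
proof -
  have e: "\<theta> + 2 * pi / 3 + 2 * pi / 3 = \<theta> + 4 * pi / 3" "\<theta> + 2 * pi / 3 + 4 * pi / 3 = \<theta> + 2 * pi"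
    "\<theta> + 4 * pi / 3 + 2 * pi / 3 = \<theta> + 2 * pi" "\<theta> + 4 * pi / 3 + 4 * pi / 3 = (\<theta> + 2 * pi / 3) + 2 * pi"
    by simp_all
  have p: "cis (x + 2 * pi) = cis x" for x by (simp add: complex_eq_iff)
  have "cis (\<theta> + 4 * pi / 3) - cis \<theta> = sqrt 3 *\<^sub>R tangent_dir (\<theta> + 2 * pi / 3)"
    "cis \<theta> - cis (\<theta> + 2 * pi / 3) = sqrt 3 *\<^sub>R tangent_dir (\<theta> + 4 * pi / 3)"
    using cis_third[of "\<theta> + 2 * pi / 3"] cis_third[of "\<theta> + 4 * pi / 3"]
    unfolding e p by simp_all
  then show ?thesis
    unfolding disk.critical_def touch_disk using cis_third[of \<theta>] pi_gt_zero
    by (auto intro!: exI[of _ "sqrt 3"])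
qed

interpretation disk: tri_body "ball 0 1"
  by unfold_locales (use critical_disk in blast)

lemma beta_out_disk: "beta_out (ball 0 1) (1/3) = sqrt 3"
proof -
  have "cross2 (cis (0 + 2 * pi / 3) - cis 0) (cis (0 + 4 * pi / 3) - cis 0) = 3 / 2 * sqrt 3"
    unfolding add_0_left cis_thirds by (simp add: cross2_def field_simps)
  then show ?thesis
    using disk.beta_out_area[OF disk.critical_midtangent[OF critical_disk[of 0]]] unfolding touch_disk by simp
qed

section \<open>Area by slices\<close>

lemma borel_measurable_Complex: "(\<lambda>p::real \<times> real. Complex (fst p) (snd p)) \<in> borel_measurable borel"
  unfolding Complex_eq by (intro borel_measurable_continuous_onI continuous_intros)

lemma lborel_complex_eq: "lborel = distr lborel borel (\<lambda>p::real \<times> real. Complex (fst p) (snd p))"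
proof (rule lborel_eqI)
  fix l u :: complex assume lu: "\<And>b. b \<in> Basis \<Longrightarrow> l \<bullet> b \<le> u \<bullet> b"
  have le: "Re l \<le> Re u" "Im l \<le> Im u"
    using lu[of 1] lu[of \<i>] by (auto simp: Basis_complex_def)
  note meas = borel_measurable_Complex
  have "(\<lambda>p::real \<times> real. Complex (fst p) (snd p)) -` box l u = {Re l<..<Re u} \<times> {Im l<..<Im u}"
    by (auto simp: box_def Basis_complex_def)
  then have "emeasure (distr lborel borel (\<lambda>p::real \<times> real. Complex (fst p) (snd p))) (box l u)
    = emeasure (lborel \<Otimes>\<^sub>M lborel) ({Re l<..<Re u} \<times> {Im l<..<Im u})"
    using meas by (subst emeasure_distr) (auto simp: lborel_prod)
  also have "\<dots> = ennreal (Re u - Re l) * ennreal (Im u - Im l)"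
    using le by (subst lborel.emeasure_pair_measure_Times) auto
  also have "\<dots> = ennreal (prod ((\<bullet>) (u - l)) Basis)"
    using le by (simp add: Basis_complex_def ennreal_mult)
  finally show "emeasure (distr lborel borel (\<lambda>p::real \<times> real. Complex (fst p) (snd p))) (box l u)
    = ennreal (prod ((\<bullet>) (u - l)) Basis)" .
qed simp

lemma measure_between_graphs:
  fixes lo hi :: "real \<Rightarrow> real"
  assumes S: "open S" "\<And>x y. Complex x y \<in> S \<longleftrightarrow> x \<in> {a<..<b} \<and> lo x < y \<and> y < hi x"
    and le: "\<And>x. x \<in> {a..b} \<Longrightarrow> lo x \<le> hi x"
    and int: "((\<lambda>x. hi x - lo x) has_integral I) {a..b}"
  shows "measure lebesgue S = I"
proof -
  have I: "I \<ge> 0" using has_integral_nonneg[OF int] le by simp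
  let ?c = "\<lambda>p::real \<times> real. Complex (fst p) (snd p)"
  note meas = borel_measurable_Complex
  have int': "((\<lambda>x. hi x - lo x) has_integral I) {a<..<b}"
    using int by (simp add: has_integral_Icc_iff_Ioo)
  have "emeasure lborel S = emeasure lborel (?c -` S)"
    using S(1) meas by (subst lborel_complex_eq, subst emeasure_distr) auto
  also have "\<dots> = emeasure (lborel \<Otimes>\<^sub>M lborel) (?c -` S)" by (simp add: lborel_prod)
  also have "\<dots> = (\<integral>\<^sup>+ x. emeasure lborel (Pair x -` (?c -` S)) \<partial>lborel)"
  proof (rule lborel.emeasure_pair_measure_alt)
    have "open (?c -` S)" by (intro open_vimage S(1) continuous_intros)
    then show "?c -` S \<in> sets (lborel \<Otimes>\<^sub>M lborel)"
      unfolding lborel_prod sets_lborel by (rule borel_open)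
  qed
  also have "\<dots> = (\<integral>\<^sup>+ x. ennreal (indicat_real {a<..<b} x * (hi x - lo x)) \<partial>lborel)"
  proof (intro nn_integral_cong)
    fix x :: real
    have "Pair x -` (?c -` S) = (if x \<in> {a<..<b} then {lo x<..<hi x} else {})"
      using S(2) by auto
    then show "emeasure lborel (Pair x -` (?c -` S)) = ennreal (indicat_real {a<..<b} x * (hi x - lo x))"
      using le[of x] by simp
  qed
  also have "\<dots> = ennreal I"
    by (rule nn_integral_has_integral_lebesgue[OF _ int']) (use le in auto)
  finally have "measure lborel S = I" using I by (simp add: measure_def)
  then show ?thesis using S(1) by (simp add: measure_completion)
qed

context convex_body begin

definition x_left :: real where "x_left = Re (\<tau> pi)"
definition x_right :: real where "x_right = Re (\<tau> 0)"

lemma Re_bounds: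
  assumes "z \<in> K"
  shows "x_left \<le> Re z" "Re z \<le> x_right" "Re z = x_left \<Longrightarrow> z = \<tau> pi" "Re z = x_right \<Longrightarrow> z = \<tau> 0"
proof -
  show "x_left \<le> Re z" "Re z \<le> x_right"
    using touch_max[OF assms, of pi] touch_max[OF assms, of 0] by (simp_all add: x_left_def x_right_def inner_complex_def)
  then show "Re z = x_left \<Longrightarrow> z = \<tau> pi" "Re z = x_right \<Longrightarrow> z = \<tau> 0"
    using left_support_unique_point[OF left_support_touch[of pi] assms]
      left_support_unique_point[OF left_support_touch[of 0] assms]
    by (simp_all add: cross2_tangent_dir x_left_def x_right_def inner_complex_def del: cross2_simps)
qed

lemma Re_strict:
  assumes "z \<in> \<Omega>" shows "x_left < Re z" "Re z < x_right"
  using left_support_pos[OF left_support_touch[of pi] assms] left_support_pos[OF left_support_touch[of 0] assms]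
  by (simp_all add: cross2_tangent_dir x_left_def x_right_def inner_complex_def del: cross2_simps)

lemma x_left_less_x_right: "x_left < x_right"
  using Re_strict nonempty by (meson ex_in_conv order.strict_trans)

text \<open>
Intermediate values: the abscissa is continuous on the connected set \<open>K\<close>.
\<close>

lemma ex_edge:
  assumes "x \<in> {x_left..x_right}"
  shows "\<exists>z\<in>K. Re z = x \<and> (\<forall>w\<in>K. Re w = x \<longrightarrow> s * Im w \<le> s * Im z)"
proof -
  have "connected (Re ` K)"
    by (intro connected_continuous_image continuous_intros convex_connected convex_closure convex_\<Omega>)
  then have "{x_left..x_right} \<subseteq> Re ` K"
    by (rule connected_contains_Icc) (auto simp: x_left_def x_right_def touch_in)
  then have "{z \<in> K. Re z = x} \<noteq> {}" using assms by auto
  moreover have "compact {z \<in> K. Re z = x}"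
    using compact_Int_closed[OF compact_K, of "{z. Re z = x}"]
    by (simp add: Int_def closed_Collect_eq continuous_on_Re)
  moreover have "continuous_on {z \<in> K. Re z = x} (\<lambda>z. s * Im z)" by (intro continuous_intros)
  ultimately have "\<exists>z\<in>{z \<in> K. Re z = x}. \<forall>w\<in>{z \<in> K. Re z = x}. s * Im w \<le> s * Im z"
    by (intro continuous_attains_sup)
  then show ?thesis by auto
qed

text \<open>
The upper boundary function for \<open>s = 1\<close> and the lower one for \<open>s = -1\<close>.
\<close>

definition edge :: "real \<Rightarrow> real \<Rightarrow> real" where
  "edge s x = Im (SOME z. z \<in> K \<and> Re z = x \<and> (\<forall>w\<in>K. Re w = x \<longrightarrow> s * Im w \<le> s * Im z))"

lemma edge_in: "x \<in> {x_left..x_right} \<Longrightarrow> Complex x (edge s x) \<in> K"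
  and edge_extreme: "Complex x y \<in> K \<Longrightarrow> s * y \<le> s * edge s x"
proof -
  have *: "Complex x (edge s x) \<in> K \<and> (\<forall>w\<in>K. Re w = x \<longrightarrow> s * Im w \<le> s * edge s x)"
    if x: "x \<in> {x_left..x_right}" for x
  proof -
    let ?Q = "\<lambda>z. z \<in> K \<and> Re z = x \<and> (\<forall>w\<in>K. Re w = x \<longrightarrow> s * Im w \<le> s * Im z)"
    define z where "z = (SOME z. ?Q z)"
    have "\<exists>z. ?Q z" using ex_edge[OF x] by blast
    then have z: "?Q z" unfolding z_def by (rule someI_ex)
    have e: "edge s x = Im z" by (simp add: edge_def z_def)
    then have "Complex x (edge s x) = z" using z by (simp add: complex_eq_iff)
    then show ?thesis using z e by simp
  qed
  show "x \<in> {x_left..x_right} \<Longrightarrow> Complex x (edge s x) \<in> K" using * by blast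
  show "s * y \<le> s * edge s x" if "Complex x y \<in> K"
    using *[of x] Re_bounds(1,2)[OF that] that by force
qed

text \<open>
A limit of boundary points over \<open>t n\<close> is a point of \<open>K\<close> over \<open>x\<close>. If it were not extreme, strict convexity
would put an interior point of \<open>K\<close> strictly beyond it, and this point persists over \<open>t n\<close>. The argument
includes the two end points of the interval.
\<close>

lemma continuous_edge:
  assumes s: "s * s = 1"
  shows "continuous_on {x_left..x_right} (edge s)"
proof -
  obtain B where B: "\<And>z. z \<in> K \<Longrightarrow> norm z \<le> B"
    using compact_imp_bounded[OF compact_K] by (auto simp: bounded_iff)
  show ?thesis
  proof (rule continuous_from_closed_graph)
    show "compact {- B..B}" by simp
    have "\<bar>edge s x\<bar> \<le> B" if "x \<in> {x_left..x_right}" for x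
      using B[OF edge_in[OF that, of s]] abs_Im_le_cmod[of "Complex x (edge s x)"] by simp
    then show "edge s \<in> {x_left..x_right} \<rightarrow> {- B..B}" by (auto simp: abs_le_iff minus_le_iff)
    show "closed ((\<lambda>x. (x, edge s x)) ` {x_left..x_right})"
      unfolding closed_sequential_limits
    proof (intro allI impI, elim conjE)
      fix p l assume p: "\<forall>n. p n \<in> (\<lambda>x. (x, edge s x)) ` {x_left..x_right}" and lim: "p \<longlonglongrightarrow> l"
      define t where "t n = fst (p n)" for n
      define x y where "x = fst l" and "y = snd l"
      have t: "t n \<in> {x_left..x_right}" "p n = (t n, edge s (t n))" for n
        using p[rule_format, of n] by (auto simp: t_def)
      have lx: "t \<longlonglongrightarrow> x" unfolding t_def x_def by (intro tendsto_intros lim)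
      have "(\<lambda>n. snd (p n)) \<longlonglongrightarrow> y" unfolding y_def by (intro tendsto_intros lim)
      then have ly: "(\<lambda>n. edge s (t n)) \<longlonglongrightarrow> y" by (simp add: t(2))
      have x: "x \<in> {x_left..x_right}"
        by (rule closed_sequentially[OF _ _ lx]) (use t in auto)
      have "(\<lambda>n. Complex (t n) (edge s (t n))) \<longlonglongrightarrow> Complex x y"
        by (intro tendsto_Complex lx ly)
      then have yK: "Complex x y \<in> K"
        by (rule closed_sequentially[OF closed_closure, rotated]) (use edge_in t in auto)
      have "y = edge s x"
      proof (rule ccontr)
        assume ne: "y \<noteq> edge s x"
        have le: "s * y \<le> s * edge s x" by (rule edge_extreme[OF yK])
        have "s * y \<noteq> s * edge s x" using ne s by auto
        then have "s * y < s * edge s x" using le by linarith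
        define w where "w = (y + edge s x) / 2"
        have "midpoint (Complex x y) (Complex x (edge s x)) \<in> \<Omega>"
          using segment[OF yK edge_in[OF x, of s]] ne by auto
        moreover have "midpoint (Complex x y) (Complex x (edge s x)) = Complex x w"
          by (simp add: midpoint_def w_def complex_eq_iff)
        ultimately have "Complex x w \<in> \<Omega>" by simp
        moreover have "(\<lambda>n. Complex (t n) w) \<longlonglongrightarrow> Complex x w"
          by (intro tendsto_Complex lx tendsto_const)
        ultimately have "\<forall>\<^sub>F n in sequentially. Complex (t n) w \<in> \<Omega>"
          using topological_tendstoD open_\<Omega> by blast
        then have ev: "\<forall>\<^sub>F n in sequentially. s * w \<le> s * edge s (t n)"
          by eventually_elim (use edge_extreme subset_K in blast)
        have "s * w \<le> s * y"
          by (rule tendsto_lowerbound[OF tendsto_mult[OF tendsto_const ly] ev]) simp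
        then show False using \<open>s * y < s * edge s x\<close> by (simp add: w_def distrib_left)
      qed
      then have "l = (x, edge s x)" by (simp add: x_def y_def prod_eq_iff)
      then show "l \<in> (\<lambda>x. (x, edge s x)) ` {x_left..x_right}" using x by blast
    qed
  qed
qed

lemma mem_\<Omega>_iff: "Complex x y \<in> \<Omega> \<longleftrightarrow> x \<in> {x_left<..<x_right} \<and> edge (-1) x < y \<and> y < edge 1 x"
proof
  assume A: "Complex x y \<in> \<Omega>"
  then obtain e where e: "e > 0" "cball (Complex x y) e \<subseteq> K" by (rule ex_cball)
  have "Complex x (y + e) \<in> cball (Complex x y) e" "Complex x (y - e) \<in> cball (Complex x y) e"
    using e(1) by (simp_all add: dist_norm complex_diff norm_complex_def)
  then have "Complex x (y + e) \<in> K" "Complex x (y - e) \<in> K" using e(2) by blast+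
  then show "x \<in> {x_left<..<x_right} \<and> edge (-1) x < y \<and> y < edge 1 x"
    using edge_extreme[of x "y + e" 1] edge_extreme[of x "y - e" "-1"] Re_strict[OF A] e(1) by auto
next
  assume A: "x \<in> {x_left<..<x_right} \<and> edge (-1) x < y \<and> y < edge 1 x"
  then have K: "Complex x (edge (-1) x) \<in> K" "Complex x (edge 1 x) \<in> K" by (auto intro!: edge_in)
  have "Complex x y \<in> open_segment (Complex x (edge (-1) x)) (Complex x (edge 1 x))"
    unfolding in_segment
  proof (intro conjI exI)
    define u where "u = (y - edge (-1) x) / (edge 1 x - edge (-1) x)"
    show "Complex x (edge (-1) x) \<noteq> Complex x (edge 1 x)" using A by simp
    show "0 < u" "u < 1" using A by (auto simp: u_def divide_less_eq)
    have "u * (edge 1 x - edge (-1) x) = y - edge (-1) x" using A by (simp add: u_def)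
    then show "Complex x y = (1 - u) *\<^sub>R Complex x (edge (-1) x) + u *\<^sub>R Complex x (edge 1 x)"
      by (simp add: complex_eq_iff algebra_simps)
  qed
  then show "Complex x y \<in> \<Omega>" using segment[OF K] A by auto
qed

lemma edge_le: "x \<in> {x_left..x_right} \<Longrightarrow> edge (-1) x \<le> edge 1 x"
  using edge_extreme[OF edge_in, of x 1 "-1"] by (simp only: mult_1)

lemma edge_ends: "edge (-1) x_left = edge 1 x_left" "edge (-1) x_right = edge 1 x_right"
proof -
  have "Complex x_left (edge s x_left) = \<tau> pi" "Complex x_right (edge s x_right) = \<tau> 0" for s
    using x_left_less_x_right by (auto intro!: Re_bounds(3,4) edge_in)
  then have "edge s x_left = Im (\<tau> pi)" "edge s x_right = Im (\<tau> 0)" for s by (metis complex.sel(2))+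
  then show "edge (-1) x_left = edge 1 x_left" "edge (-1) x_right = edge 1 x_right" by simp_all
qed

section \<open>Sas's parametrization of the boundary\<close>

definition x_mid :: real where "x_mid = (x_left + x_right) / 2"
definition x_rad :: real where "x_rad = (x_right - x_left) / 2"

text \<open>
The boundary is traversed counterclockwise, with an abscissa that depends on the cosine only.
\<close>

definition sas_x :: "real \<Rightarrow> real" where "sas_x \<phi> = x_mid + x_rad * cos \<phi>"
definition sas_y :: "real \<Rightarrow> real" where
  "sas_y \<phi> = (if sin \<phi> \<le> 0 then edge (-1) (sas_x \<phi>) else edge 1 (sas_x \<phi>))"
definition sas_pt :: "real \<Rightarrow> complex" where "sas_pt \<phi> = Complex (sas_x \<phi>) (sas_y \<phi>)"

lemma x_rad_pos: "x_rad > 0" using x_left_less_x_right by (simp add: x_rad_def)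

lemma sas_x_in: "sas_x \<phi> \<in> {x_left..x_right}"
proof -
  have "x_rad * cos \<phi> \<le> x_rad * 1" "x_rad * (- 1) \<le> x_rad * cos \<phi>" using x_rad_pos by (intro mult_left_mono; simp)+
  then show ?thesis by (simp add: sas_x_def x_mid_def x_rad_def field_simps)
qed

lemma sas_x_ends: "sas_x 0 = x_right" "sas_x pi = x_left" "sas_x (2 * pi) = x_right"
  by (simp_all add: sas_x_def x_mid_def x_rad_def field_simps)

lemma sas_pt_in_K: "sas_pt \<phi> \<in> K"
  by (simp add: sas_pt_def sas_y_def edge_in[OF sas_x_in])

lemma sas_2pi [simp]: "sas_x (\<phi> + 2 * pi) = sas_x \<phi>" "sas_y (\<phi> + 2 * pi) = sas_y \<phi>" "sas_pt (\<phi> + 2 * pi) = sas_pt \<phi>"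
  by (simp_all add: sas_x_def sas_y_def sas_pt_def)

lemma continuous_on_sas_x: "continuous_on S sas_x"
  unfolding sas_x_def by (intro continuous_intros)

lemma continuous_on_sas_y: "continuous_on S sas_y"
proof -
  have "continuous_on UNIV sas_y"
    unfolding sas_y_def
  proof (rule continuous_on_cases_le)
    show "continuous_on {x \<in> UNIV. sin x \<le> 0} (\<lambda>x. edge (-1) (sas_x x))"
      by (rule continuous_on_compose2[OF continuous_edge continuous_on_sas_x]) (use sas_x_in in auto)
    show "continuous_on {x \<in> UNIV. 0 \<le> sin x} (\<lambda>x. edge 1 (sas_x x))"
      by (rule continuous_on_compose2[OF continuous_edge continuous_on_sas_x]) (use sas_x_in in auto)
    fix x :: real assume "sin x = 0"
    then have "cos x = 1 \<or> cos x = -1" using sin_cos_squared_add[of x] by (simp add: power2_eq_1_iff)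
    then have "sas_x x = x_right \<or> sas_x x = x_left" by (auto simp: sas_x_def x_mid_def x_rad_def field_simps)
    then show "edge (-1) (sas_x x) = edge 1 (sas_x x)" using edge_ends by auto
  qed (intro continuous_intros)
  then show ?thesis using continuous_on_subset by blast
qed

lemma DERIV_sas_x: "(sas_x has_real_derivative - (x_rad * sin \<phi>)) (at \<phi> within S)"
  unfolding sas_x_def by (auto intro!: derivative_eq_intros)

text \<open>
The substitution \<open>x = sas_x \<phi>\<close> in the area under the upper and above the lower boundary function.
\<close>

lemma area_eq: "((\<lambda>\<phi>. x_rad * sin \<phi> * sas_y \<phi>) has_integral measure lebesgue \<Omega>) {0..2 * pi}"
proof -
  have ce: "continuous_on {x_left..x_right} (edge 1)" "continuous_on {x_left..x_right} (edge (-1))"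
    by (rule continuous_edge; simp)+
  let ?I = "\<lambda>s. integral {x_left..x_right} (edge s)"
  have hi: "(edge 1 has_integral ?I 1) {x_left..x_right}" "(edge (-1) has_integral ?I (-1)) {x_left..x_right}"
    using ce by (auto intro!: integrable_integral integrable_continuous_interval)
  have area: "measure lebesgue \<Omega> = ?I 1 - ?I (-1)"
    by (rule measure_between_graphs[OF open_\<Omega> mem_\<Omega>_iff edge_le has_integral_diff[OF hi]])
  have "((\<lambda>\<phi>. (- x_rad * sin \<phi>) *\<^sub>R edge 1 (sas_x \<phi>)) has_integral
      integral {sas_x 0..sas_x pi} (edge 1) - integral {sas_x pi..sas_x 0} (edge 1)) {0..pi}"
    by (rule has_integral_substitution_general[of "{}" _ _ _ x_left x_right])
      (use sas_x_in ce in \<open>auto intro: continuous_on_sas_x DERIV_sas_x\<close>)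
  then have 1: "((\<lambda>\<phi>. (- x_rad * sin \<phi>) * edge 1 (sas_x \<phi>)) has_integral - ?I 1) {0..pi}"
    using x_left_less_x_right by (simp add: sas_x_ends)
  have "((\<lambda>\<phi>. (- x_rad * sin \<phi>) *\<^sub>R edge (-1) (sas_x \<phi>)) has_integral
      integral {sas_x pi..sas_x (2 * pi)} (edge (-1)) - integral {sas_x (2 * pi)..sas_x pi} (edge (-1))) {pi..2 * pi}"
    by (rule has_integral_substitution_general[of "{}" _ _ _ x_left x_right])
      (use sas_x_in ce in \<open>auto intro: continuous_on_sas_x DERIV_sas_x\<close>)
  then have 2: "((\<lambda>\<phi>. (- x_rad * sin \<phi>) * edge (-1) (sas_x \<phi>)) has_integral ?I (-1)) {pi..2 * pi}"
    using x_left_less_x_right by (simp add: sas_x_ends)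
  have upper: "((\<lambda>\<phi>. x_rad * sin \<phi> * sas_y \<phi>) has_integral ?I 1) {0..pi}"
  proof (rule has_integral_eq[OF _ has_integral_neg[OF 1, simplified]])
    fix x assume "x \<in> {0..pi}"
    then have "sin x = 0 \<or> \<not> sin x \<le> 0" using sin_ge_zero[of x] by force
    then show "x_rad * sin x * edge 1 (sas_x x) = x_rad * sin x * sas_y x" by (auto simp: sas_y_def)
  qed
  have lower: "((\<lambda>\<phi>. x_rad * sin \<phi> * sas_y \<phi>) has_integral - ?I (-1)) {pi..2 * pi}"
  proof (rule has_integral_eq[OF _ has_integral_neg[OF 2, simplified]])
    fix x assume "x \<in> {pi..2 * pi}"
    then have "sin x \<le> 0" using sin_ge_zero[of "x - pi"] by simp
    then show "x_rad * sin x * edge (-1) (sas_x x) = x_rad * sin x * sas_y x" by (simp add: sas_y_def)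
  qed
  show ?thesis using has_integral_combine[OF _ _ upper lower] by (simp add: area)
qed

definition sas_area :: "real \<Rightarrow> real" where
  "sas_area \<phi> = cross2 (sas_pt (\<phi> + 2 * pi / 3) - sas_pt \<phi>) (sas_pt (\<phi> + 4 * pi / 3) - sas_pt \<phi>)"

lemma cos_thirds:
  "cos (x + 2 * pi / 3) = - (cos x / 2) - sqrt 3 / 2 * sin x"
  "cos (x + 4 * pi / 3) = - (cos x / 2) + sqrt 3 / 2 * sin x"
  "sin (x + 2 * pi / 3) = - (sin x / 2) + sqrt 3 / 2 * cos x"
  "sin (x + 4 * pi / 3) = - (sin x / 2) - sqrt 3 / 2 * cos x"
  using cis_thirds by (simp_all add: cos_add sin_add complex_eq_iff)

text \<open>
In the shoelace formula each ordinate is multiplied with the difference of the two other abscissae, and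
for parameters one third of a period apart this is a multiple of the sine. So the area is a sum over the
three vertices separately.
\<close>

lemma sas_area_eq:
  "sas_area \<phi> = sqrt 3 * (x_rad * sin \<phi> * sas_y \<phi> + x_rad * sin (\<phi> + 2 * pi / 3) * sas_y (\<phi> + 2 * pi / 3)
     + x_rad * sin (\<phi> + 4 * pi / 3) * sas_y (\<phi> + 4 * pi / 3))"
proof -
  have s3: "sqrt 3 * (sqrt 3 * t) = 3 * t" for t by (simp flip: mult.assoc)
  show ?thesis
    unfolding sas_area_def sas_pt_def cross2_def sas_x_def cos_thirds
    by (simp add: cos_thirds algebra_simps s3)
qed

lemma continuous_on_sas_area: "continuous_on S sas_area"
  unfolding sas_area_eq
  by (intro continuous_intros continuous_on_compose2[OF continuous_on_sas_y[of UNIV]]) auto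

lemma sas_area_third: "sas_area (\<phi> + 2 * pi / 3) = sas_area \<phi>"
proof -
  have e: "\<phi> + 2 * pi / 3 + 2 * pi / 3 = \<phi> + 4 * pi / 3" "\<phi> + 2 * pi / 3 + 4 * pi / 3 = \<phi> + 2 * pi"
    by simp_all
  show ?thesis unfolding sas_area_eq e by simp
qed

text \<open>
The three summands of \<open>sas_area_eq\<close> run through the three thirds of a period.
\<close>

lemma sas_average: "(sas_area has_integral sqrt 3 * measure lebesgue \<Omega>) {0..2 * pi / 3}"
proof -
  let ?s = "\<lambda>\<phi>. x_rad * sin \<phi> * sas_y \<phi>"
  have int: "?s integrable_on {a..b}" for a b
    by (intro integrable_continuous_interval continuous_intros continuous_on_sas_y)
  let ?I = "\<lambda>a b. integral {a..b} ?s"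
  have i1: "((\<lambda>\<phi>. ?s (\<phi> + c)) has_integral ?I c (2 * pi / 3 + c)) {0..2 * pi / 3}" for c
    using has_integral_shift_real_ivl[OF integrable_integral[OF int[of c "2 * pi / 3 + c"]], of c] by simp
  have "(sas_area has_integral sqrt 3 * (?I 0 (2 * pi / 3) + ?I (2 * pi / 3) (4 * pi / 3) + ?I (4 * pi / 3) (2 * pi))) {0..2 * pi / 3}"
    unfolding sas_area_eq
    using has_integral_mult_right[OF has_integral_add[OF has_integral_add[OF i1[of 0] i1[of "2 * pi / 3"]] i1[of "4 * pi / 3"]], of "sqrt 3"]
    by (simp add: add_divide_distrib[symmetric] field_simps)
  moreover have "?I 0 (2 * pi / 3) + ?I (2 * pi / 3) (4 * pi / 3) = ?I 0 (4 * pi / 3)"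
    by (intro Henstock_Kurzweil_Integration.integral_combine int) auto
  moreover have "?I 0 (4 * pi / 3) + ?I (4 * pi / 3) (2 * pi) = ?I 0 (2 * pi)"
    by (intro Henstock_Kurzweil_Integration.integral_combine int) auto
  moreover have "?I 0 (2 * pi) = measure lebesgue \<Omega>" by (rule integral_unique[OF area_eq])
  ultimately show ?thesis by simp
qed

lemma sas_inequality:
  assumes "\<And>p q r. \<lbrakk>p \<in> K; q \<in> K; r \<in> K\<rbrakk> \<Longrightarrow> cross2 (q - p) (r - p) \<le> D"
  shows "sqrt 3 * measure lebesgue \<Omega> \<le> 2 * pi / 3 * D"
    and "sqrt 3 * measure lebesgue \<Omega> = 2 * pi / 3 * D \<Longrightarrow> sas_area \<phi> = D"
proof -
  have le: "sas_area \<phi> \<le> D" for \<phi> unfolding sas_area_def by (intro assms sas_pt_in_K)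
  have D: "((\<lambda>\<phi>. D) has_integral 2 * pi / 3 * D) {0..2 * pi / 3}"
    using has_integral_const_real[of D 0 "2 * pi / 3"] by simp
  show "sqrt 3 * measure lebesgue \<Omega> \<le> 2 * pi / 3 * D"
    by (rule has_integral_le[OF sas_average D]) (rule le)
  assume eq: "sqrt 3 * measure lebesgue \<Omega> = 2 * pi / 3 * D"
  have "((\<lambda>\<phi>. D - sas_area \<phi>) has_integral 0) {0..2 * pi / 3}"
    using has_integral_diff[OF D sas_average] eq by simp
  moreover have "continuous_on {0..2 * pi / 3} (\<lambda>\<phi>. D - sas_area \<phi>)"
    by (intro continuous_intros continuous_on_sas_area)
  ultimately have *: "sas_area x = D" if "x \<in> {0..2 * pi / 3}" for x
    using has_integral_0_cbox_imp_0[of 0 "2 * pi / 3" "\<lambda>\<phi>. D - sas_area \<phi>" x] that le pi_gt_zero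
    by (simp add: not_le)
  \<comment> \<open>Rescaled to period \<open>2 * pi\<close>, so that \<open>reduce_2pi\<close> applies.\<close>
  define g where "g x = sas_area (x / 3)" for x
  have "g (x + 2 * pi) = g x" for x
    using sas_area_third[of "x / 3"] by (simp add: g_def add_divide_distrib)
  moreover obtain k where "0 \<le> 3 * \<phi> + 2 * pi * of_int k" "3 * \<phi> + 2 * pi * of_int k \<le> 2 * pi"
    using reduce_2pi .
  moreover from this have "g (3 * \<phi> + 2 * pi * of_int k) = D"
    unfolding g_def by (intro *) simp
  ultimately have "g (3 * \<phi>) = D" using periodic_int[of g "3 * \<phi>" k] by metis
  then show "sas_area \<phi> = D" by (simp add: g_def)
qed

text \<open>
Moving one vertex of a largest inscribed triangle does not increase the area, so the parallel to the
opposite side through this vertex is a support line.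
\<close>

lemma ex_max_triangle:
  obtains p q r where "midtangent_triangle K p q r"
    "\<And>p' q' r'. \<lbrakk>p' \<in> K; q' \<in> K; r' \<in> K\<rbrakk> \<Longrightarrow> cross2 (q' - p') (r' - p') \<le> cross2 (q - p) (r - p)"
proof -
  let ?D = "\<lambda>t. cross2 (fst (snd t) - fst t) (snd (snd t) - fst t)"
  have "continuous_on (K \<times> K \<times> K) ?D"
    unfolding cross2_def by (intro continuous_intros)
  moreover have "K \<times> K \<times> K \<noteq> {}" using nonempty by auto
  ultimately have "\<exists>t\<in>K \<times> K \<times> K. \<forall>t'\<in>K \<times> K \<times> K. ?D t' \<le> ?D t"
    by (intro continuous_attains_sup compact_Times compact_K)
  then obtain p q r where pqr: "p \<in> K" "q \<in> K" "r \<in> K"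
    and max: "\<And>p' q' r'. \<lbrakk>p' \<in> K; q' \<in> K; r' \<in> K\<rbrakk> \<Longrightarrow> cross2 (q' - p') (r' - p') \<le> cross2 (q - p) (r - p)"
    by fastforce
  obtain z where "z \<in> \<Omega>" using nonempty by blast
  then obtain e where e: "e > 0" "cball z e \<subseteq> K" by (rule ex_cball)
  then have "z \<in> K" "z + of_real e \<in> K" "z + \<i> * of_real e \<in> K"
    by (auto simp: dist_norm norm_mult intro!: subsetD[OF e(2)])
  from max[OF this] have pos: "0 < cross2 (q - p) (r - p)"
    using e(1) by (simp add: cross2_def algebra_simps) (smt (verit) mult_pos_pos)
  then have ne: "q - r \<noteq> 0" "r - p \<noteq> 0" "p - q \<noteq> 0"
    by (auto simp: cross2_def)
  have "0 \<le> cross2 (q - r) (z - p)" "0 \<le> cross2 (r - p) (z - q)" "0 \<le> cross2 (p - q) (z - r)" if "z \<in> K" for z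
    using max[OF that pqr(2,3)] max[OF pqr(1) that pqr(3)] max[OF pqr(1,2) that]
    by (simp_all add: cross2_def algebra_simps)
  then have "midtangent_triangle K p q r"
    using pqr ne by (simp add: midtangent_triangle_def left_support_def del: cross2_simps)
  with max that show thesis by blast
qed

end

section \<open>The equality case\<close>

lemma abs_cos_diff_le: "\<bar>cos y - cos x\<bar> \<le> \<bar>y - x :: real\<bar>"
  using abs_Re_le_cmod[of "cis y - cis x"] norm_cis_diff_le[of y x] by simp

lemma finite_sin_zeros: "finite {t \<in> {- M..M}. sin t = (0::real)}"
proof (rule finite_subset)
  show "{t \<in> {- M..M}. sin t = 0} \<subseteq> (\<lambda>i. real_of_int i * pi) ` {- \<lceil>M\<rceil>..\<lceil>M\<rceil>}"
  proof
    fix t assume "t \<in> {t \<in> {- M..M}. sin t = 0}"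
    then obtain i :: int where i: "t = real_of_int i * pi" "\<bar>t\<bar> \<le> M"
      by (auto simp: sin_zero_iff_int2)
    have "\<bar>real_of_int i\<bar> * 1 \<le> \<bar>real_of_int i\<bar> * pi" using pi_gt3 by (intro mult_left_mono) auto
    then have "\<bar>real_of_int i\<bar> \<le> M" using i by (simp add: abs_mult)
    then have "- \<lceil>M\<rceil> \<le> i" "i \<le> \<lceil>M\<rceil>" by linarith+
    then show "t \<in> (\<lambda>i. real_of_int i * pi) ` {- \<lceil>M\<rceil>..\<lceil>M\<rceil>}" using i by auto
  qed
qed auto

context convex_body begin

text \<open>
The rise of the side opposite to the vertex with parameter \<open>\<phi>\<close>.
\<close>

definition opp_rise :: "real \<Rightarrow> real" where
  "opp_rise \<phi> = sas_y (\<phi> + 2 * pi / 3) - sas_y (\<phi> + 4 * pi / 3)"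

lemma continuous_on_opp_rise: "continuous_on S opp_rise"
  unfolding opp_rise_def by (intro continuous_intros continuous_on_compose2[OF continuous_on_sas_y[of UNIV]]) auto

context
  fixes D :: real
  assumes max: "\<And>p q r. \<lbrakk>p \<in> K; q \<in> K; r \<in> K\<rbrakk> \<Longrightarrow> cross2 (q - p) (r - p) \<le> D"
    and extremal: "\<And>\<phi>. sas_area \<phi> = D"
begin

text \<open>
Moving the vertex with parameter \<open>\<phi>\<close> to the parameter \<open>\<psi>\<close> does not increase the area, which is affine in the
position of the vertex.
\<close>

lemma extremal_vertex: "sqrt 3 * sin \<phi> * (sas_y \<psi> - sas_y \<phi>) \<le> opp_rise \<phi> * (cos \<phi> - cos \<psi>)"
proof -
  have "cross2 (sas_pt (\<phi> + 2 * pi / 3) - sas_pt \<psi>) (sas_pt (\<phi> + 4 * pi / 3) - sas_pt \<psi>) \<le> sas_area \<phi>"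
    unfolding extremal by (intro max sas_pt_in_K)
  moreover have "cross2 (sas_pt (\<phi> + 2 * pi / 3) - sas_pt \<psi>) (sas_pt (\<phi> + 4 * pi / 3) - sas_pt \<psi>) - sas_area \<phi>
    = x_rad * (sqrt 3 * sin \<phi> * (sas_y \<psi> - sas_y \<phi>) - opp_rise \<phi> * (cos \<phi> - cos \<psi>))"
    unfolding sas_area_def sas_pt_def cross2_def sas_x_def opp_rise_def cos_thirds by (simp add: algebra_simps)
  ultimately have "x_rad * (sqrt 3 * sin \<phi> * (sas_y \<psi> - sas_y \<phi>) - opp_rise \<phi> * (cos \<phi> - cos \<psi>)) \<le> 0" by linarith
  then show ?thesis using x_rad_pos by (simp add: mult_le_0_iff)
qed

text \<open>
Applied to \<open>(\<phi>, x)\<close> and to \<open>(x, \<phi>)\<close>, \<open>extremal_vertex\<close> bounds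
the increment of \<open>sas_y\<close> from both sides by multiples of the increment of the cosine with nearly equal
factors.
\<close>

lemma DERIV_sas_y_generic:
  assumes "sin \<phi> \<noteq> 0"
  shows "(sas_y has_real_derivative opp_rise \<phi> / sqrt 3) (at \<phi>)"
proof -
  define k where "k x = opp_rise x / (sqrt 3 * sin x)" for x
  \<comment> \<open>It suffices that this combination has derivative 0 at \<open>\<phi>\<close>.\<close>
  let ?g = "\<lambda>x. sas_y x + k \<phi> * cos x"
  have "(?g has_real_derivative 0) (at \<phi>)"
  proof (rule DERIV_0_I)
    fix e :: real assume "e > 0"
    have "isCont opp_rise \<phi>" using continuous_on_opp_rise[of UNIV] by (simp add: continuous_on_eq_continuous_at)
    then have "isCont k \<phi>" unfolding k_def using assms by (intro continuous_intros) auto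
    then obtain d1 where d1: "d1 > 0" "\<And>x. \<bar>x - \<phi>\<bar> < d1 \<Longrightarrow> \<bar>k x - k \<phi>\<bar> < e"
      using \<open>e > 0\<close> unfolding continuous_at_eps_delta dist_real_def by meson
    have "isCont sin \<phi>" by simp
    then obtain d2 where d2: "d2 > 0" "\<And>x. \<bar>x - \<phi>\<bar> < d2 \<Longrightarrow> \<bar>sin x - sin \<phi>\<bar> < \<bar>sin \<phi>\<bar>"
      using assms unfolding continuous_at_eps_delta dist_real_def by (meson zero_less_abs_iff)
    have "\<bar>?g x - ?g \<phi>\<bar> \<le> e * \<bar>x - \<phi>\<bar>" if x: "\<bar>x - \<phi>\<bar> < min d1 d2" for x
    proof -
      let ?A = "?g x - ?g \<phi>" and ?B = "(k x - k \<phi>) * (cos x - cos \<phi>)"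
      have s: "\<bar>sin x - sin \<phi>\<bar> < \<bar>sin \<phi>\<bar>" using d2(2) x by simp
      have dk: "opp_rise y = k y * (sqrt 3 * sin y)" if "sin y \<noteq> 0" for y using that by (simp add: k_def)
      have "sin x \<noteq> 0" using s by auto
      have "(sqrt 3 * sin \<phi>) * ?A \<le> 0"
        using extremal_vertex[of \<phi> x] unfolding dk[OF assms] by (simp add: algebra_simps)
      moreover have "(sqrt 3 * sin x) * (- ?A - ?B) \<le> 0"
        using extremal_vertex[of x \<phi>] unfolding dk[OF \<open>sin x \<noteq> 0\<close>] by (simp add: algebra_simps)
      ultimately have "sin \<phi> * ?A \<le> 0" "sin x * (- ?A - ?B) \<le> 0"
        by (simp_all add: mult.assoc mult_le_0_iff)
      then have "\<bar>?A\<bar> \<le> \<bar>?B\<bar>"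
        using s assms unfolding mult_le_0_iff by linarith
      also have "\<dots> \<le> e * \<bar>x - \<phi>\<bar>"
        unfolding abs_mult using d1(2)[of x] x \<open>e > 0\<close> abs_cos_diff_le[of x \<phi>]
        by (intro mult_mono) auto
      finally show ?thesis .
    qed
    then show "\<exists>d>0. \<forall>y. \<bar>y - \<phi>\<bar> < d \<longrightarrow> \<bar>?g y - ?g \<phi>\<bar> \<le> e * \<bar>y - \<phi>\<bar>"
      using d1(1) d2(1) by (intro exI[of _ "min d1 d2"]) auto
  qed
  moreover have "((\<lambda>x. k \<phi> * cos x) has_real_derivative k \<phi> * - sin \<phi>) (at \<phi>)"
    by (auto intro!: derivative_eq_intros)
  ultimately have "((\<lambda>x. ?g x - k \<phi> * cos x) has_real_derivative 0 - k \<phi> * - sin \<phi>) (at \<phi>)"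
    by (rule DERIV_diff)
  then show ?thesis using assms by (simp add: k_def)
qed

text \<open>
At the zeros of the sine \<open>extremal_vertex\<close> says nothing, but \<open>sas_y\<close> is continuous there and its derivative
elsewhere extends continuously.
\<close>

lemma DERIV_sas_y: "(sas_y has_real_derivative opp_rise \<phi> / sqrt 3) (at \<phi>)"
proof -
  have "continuous_on UNIV (\<lambda>x. opp_rise x / sqrt 3)"
    by (intro continuous_intros continuous_on_opp_rise) auto
  then have "isCont (\<lambda>x. opp_rise x / sqrt 3) x" for x by (simp add: continuous_on_eq_continuous_at)
  then obtain Z where Z: "\<And>x. (Z has_real_derivative opp_rise x / sqrt 3) (at x)"
    using einterval_antiderivative[of "-\<infinity>" \<infinity> "\<lambda>x. opp_rise x / sqrt 3"]
    by (auto simp: has_real_derivative_iff_has_vector_derivative)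
  have cZ: "continuous_on S Z" for S
    using Z by (meson DERIV_isCont continuous_at_imp_continuous_on)
  have const: "sas_y x - Z x = sas_y 0 - Z 0" for x
  proof (rule has_derivative_zero_unique_strong_convex[of "{- \<bar>x\<bar>..\<bar>x\<bar>}" "{t \<in> {- \<bar>x\<bar>..\<bar>x\<bar>}. sin t = 0}" "\<lambda>x. sas_y x - Z x" 0])
    show "continuous_on {- \<bar>x\<bar>..\<bar>x\<bar>} (\<lambda>x. sas_y x - Z x)" by (intro continuous_intros continuous_on_sas_y cZ)
    fix t assume "t \<in> {- \<bar>x\<bar>..\<bar>x\<bar>} - {t \<in> {- \<bar>x\<bar>..\<bar>x\<bar>}. sin t = 0}"
    then have "sin t \<noteq> 0" by auto
    from DERIV_diff[OF DERIV_sas_y_generic[OF this] Z[of t]]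
    have "((\<lambda>x. sas_y x - Z x) has_real_derivative 0) (at t)" by simp
    then have "((\<lambda>x. sas_y x - Z x) has_derivative (*) 0) (at t)" by (simp add: has_field_derivative_def)
    moreover have "(*) (0::real) = (\<lambda>h. 0)" by auto
    ultimately show "((\<lambda>x. sas_y x - Z x) has_derivative (\<lambda>h. 0)) (at t within {- \<bar>x\<bar>..\<bar>x\<bar>})"
      by (simp add: has_derivative_at_withinI)
  qed (use finite_sin_zeros in auto)
  define k where "k = sas_y 0 - Z 0"
  have "sas_y x = Z x + k" for x using const[of x] by (simp add: k_def)
  then have "sas_y = (\<lambda>x. Z x + k)" by blast
  moreover have "((\<lambda>x. Z x + k) has_real_derivative opp_rise \<phi> / sqrt 3) (at \<phi>)"
    using DERIV_add[OF Z[of \<phi>] DERIV_const[of k]] by simp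
  ultimately show ?thesis by metis
qed

text \<open>
Since \<open>opp_rise\<close> telescopes over the three vertices, \<open>sas_y\<close> has constant sum \<open>3 * c\<close> over them. Differentiating
\<open>sas_y' = opp_rise / sqrt 3\<close> once more and eliminating with this constant gives the harmonic oscillator
\<open>sas_y'' = c - sas_y\<close>.
\<close>

lemma extremal_trigonometric: "\<exists>c A B. \<forall>\<phi>. sas_y \<phi> = c + A * cos \<phi> + B * sin \<phi>"
proof -
  have sh: "((\<lambda>x. sas_y (x + t)) has_real_derivative opp_rise (x + t) / sqrt 3) (at x)" for x t
    using DERIV_sas_y[of "x + t"] by (simp add: DERIV_shift)
  have per: "sas_y (x + 2 * pi / 3 + 2 * pi / 3) = sas_y (x + 4 * pi / 3)" "sas_y (x + 2 * pi / 3 + 4 * pi / 3) = sas_y x"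
    "sas_y (x + 4 * pi / 3 + 2 * pi / 3) = sas_y x" "sas_y (x + 4 * pi / 3 + 4 * pi / 3) = sas_y (x + 2 * pi / 3)" for x
  proof -
    have "x + 2 * pi / 3 + 2 * pi / 3 = x + 4 * pi / 3" "x + 2 * pi / 3 + 4 * pi / 3 = x + 2 * pi"
      "x + 4 * pi / 3 + 2 * pi / 3 = x + 2 * pi" "x + 4 * pi / 3 + 4 * pi / 3 = (x + 2 * pi / 3) + 2 * pi"
      by simp_all
    then show "sas_y (x + 2 * pi / 3 + 2 * pi / 3) = sas_y (x + 4 * pi / 3)" "sas_y (x + 2 * pi / 3 + 4 * pi / 3) = sas_y x"
    "sas_y (x + 4 * pi / 3 + 2 * pi / 3) = sas_y x" "sas_y (x + 4 * pi / 3 + 4 * pi / 3) = sas_y (x + 2 * pi / 3)"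
      by (simp_all only: sas_2pi)
  qed
  define c where "c = (sas_y 0 + sas_y (0 + 2 * pi / 3) + sas_y (0 + 4 * pi / 3)) / 3"
  have "((\<lambda>x. sas_y x + sas_y (x + 2 * pi / 3) + sas_y (x + 4 * pi / 3)) has_real_derivative 0) (at x)" for x
    using DERIV_add[OF DERIV_add[OF DERIV_sas_y[of x] sh[of "2 * pi / 3" x]] sh[of "4 * pi / 3" x]]
    unfolding opp_rise_def per by (simp add: add_divide_distrib[symmetric])
  then have sum: "sas_y x + sas_y (x + 2 * pi / 3) + sas_y (x + 4 * pi / 3) = 3 * c" for x
    using DERIV_isconst_all[of "\<lambda>x. sas_y x + sas_y (x + 2 * pi / 3) + sas_y (x + 4 * pi / 3)" x 0] by (simp add: c_def)
  define v where "v x = opp_rise x / sqrt 3" for x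
  have dv: "(v has_real_derivative c - sas_y x) (at x)" for x
  proof -
    have "v = (\<lambda>x. (sas_y (x + 2 * pi / 3) - sas_y (x + 4 * pi / 3)) / sqrt 3)"
      by (simp add: fun_eq_iff v_def opp_rise_def)
    then have "(v has_real_derivative
      (opp_rise (x + 2 * pi / 3) / sqrt 3 - opp_rise (x + 4 * pi / 3) / sqrt 3) / sqrt 3) (at x)"
      by (simp only:) (intro DERIV_cdivide DERIV_diff sh)
    moreover have "(opp_rise (x + 2 * pi / 3) / sqrt 3 - opp_rise (x + 4 * pi / 3) / sqrt 3) / sqrt 3
      = (opp_rise (x + 2 * pi / 3) - opp_rise (x + 4 * pi / 3)) / 3" by (simp add: diff_divide_distrib)
    moreover have "\<dots> = c - sas_y x" unfolding opp_rise_def per using sum[of x] by (simp add: field_simps)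
    ultimately show ?thesis by metis
  qed
  have dy: "(sas_y has_real_derivative v x) (at x)" for x using DERIV_sas_y by (simp add: v_def)
  define A where "A = (sas_y 0 - c) * cos 0 - v 0 * sin 0"
  define B where "B = (sas_y 0 - c) * sin 0 + v 0 * cos 0"
  have "((\<lambda>x. (sas_y x - c) * cos x - v x * sin x) has_real_derivative 0) (at x)"
    "((\<lambda>x. (sas_y x - c) * sin x + v x * cos x) has_real_derivative 0) (at x)" for x
    by (auto intro!: derivative_eq_intros dy dv simp: algebra_simps)
  then have AB: "(sas_y x - c) * cos x - v x * sin x = A" "(sas_y x - c) * sin x + v x * cos x = B" for x
    unfolding A_def B_def by (intro DERIV_isconst_all; blast)+
  have "sas_y x = c + A * cos x + B * sin x" for x
  proof -
    have "A * cos x + B * sin x = (sas_y x - c) * ((sin x)\<^sup>2 + (cos x)\<^sup>2)"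
      unfolding AB[of x, symmetric] by (simp add: algebra_simps power2_eq_square
          del: sin_cos_squared_add sin_cos_squared_add2 sin_cos_squared_add3)
    then show ?thesis by simp
  qed
  then show ?thesis by blast
qed

end

end

section \<open>Ellipses\<close>

text \<open>
Images of the unit disk under affine maps with triangular linear part: the abscissa depends on \<open>x\<close> only,
as in the parametrization of Sas.
\<close>

definition disk_image :: "real \<Rightarrow> real \<Rightarrow> real \<Rightarrow> real \<Rightarrow> real \<Rightarrow> complex set" where
  "disk_image m a c A B = {Complex (m + a * x) (c + A * x + B * y) | x y. x\<^sup>2 + y\<^sup>2 < 1}"

lemma ellipse_rotate:
  assumes "norm s = 1"
  shows "{z0 + (p * s) * w + (q * cnj s) * cnj w | w. norm w < 1} = {z0 + p * w + q * cnj w | w. norm w < (1::real)}"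
proof (intro equalityI subsetI)
  fix z assume "z \<in> {z0 + (p * s) * w + (q * cnj s) * cnj w | w. norm w < 1}"
  then obtain w where "norm w < 1" "z = z0 + (p * s) * w + (q * cnj s) * cnj w" by blast
  then show "z \<in> {z0 + p * w + q * cnj w | w. norm w < 1}"
    using assms by (intro CollectI exI[of _ "s * w"]) (simp add: norm_mult mult_ac)
next
  fix z assume "z \<in> {z0 + p * w + q * cnj w | w. norm w < 1}"
  then obtain w where w: "norm w < 1" "z = z0 + p * w + q * cnj w" by blast
  have "s * cnj s = 1" using assms by (simp add: complex_norm_square[symmetric])
  then have "(p * s) * (cnj s * w) = p * w" "(q * cnj s) * cnj (cnj s * w) = q * cnj w"
    by (simp_all add: mult_ac)
  then show "z \<in> {z0 + (p * s) * w + (q * cnj s) * cnj w | w. norm w < 1}"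
    using w assms by (intro CollectI exI[of _ "cnj s * w"]) (simp only: norm_mult complex_mod_cnj, simp)
qed

text \<open>
A real linear map of the plane has the form \<open>\<lambda>w. p * w + q * cnj w\<close> and preserves the orientation if and only
if \<open>norm q < norm p\<close>. Rotations before and after the map give \<open>p\<close> and \<open>q\<close> arbitrary arguments. If both become
real, the map scales the axes by \<open>norm p + norm q\<close> and \<open>norm p - norm q\<close>.
\<close>

lemma is_ellipse_iff_conformal:
  "is_ellipse \<Omega> \<longleftrightarrow> (\<exists>z0 p q. norm q < norm p \<and> \<Omega> = {z0 + p * w + q * cnj w | w. norm w < 1})"
proof
  have axes: "{z0 + cis \<alpha> * Complex x y | x y. (x / a)\<^sup>2 + (y / b)\<^sup>2 < 1} =
     {z0 + (cis \<alpha> * of_real ((a + b) / 2)) * w + (cis \<alpha> * of_real ((a - b) / 2)) * cnj w | w. norm w < 1}"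
    if ab: "a > 0" "b > 0" for a b \<alpha> z0
  proof -
    have e: "z0 + (cis \<alpha> * of_real ((a + b) / 2)) * w + (cis \<alpha> * of_real ((a - b) / 2)) * cnj w
      = z0 + cis \<alpha> * Complex (a * Re w) (b * Im w)" for w
      by (simp add: complex_eq_iff field_simps)
    have n: "norm w < 1 \<longleftrightarrow> (Re w)\<^sup>2 + (Im w)\<^sup>2 < 1" for w by (simp add: norm_complex_def)
    show ?thesis unfolding e n
    proof (intro equalityI subsetI)
      fix z assume "z \<in> {z0 + cis \<alpha> * Complex x y | x y. (x / a)\<^sup>2 + (y / b)\<^sup>2 < 1}"
      then obtain x y where "z = z0 + cis \<alpha> * Complex x y" "(x / a)\<^sup>2 + (y / b)\<^sup>2 < 1" by blast
      then show "z \<in> {z0 + cis \<alpha> * Complex (a * Re w) (b * Im w) | w. (Re w)\<^sup>2 + (Im w)\<^sup>2 < 1}"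
        using ab by (intro CollectI exI[of _ "Complex (x / a) (y / b)"]) simp
    next
      fix z assume "z \<in> {z0 + cis \<alpha> * Complex (a * Re w) (b * Im w) | w. (Re w)\<^sup>2 + (Im w)\<^sup>2 < 1}"
      then obtain w where "z = z0 + cis \<alpha> * Complex (a * Re w) (b * Im w)" "(Re w)\<^sup>2 + (Im w)\<^sup>2 < 1" by blast
      then show "z \<in> {z0 + cis \<alpha> * Complex x y | x y. (x / a)\<^sup>2 + (y / b)\<^sup>2 < 1}"
        using ab by (intro CollectI exI[of _ "a * Re w"] exI[of _ "b * Im w"]) simp
    qed
  qed
  {
    assume "is_ellipse \<Omega>"
    then obtain z0 \<alpha> a b where ab: "a > 0" "b > 0" and
      \<Omega>: "\<Omega> = {z0 + cis \<alpha> * Complex x y | x y. (x / a)\<^sup>2 + (y / b)\<^sup>2 < 1}"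
      unfolding is_ellipse_def by blast
    have "norm (cis \<alpha> * of_real ((a - b) / 2)) < norm (cis \<alpha> * of_real ((a + b) / 2))"
      using ab by (simp only: norm_mult norm_cis norm_of_real) (simp add: abs_if field_simps)
    then show "\<exists>z0 p q. norm q < norm p \<and> \<Omega> = {z0 + p * w + q * cnj w | w. norm w < 1}"
      unfolding \<Omega> axes[OF ab] by blast
  }
  assume "\<exists>z0 p q. norm q < norm p \<and> \<Omega> = {z0 + p * w + q * cnj w | w. norm w < 1}"
  then obtain z0 p q where pq: "norm q < norm p" and \<Omega>: "\<Omega> = {z0 + p * w + q * cnj w | w. norm w < 1}"
    by blast
  define \<alpha> where "\<alpha> = (Arg p + Arg q) / 2"
  define s where "s = cis ((Arg q - Arg p) / 2)"
  define a where "a = norm p + norm q"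
  define b where "b = norm p - norm q"
  have ab: "a > 0" "b > 0" using pq norm_ge_zero[of q] unfolding a_def b_def by linarith+
  have pol: "p = of_real (norm p) * cis (Arg p)" "q = of_real (norm q) * cis (Arg q)"
    using rcis_cmod_Arg[of p] rcis_cmod_Arg[of q] by (simp_all add: rcis_def)
  have "cis (Arg p) * s = cis \<alpha>" "cis (Arg q) * cnj s = cis \<alpha>"
    unfolding s_def \<alpha>_def cis_cnj cis_mult by (simp_all add: field_simps)
  then have "p * s = of_real (norm p) * cis \<alpha>" "q * cnj s = of_real (norm q) * cis \<alpha>"
    by (metis pol(1) mult.assoc, metis pol(2) mult.assoc)
  then have ps: "p * s = cis \<alpha> * of_real ((a + b) / 2)" "q * cnj s = cis \<alpha> * of_real ((a - b) / 2)"
    by (simp_all add: a_def b_def mult.commute)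
  have "norm s = 1" by (simp add: s_def)
  from ellipse_rotate[OF this, of z0 p q] have "\<Omega> = {z0 + (cis \<alpha> * of_real ((a + b) / 2)) * w + (cis \<alpha> * of_real ((a - b) / 2)) * cnj w | w. norm w < 1}"
    unfolding \<Omega> ps by (rule sym)
  then show "is_ellipse \<Omega>"
    unfolding axes[OF ab, symmetric] is_ellipse_def using ab by blast
qed

lemma disk_image_conformal:
  "disk_image m a c A B =
    {Complex m c + (Complex (a + B) A / 2) * w + (Complex (a - B) A / 2) * cnj w | w. norm w < 1}"
proof -
  have e: "Complex m c + (Complex (a + B) A / 2) * w + (Complex (a - B) A / 2) * cnj w
    = Complex (m + a * Re w) (c + A * Re w + B * Im w)" for w
    by (simp add: complex_eq_iff field_simps)
  have n: "norm w < 1 \<longleftrightarrow> (Re w)\<^sup>2 + (Im w)\<^sup>2 < 1" for w by (simp add: norm_complex_def)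
  show ?thesis unfolding e n disk_image_def
    by (intro equalityI subsetI; clarsimp) (metis complex.sel)+
qed

text \<open>
A preliminary rotation of the disk makes \<open>p + cnj q\<close> real, and then the abscissa of the image of \<open>w\<close> depends
on \<open>Re w\<close> only.
\<close>

lemma is_ellipse_iff_disk_image:
  "is_ellipse \<Omega> \<longleftrightarrow> (\<exists>m a c A B. a > 0 \<and> B > 0 \<and> \<Omega> = disk_image m a c A B)"
proof
  assume "is_ellipse \<Omega>"
  then obtain z0 p q where pq: "norm q < norm p" and \<Omega>: "\<Omega> = {z0 + p * w + q * cnj w | w. norm w < 1}"
    unfolding is_ellipse_iff_conformal by blast
  define t where "t = p + cnj q"
  have t: "t \<noteq> 0" using pq by (metis t_def add_eq_0_iff complex_mod_cnj norm_minus_cancel less_irrefl)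
  \<comment> \<open>The rotation that makes \<open>p + cnj q\<close> equal to its norm.\<close>
  define s where "s = cnj t / of_real (norm t)"
  define p' where "p' = p * s"
  define q' where "q' = q * cnj s"
  have s: "norm s = 1" using t by (simp add: s_def norm_divide)
  have "p' + cnj q' = t * s" by (simp add: p'_def q'_def t_def algebra_simps)
  also have "\<dots> = of_real (norm t)"
    using t complex_norm_square[of t] by (simp add: s_def power2_eq_square field_simps)
  finally have sum: "Re p' + Re q' = norm t" "Im p' = Im q'" by (simp_all add: complex_eq_iff)
  have "norm q' < norm p'" using pq s by (simp add: p'_def q'_def norm_mult)
  then have "(norm q')\<^sup>2 < (norm p')\<^sup>2" by (simp add: power_strict_mono)
  then have "0 < (Re p' + Re q') * (Re p' - Re q')"
    unfolding cmod_power2 sum(2) by (simp add: power2_eq_square algebra_simps)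
  then have B: "0 < Re p' - Re q'" using t unfolding sum(1) by (simp add: zero_less_mult_iff)
  have "p' = Complex (norm t + (Re p' - Re q')) (2 * Im p') / 2"
    "q' = Complex (norm t - (Re p' - Re q')) (2 * Im p') / 2"
    using sum by (simp_all add: complex_eq_iff)
  then have "disk_image (Re z0) (norm t) (Im z0) (2 * Im p') (Re p' - Re q') =
    {z0 + p' * w + q' * cnj w | w. norm w < 1}"
    unfolding disk_image_conformal complex_surj by metis
  also have "\<dots> = \<Omega>" unfolding \<Omega> p'_def q'_def by (rule ellipse_rotate[OF s])
  finally show "\<exists>m a c A B. a > 0 \<and> B > 0 \<and> \<Omega> = disk_image m a c A B" using t B by (metis zero_less_norm_iff)
next
  assume "\<exists>m a c A B. a > 0 \<and> B > 0 \<and> \<Omega> = disk_image m a c A B"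
  then obtain m a c A B where ab: "a > 0" "B > 0" and \<Omega>: "\<Omega> = disk_image m a c A B" by blast
  have "(a - B)\<^sup>2 < (a + B)\<^sup>2" using ab by (simp add: power2_eq_square algebra_simps)
  then have "norm (Complex (a - B) A / 2) < norm (Complex (a + B) A / 2)"
    by (simp add: norm_divide norm_complex_def power_divide)
  then show "is_ellipse \<Omega>" unfolding is_ellipse_iff_conformal \<Omega> disk_image_conformal by blast
qed

section \<open>Area and triangles of an ellipse\<close>

context convex_body begin

text \<open>
The affine map \<open>T\<close> from the disk multiplies all cross products by \<open>a * B\<close>, so it carries equilateral
triangles inscribed in the circle to midtangent triangles. The parametrization of Sas is the image of the
standard one of the circle, so \<open>sas_area\<close> is constant, and \<open>sas_average\<close> yields the area of the ellipse.
\<close>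

lemma disk_image_triangle:
  assumes \<Omega>: "\<Omega> = disk_image m a c A B" and ab: "a > 0" "B > 0"
  obtains p q r where "midtangent_triangle K p q r"
    "sqrt 3 * measure lebesgue \<Omega> = 2 * pi / 3 * cross2 (q - p) (r - p)"
proof -
  define T where "T w = Complex (m + a * Re w) (c + A * Re w + B * Im w)" for w
  have T_cross: "cross2 (T x - T y) (T z - T w) = a * B * cross2 (x - y) (z - w)" for x y z w
    by (simp add: T_def cross2_def algebra_simps)
  have n: "norm w < 1 \<longleftrightarrow> (Re w)\<^sup>2 + (Im w)\<^sup>2 < 1" for w by (simp add: norm_complex_def)
  have \<Omega>_T: "\<Omega> = T ` ball 0 1"
  proof (intro equalityI subsetI)
    fix z assume "z \<in> \<Omega>"
    then obtain x y where "z = Complex (m + a * x) (c + A * x + B * y)" "x\<^sup>2 + y\<^sup>2 < 1"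
      unfolding \<Omega> disk_image_def by blast
    then show "z \<in> T ` ball 0 1" by (intro image_eqI[of _ _ "Complex x y"]) (simp_all add: T_def n)
  next
    fix z assume "z \<in> T ` ball 0 1"
    then obtain w where "z = T w" "norm w < 1" by auto
    then show "z \<in> \<Omega>"
      unfolding \<Omega> disk_image_def n by (intro CollectI exI[of _ "Re w"] exI[of _ "Im w"]) (simp add: T_def)
  qed
  have cont: "continuous_on S T" for S
    unfolding T_def Complex_eq by (intro continuous_intros)
  have K_T: "K = T ` cball 0 1"
  proof
    have "closed (T ` cball 0 1)" by (intro compact_imp_closed compact_continuous_image cont) simp
    then show "K \<subseteq> T ` cball 0 1" unfolding \<Omega>_T by (intro closure_minimal image_mono) auto
    show "T ` cball 0 1 \<subseteq> K"
      unfolding \<Omega>_T using image_closure_subset[OF cont closed_closure closure_subset, of "ball 0 1"]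
      by simp
  qed
  have sup: "left_support K (T x) (T y - T z)" if "left_support (closure (ball 0 1)) x (y - z)" for x y z
  proof -
    have D: "x \<in> cball 0 1" "y \<noteq> z" "\<And>w. w \<in> cball 0 1 \<Longrightarrow> 0 \<le> cross2 (y - z) (w - x)"
      using that by (auto simp: left_support_def simp del: cross2_simps)
    have "T y \<noteq> T z" using D(2) ab by (auto simp: T_def complex_eq_iff)
    then show ?thesis
      unfolding left_support_def K_T using D ab
      by (auto simp: T_cross simp del: cross2_simps intro!: mult_nonneg_nonneg)
  qed
  have "midtangent_triangle (closure (ball 0 1)) (cis 0) (cis (0 + 2 * pi / 3)) (cis (0 + 4 * pi / 3))"
    using disk.critical_midtangent[OF critical_disk[of 0]] unfolding touch_disk .
  then have tri: "midtangent_triangle K (T (cis 0)) (T (cis (0 + 2 * pi / 3))) (T (cis (0 + 4 * pi / 3)))"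
    unfolding midtangent_triangle_def by (intro conjI sup) auto
  have Re_T: "\<bar>Re w\<bar> \<le> 1" if "w \<in> cball 0 1" for w :: complex
    using that abs_Re_le_cmod[of w] by simp
  have "\<tau> 0 = T 1"
  proof (rule touch_eqI)
    fix y assume "y \<in> K"
    then obtain w where w: "y = T w" "w \<in> cball 0 1" using K_T by auto
    have "a * Re w \<le> a * 1" using Re_T[OF w(2)] ab by (intro mult_left_mono) auto
    then show "y \<bullet> cis 0 \<le> T 1 \<bullet> cis 0" by (simp add: w T_def inner_complex_def)
  qed (auto simp: K_T)
  moreover have "\<tau> pi = T (- 1)"
  proof (rule touch_eqI)
    fix y assume "y \<in> K"
    then obtain w where w: "y = T w" "w \<in> cball 0 1" using K_T by auto
    have "a * (- 1) \<le> a * Re w" using Re_T[OF w(2)] ab by (intro mult_left_mono) auto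
    then show "y \<bullet> cis pi \<le> T (- 1) \<bullet> cis pi" by (simp add: w T_def inner_complex_def)
  qed (auto simp: K_T)
  ultimately have "x_right = m + a" "x_left = m - a" by (simp_all add: x_right_def x_left_def T_def)
  then have x_eq: "sas_x \<phi> = m + a * cos \<phi>" for \<phi> by (simp add: sas_x_def x_mid_def x_rad_def)
  have pt_eq: "sas_pt \<phi> = T (cis \<phi>)" for \<phi>
  proof -
    obtain w where w: "sas_pt \<phi> = T w" "w \<in> cball 0 1" using sas_pt_in_K[of \<phi>] K_T by auto
    have Re: "Re w = cos \<phi>" using arg_cong[OF w(1), of Re] ab by (simp add: sas_pt_def x_eq T_def)
    have y_eq: "sas_y \<phi> = c + A * cos \<phi> + B * Im w" using arg_cong[OF w(1), of Im] Re by (simp add: sas_pt_def T_def)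
    have "(Re w)\<^sup>2 + (Im w)\<^sup>2 \<le> 1" using w(2) by (simp add: norm_complex_def)
    then have "(Im w)\<^sup>2 \<le> (sin \<phi>)\<^sup>2" using sin_cos_squared_add[of \<phi>] unfolding Re by linarith
    then have Im: "\<bar>Im w\<bar> \<le> \<bar>sin \<phi>\<bar>" by (simp add: abs_le_square_iff)
    have "T (cis \<phi>) \<in> K" unfolding K_T by (intro imageI) simp
    then have K: "Complex (sas_x \<phi>) (c + A * cos \<phi> + B * sin \<phi>) \<in> K" by (simp add: T_def x_eq)
    have "Im w = sin \<phi>"
    proof (cases "sin \<phi> \<le> 0")
      case True
      then have "B * Im w \<le> B * sin \<phi>" using edge_extreme[OF K, of "-1"] y_eq by (simp add: sas_y_def)
      then show ?thesis using True Im ab by auto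
    next
      case False
      then have "B * sin \<phi> \<le> B * Im w" using edge_extreme[OF K, of 1] y_eq by (simp add: sas_y_def)
      then show ?thesis using False Im ab by auto
    qed
    then have "w = cis \<phi>" using Re by (simp add: complex_eq_iff)
    then show ?thesis using w by simp
  qed
  define D where "D = cross2 (T (cis (0 + 2 * pi / 3)) - T (cis 0)) (T (cis (0 + 4 * pi / 3)) - T (cis 0))"
  have "sas_area \<phi> = D" for \<phi>
  proof -
    have "cross2 (cis \<phi> * x) (cis \<phi> * y) = cross2 x y" for x y
    proof -
      have "cross2 (cis \<phi> * x) (cis \<phi> * y) = cross2 x y * ((sin \<phi>)\<^sup>2 + (cos \<phi>)\<^sup>2)"
        by (simp add: cross2_def algebra_simps power2_eq_square del: sin_cos_squared_add sin_cos_squared_add2 sin_cos_squared_add3)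
      then show ?thesis by simp
    qed
    from this[of "cis (2 * pi / 3) - 1" "cis (4 * pi / 3) - 1"] show ?thesis
      unfolding sas_area_def D_def pt_eq T_cross by (simp add: cis_mult right_diff_distrib del: cross2_simps)
  qed
  then have "sas_area = (\<lambda>_. D)" by blast
  then have "((\<lambda>_. D) has_integral sqrt 3 * measure lebesgue \<Omega>) {0..2 * pi / 3}"
    using sas_average by simp
  moreover have "((\<lambda>_. D) has_integral 2 * pi / 3 * D) {0..2 * pi / 3}"
    using has_integral_const_real[of D 0 "2 * pi / 3"] by simp
  ultimately have "sqrt 3 * measure lebesgue \<Omega> = 2 * pi / 3 * D" by (rule has_integral_unique)
  with tri that show thesis unfolding D_def by blast
qed

text \<open>
With trigonometric \<open>sas_y\<close> the upper and lower boundary functions are those of an ellipse.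
\<close>

lemma extremal_disk_image:
  assumes max: "\<And>p q r. \<lbrakk>p \<in> K; q \<in> K; r \<in> K\<rbrakk> \<Longrightarrow> cross2 (q - p) (r - p) \<le> D"
    and extremal: "\<And>\<phi>. sas_area \<phi> = D"
  shows "is_ellipse \<Omega>"
proof -
  obtain c A B where y_eq: "\<And>\<phi>. sas_y \<phi> = c + A * cos \<phi> + B * sin \<phi>"
    using extremal_trigonometric[OF max extremal] by blast
  have edges: "edge 1 (x_mid + x_rad * t) = c + A * t + B * sqrt (1 - t\<^sup>2)"
    "edge (-1) (x_mid + x_rad * t) = c + A * t - B * sqrt (1 - t\<^sup>2)" if "\<bar>t\<bar> < 1" for t
  proof -
    have t: "- 1 < t" "t < 1" using that by auto
    then have "t\<^sup>2 < 1" by (simp add: abs_square_less_1 that)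
    then have "0 < sqrt (1 - t\<^sup>2)" by simp
    then have s: "0 < sin (arccos t)" "sin (arccos t) = sqrt (1 - t\<^sup>2)" using t by (simp_all add: sin_arccos)
    show "edge 1 (x_mid + x_rad * t) = c + A * t + B * sqrt (1 - t\<^sup>2)"
      "edge (-1) (x_mid + x_rad * t) = c + A * t - B * sqrt (1 - t\<^sup>2)"
      using y_eq[of "arccos t"] y_eq[of "- arccos t"] s t by (simp_all add: sas_y_def sas_x_def)
  qed
  have range: "x_mid + x_rad * t \<in> {x_left<..<x_right} \<longleftrightarrow> \<bar>t\<bar> < 1" for t
  proof -
    have "x_mid + x_rad * t < x_right \<longleftrightarrow> x_rad * t < x_rad * 1" "x_left < x_mid + x_rad * t \<longleftrightarrow> x_rad * (- 1) < x_rad * t"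
      by (auto simp: x_mid_def x_rad_def field_simps)
    then show ?thesis
      unfolding greaterThanLessThan_iff mult_less_cancel_left_pos[OF x_rad_pos] abs_less_iff by auto
  qed
  have mem: "Complex (x_mid + x_rad * t) (c + A * t + B * y) \<in> \<Omega> \<longleftrightarrow> \<bar>t\<bar> < 1 \<and> - (B * sqrt (1 - t\<^sup>2)) < B * y \<and> B * y < B * sqrt (1 - t\<^sup>2)" for t y
    unfolding mem_\<Omega>_iff range using edges[of t] by auto
  have coords: "\<exists>t. Re z = x_mid + x_rad * t" for z
    using x_rad_pos by (intro exI[of _ "(Re z - x_mid) / x_rad"]) simp
  obtain z where z: "z \<in> \<Omega>" using nonempty by blast
  obtain t where t: "Re z = x_mid + x_rad * t" using coords by blast
  have "\<bar>t\<bar> < 1" "edge (-1) (x_mid + x_rad * t) < edge 1 (x_mid + x_rad * t)"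
    using z mem_\<Omega>_iff[of "Re z" "Im z"] range[of t] unfolding t[symmetric] by auto
  then have "0 < B * sqrt (1 - t\<^sup>2)" "0 \<le> sqrt (1 - t\<^sup>2)" using edges[of t] by (auto simp: abs_square_le_1)
  then have B: "B > 0" by (simp add: zero_less_mult_iff)
  have mem': "Complex (x_mid + x_rad * t) (c + A * t + B * y) \<in> \<Omega> \<longleftrightarrow> t\<^sup>2 + y\<^sup>2 < 1" for t y
  proof -
    have "- (B * sqrt (1 - t\<^sup>2)) < B * y \<longleftrightarrow> - sqrt (1 - t\<^sup>2) < y" "B * y < B * sqrt (1 - t\<^sup>2) \<longleftrightarrow> y < sqrt (1 - t\<^sup>2)"
      using B mult_less_cancel_left_pos[of B "- sqrt (1 - t\<^sup>2)" y] by simp_all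
    then have "Complex (x_mid + x_rad * t) (c + A * t + B * y) \<in> \<Omega> \<longleftrightarrow> \<bar>t\<bar> < 1 \<and> \<bar>y\<bar> < sqrt (1 - t\<^sup>2)"
      unfolding mem by auto
    also have "\<dots> \<longleftrightarrow> t\<^sup>2 < 1 \<and> y\<^sup>2 < 1 - t\<^sup>2"
      by (metis abs_square_less_1 real_sqrt_abs real_sqrt_less_iff)
    also have "\<dots> \<longleftrightarrow> t\<^sup>2 + y\<^sup>2 < 1" using zero_le_power2[of y] by linarith
    finally show ?thesis .
  qed
  have "\<Omega> = disk_image x_mid x_rad c A B"
  proof (intro equalityI subsetI)
    fix z assume z: "z \<in> \<Omega>"
    obtain t where t: "Re z = x_mid + x_rad * t" using coords by blast
    define y where "y = (Im z - c - A * t) / B"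
    have "z = Complex (x_mid + x_rad * t) (c + A * t + B * y)" using t B by (simp add: complex_eq_iff y_def)
    then show "z \<in> disk_image x_mid x_rad c A B" using z mem' unfolding disk_image_def by blast
  next
    fix z assume "z \<in> disk_image x_mid x_rad c A B"
    then show "z \<in> \<Omega>" using mem' unfolding disk_image_def by blast
  qed
  then show ?thesis using x_rad_pos B is_ellipse_iff_disk_image by blast
qed

end

theorem theorem5p3:
  fixes \<Omega> :: "complex set"
  assumes "bounded \<Omega>"
    and "strictly_convex_domain \<Omega>"
    and "C2_pos_curved_boundary \<Omega>"
    and "\<exists>\<Gamma>. invariant_curve \<Omega> \<Gamma> \<and> consists_of_3_periodic_points \<Omega> \<Gamma>"
  shows "beta_out \<Omega> (1/3) \<ge> measure lebesgue \<Omega> / pi * beta_out (ball 0 1) (1/3) \<and>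
         (beta_out \<Omega> (1/3) = measure lebesgue \<Omega> / pi * beta_out (ball 0 1) (1/3) \<longleftrightarrow> is_ellipse \<Omega>)"
proof -
  interpret convex_body \<Omega> using assms(1,2) by unfold_locales
  interpret tri_body \<Omega> using assms(3,4) invariant_curve_tri_body by blast
  obtain p q r where T: "midtangent_triangle K p q r"
    and max: "\<And>p' q' r'. \<lbrakk>p' \<in> K; q' \<in> K; r' \<in> K\<rbrakk> \<Longrightarrow> cross2 (q' - p') (r' - p') \<le> cross2 (q - p) (r - p)"
    using ex_max_triangle by metis
  define D where "D = cross2 (q - p) (r - p)"
  have max_D: "\<And>p' q' r'. \<lbrakk>p' \<in> K; q' \<in> K; r' \<in> K\<rbrakk> \<Longrightarrow> cross2 (q' - p') (r' - p') \<le> D"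
    unfolding D_def by (rule max)
  have beta: "beta_out \<Omega> (1/3) = 2 / 3 * D" unfolding D_def by (rule beta_out_area[OF T])
  have scale: "measure lebesgue \<Omega> / pi * beta_out (ball 0 1) (1/3) = (sqrt 3 * measure lebesgue \<Omega>) / pi"
    "2 / 3 * D = (2 * pi / 3 * D) / pi"
    by (simp_all add: beta_out_disk)
  have "beta_out \<Omega> (1/3) \<ge> measure lebesgue \<Omega> / pi * beta_out (ball 0 1) (1/3)"
    unfolding beta scale using sas_inequality(1)[OF max_D] by (intro divide_right_mono) auto
  moreover have "is_ellipse \<Omega>" if "beta_out \<Omega> (1/3) = measure lebesgue \<Omega> / pi * beta_out (ball 0 1) (1/3)"
  proof -
    have "sqrt 3 * measure lebesgue \<Omega> = 2 * pi / 3 * D"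
      using that unfolding beta scale by (metis divide_cancel_right pi_neq_zero)
    then show ?thesis using extremal_disk_image[OF max_D] sas_inequality(2)[OF max_D] by blast
  qed
  moreover have "beta_out \<Omega> (1/3) = measure lebesgue \<Omega> / pi * beta_out (ball 0 1) (1/3)" if ell: "is_ellipse \<Omega>"
  proof -
    obtain m a c A B where "a > 0" "B > 0" "\<Omega> = disk_image m a c A B"
      using ell is_ellipse_iff_disk_image by metis
    then obtain p' q' r' where T': "midtangent_triangle K p' q' r'"
      and area: "sqrt 3 * measure lebesgue \<Omega> = 2 * pi / 3 * cross2 (q' - p') (r' - p')"
      using disk_image_triangle by metis
    show ?thesis unfolding beta_out_area[OF T'] scale(1) area by simp
  qed
  ultimately show ?thesis by blast
qed

end
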